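(* Let $A,B$ be $n\times n$ complex positive semidefinite Hermitian matrices. Then the following dichotomy holds. (1) Assume there exists $\tau\ge 1$ such that $A\le\tau B$. Define $\Delta(A\|B)=\Delta(A_1\|B_1)\oplus 0$ with respect to the orthogonal decomposition $\mathbb{C}^n=B\mathbb{C}^n\oplus\ker B$, where $A_1=A|_{B\mathbb{C}^n}$ and $B_1=B|_{B\mathbb{C}^n}$. Then $\Delta(A\|B)$ is a positive semidefinite Hermitian matrix and $$\Delta(A\|B)=\int_1^\infty\big(\gamma^{-1}(A-\gamma B)_++\gamma^{-2}(B-\gamma A)_+\big)\,d\gamma .$$ (2) Assume there is no $\tau\ge1$ such that $A\le \tau B$. Then the integral on the right-hand side above diverges to an unbounded nonnegative operator; more precisely, there exists $\mathbf{x}\in\mathbb{C}^n$ such that $B\mathbf{x}=0$ and $\mathbf{x}^*A\mathbf{x}>0$, and hence $$\lim_{t\to\infty}\Big\|\int_1^t\big(\gamma^{-1}(A-\gamma B)_++\gamma^{-2}(B-\gamma A)_+\big)\,d\gamma\Big\|=\infty .$$ In particular, in the formula $$D(A\|B)=\int_{-\infty}^\infty\frac{dt}{|t|(t-1)^2}\operatorname{Tr}\big((1-t)A+tB\big)_-$$ both sides are equal to $\infty$.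
   Context: For Hermitian $T$, $\{T>0\}$ is the orthogonal projection onto the span of eigenvectors with positive eigenvalues, $T_+=T\{T>0\}$, $T_-=-T\{-T>0\}$, so $T=T_+-T_-$. $A\le C$ means $C-A$ is positive semidefinite. $\|\cdot\|$ is the operator norm. For $A\ge 0$ and $B>0$ (on a finite-dimensional Hilbert space) the divergence operator is $$\Delta(A\|B):=A(\log A-\log B)-B\,D\log[B](A)+B,\qquad D\log[B](A):=\lim_{t\to0}\frac{\log(B+tA)-\log B}{t},$$ with $A\log A$ defined using $0\log 0=0$. If $0\le A\le\tau B$ then $A$ vanishes on $\ker B$ and maps $B\mathbb{C}^n$ to itself, so $A_1,B_1$ are operators on $B\mathbb{C}^n$ with $A_1\ge0$, $B_1>0$. $D(A\|B):=\operatorname{Tr}\big(A(\log A-\log B)-A+B\big)$ is the divergence (relative entropy), with the usual convention that $D(A\|B)=+\infty$ when the support of $A$ is not contained in the support of $B$. *)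

theory Defs
  imports "HOL-Analysis.Analysis"
begin

definition cinner :: "complex ^ 'n \<Rightarrow> complex ^ 'n \<Rightarrow> complex" where
  "cinner x y = (\<Sum>i\<in>UNIV. cnj (x $ i) * y $ i)"

definition hermitian :: "complex ^ 'n ^ 'n \<Rightarrow> bool" where
  "hermitian M \<longleftrightarrow> transpose M = (\<chi> i j. cnj (M $ i $ j))"

(* For Hermitian M the value of the quadratic form is real, so taking Re loses nothing. *)
definition psd :: "complex ^ 'n ^ 'n \<Rightarrow> bool" where
  "psd M \<longleftrightarrow> hermitian M \<and> (\<forall>x. 0 \<le> Re (cinner x (M *v x)))"

definition loewner_le :: "complex ^ 'n ^ 'n \<Rightarrow> complex ^ 'n ^ 'n \<Rightarrow> bool" where
  "loewner_le A C \<longleftrightarrow> psd (C - A)"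

definition op_norm :: "complex ^ 'n ^ 'n \<Rightarrow> real" where
  "op_norm M = onorm ((*v) M)"

definition orth_proj :: "(complex ^ 'n) set \<Rightarrow> complex ^ 'n ^ 'n" where
  "orth_proj V = (THE P. \<forall>x. P *v x \<in> V \<and> (\<forall>y\<in>V. cinner y (x - P *v x) = 0))"

definition spectral_pos :: "complex ^ 'n ^ 'n \<Rightarrow> complex ^ 'n ^ 'n" where
  "spectral_pos T =
     orth_proj (vec.span {x. x \<noteq> 0 \<and> (\<exists>r::real. 0 < r \<and> T *v x = complex_of_real r *s x)})"

definition pos_part :: "complex ^ 'n ^ 'n \<Rightarrow> complex ^ 'n ^ 'n" where
  "pos_part T = T ** spectral_pos T"

definition neg_part :: "complex ^ 'n ^ 'n \<Rightarrow> complex ^ 'n ^ 'n" where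
  "neg_part T = - T ** spectral_pos (- T)"

(* An operator T on a complex subspace V of C^n is represented by the n-by-n matrix of its
   extension by zero to the orthogonal complement of V, i.e. by the direct sum of T and 0.
   For a matrix M that maps V to itself, restrict_op V M is the restriction of M to V. *)
definition restrict_op :: "(complex ^ 'n) set \<Rightarrow> complex ^ 'n ^ 'n \<Rightarrow> complex ^ 'n ^ 'n" where
  "restrict_op V M = M ** orth_proj V"

(* Functional calculus of a self-adjoint operator T on V: only eigenvectors lying in V count, so
   the zero extension to the orthogonal complement contributes no eigenvalue 0, and the
   result is again an operator on V extended by zero. *)
definition eigenspace_on ::
  "(complex ^ 'n) set \<Rightarrow> complex ^ 'n ^ 'n \<Rightarrow> real \<Rightarrow> (complex ^ 'n) set" where
  "eigenspace_on V T r = {x \<in> V. T *v x = complex_of_real r *s x}"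

definition spectrum_on :: "(complex ^ 'n) set \<Rightarrow> complex ^ 'n ^ 'n \<Rightarrow> real set" where
  "spectrum_on V T = {r. \<exists>x \<in> eigenspace_on V T r. x \<noteq> 0}"

definition fun_calc_on ::
  "(complex ^ 'n) set \<Rightarrow> (real \<Rightarrow> real) \<Rightarrow> complex ^ 'n ^ 'n \<Rightarrow> complex ^ 'n ^ 'n" where
  "fun_calc_on V f T = (\<Sum>r \<in> spectrum_on V T. f r *\<^sub>R orth_proj (eigenspace_on V T r))"

definition log_on :: "(complex ^ 'n) set \<Rightarrow> complex ^ 'n ^ 'n \<Rightarrow> complex ^ 'n ^ 'n" where
  "log_on V T = fun_calc_on V ln T"

definition xlogx_on :: "(complex ^ 'n) set \<Rightarrow> complex ^ 'n ^ 'n \<Rightarrow> complex ^ 'n ^ 'n" where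
  "xlogx_on V T = fun_calc_on V (\<lambda>r. r * ln r) T"

definition Dlog_on ::
  "(complex ^ 'n) set \<Rightarrow> complex ^ 'n ^ 'n \<Rightarrow> complex ^ 'n ^ 'n \<Rightarrow> complex ^ 'n ^ 'n" where
  "Dlog_on V B A = Lim (at (0::real)) (\<lambda>t. (1 / t) *\<^sub>R (log_on V (B + t *\<^sub>R A) - log_on V B))"

(* The divergence operator of A \<ge> 0 and B > 0 on the Hilbert space V. *)
definition div_op_on ::
  "(complex ^ 'n) set \<Rightarrow> complex ^ 'n ^ 'n \<Rightarrow> complex ^ 'n ^ 'n \<Rightarrow> complex ^ 'n ^ 'n" where
  "div_op_on V A B = xlogx_on V A - A ** log_on V B - B ** Dlog_on V B A + B"

definition div_op :: "complex ^ 'n ^ 'n \<Rightarrow> complex ^ 'n ^ 'n \<Rightarrow> complex ^ 'n ^ 'n" where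
  "div_op A B = (let V = range ((*v) B) in div_op_on V (restrict_op V A) (restrict_op V B))"

(* The support of a Hermitian matrix is its range; log B is taken on the support of B. *)
definition rel_entropy :: "complex ^ 'n ^ 'n \<Rightarrow> complex ^ 'n ^ 'n \<Rightarrow> ereal" where
  "rel_entropy A B =
     (if range ((*v) A) \<subseteq> range ((*v) B)
      then ereal (Re (trace (xlogx_on UNIV A - A ** log_on (range ((*v) B)) B - A + B)))
      else \<infinity>)"

definition div_integrand ::
  "complex ^ 'n ^ 'n \<Rightarrow> complex ^ 'n ^ 'n \<Rightarrow> real \<Rightarrow> complex ^ 'n ^ 'n" where
  "div_integrand A B g =
     (1 / g) *\<^sub>R pos_part (A - g *\<^sub>R B) + (1 / g\<^sup>2) *\<^sub>R pos_part (B - g *\<^sub>R A)"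

end

(*
  For B > 0 write I(A,B) for the integral and f(r) = r ln r.  The heart of the proof is that
  N(A) = f(A) + B - I(A,B) is linear in A.  Since I(B + tA, B) = O(t^2), this linearity gives
  f(B + tA) = f(B) + t N(A) + O(t^2), so N(A) is the derivative of f at B in direction A, and
  rewriting it through the derivative of log turns I(A,B) = f(A) + B - N(A) into the divergence
  operator.

  For linearity, expand absolute values and logarithms into resolvents.  For fixed s > 0 the
  function w |-> (s - iA + wB)^-1 is holomorphic on Re w >= 0 and decays like 1/w, so a contour
  integral along the imaginary axis gives
     int_0^oo Re[(s + i(gB - A))^-1 - (s + i(gB + A))^-1] dg/g = pi A / (s^2 + A^2).
  Multiply by s and integrate over s: the left side becomes the integral of
  (pi/2)(|gB + A| - |gB - A|)/g, the right side pi s A/(s^2 + A^2) integrates to -pi f(A).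
  Both integrals diverge logarithmically, but linear combinations with sum c_k A_k = 0 converge
  absolutely in (g,s), and Fubini applies to them.

  For singular B, replace B by B + Q, where Q is the projection onto ker B.  If A is not dominated
  by any multiple of B, a vector x with Bx = 0 and x*Ax > 0 makes the integrand at least x*Ax/g.
*)
theory Submission
  imports Defs "HOL-Complex_Analysis.Complex_Analysis"
begin

unbundle no fps_syntax
no_notation fps_nth (infixl "$" 75)

section \<open>Hermitian forms and spectral projections\<close>

text \<open>The obstacle is that A and B need not commute, so neither f(A) nor the positive parts of
  A - gB can be compared eigenvalue by eigenvalue. All integrals are therefore tested on one fixed
  vector x, where they are scalar, and a Hermitian matrix is recovered from its quadratic form. The
  combinations converge because the first-order term of each resolvent difference is linear in A_k
  and drops out when sum c_k A_k = 0. The sum of the c_k is left free, so the outcome is linearity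
  and not only affinity. The summand B of N(A) appears when the half-line is cut at g = 1. Above 1
  the absolute values are expressed through (A - gB)_+. Below 1 they are expressed through (gB -
  A)_+, which leaves a constant multiple of B on an interval of length 1; g -> 1/g then turns this
  piece into gamma^-2 (B - gamma A)_+. The integral at B + tA is O(t^2) because its integrand has
  size O(|t|) and lives on an interval of length O(|t|) starting at gamma = 1.\<close>

lemma cinner_add_right: "cinner x (y + z) = cinner x y + cinner x z"
  by (simp add: cinner_def distrib_left sum.distrib)

lemma cinner_add_left: "cinner (x + y) z = cinner x z + cinner y z"
  by (simp add: cinner_def distrib_right sum.distrib)

lemma cinner_diff_right: "cinner x (y - z) = cinner x y - cinner x z"
  by (simp add: cinner_def right_diff_distrib sum_subtractf)

lemma cinner_diff_left: "cinner (x - y) z = cinner x z - cinner y z"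
  by (simp add: cinner_def left_diff_distrib sum_subtractf)

lemma cinner_minus_right: "cinner x (- y) = - cinner x y"
  by (simp add: cinner_def sum_negf)

lemma cinner_minus_left: "cinner (- x) y = - cinner x y"
  by (simp add: cinner_def sum_negf)

lemma cinner_smult_right: "cinner x (c *s y) = c * cinner x y"
  by (simp add: cinner_def sum_distrib_left mult_ac)

lemma cinner_smult_left: "cinner (c *s x) y = cnj c * cinner x y"
  by (simp add: cinner_def sum_distrib_left mult_ac)

lemma cinner_scaleR_right: "cinner x (r *\<^sub>R y) = of_real r * cinner x y"
  by (simp add: cinner_def sum_distrib_left mult_ac scaleR_conv_of_real[where 'a=complex])

lemma cinner_scaleR_left: "cinner (r *\<^sub>R x) y = of_real r * cinner x y"
  by (simp add: cinner_def sum_distrib_left mult_ac scaleR_conv_of_real[where 'a=complex])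

lemma cinner_zero_right [simp]: "cinner x 0 = 0"
  by (simp add: cinner_def)

lemma cinner_zero_left [simp]: "cinner 0 x = 0"
  by (simp add: cinner_def)

lemma cinner_sum_right: "cinner x (\<Sum>i\<in>I. f i) = (\<Sum>i\<in>I. cinner x (f i))"
  by (induction I rule: infinite_finite_induct) (auto simp: cinner_add_right)

lemma cinner_commute: "cinner y x = cnj (cinner x y)"
  by (simp add: cinner_def mult.commute)

lemma inner_eq_Re_cinner: "inner x y = Re (cinner x y)"
  by (simp add: cinner_def inner_vec_def inner_complex_def)

lemma cinner_same: "cinner x x = of_real ((norm x)\<^sup>2)"
proof (rule complex_eqI)
  show "Re (cinner x x) = Re (of_real ((norm x)\<^sup>2))"
    by (simp add: inner_eq_Re_cinner[symmetric] power2_norm_eq_inner)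
  show "Im (cinner x x) = Im (of_real ((norm x)\<^sup>2))"
    using arg_cong[OF cinner_commute[of x x], of Im] by simp
qed

lemma cinner_eq_zero_iff [simp]: "cinner x x = 0 \<longleftrightarrow> x = 0"
  by (simp add: cinner_same)

lemma norm_vec_smult: "norm (c *s (x :: complex ^ 'n)) = cmod c * norm x"
  by (simp add: norm_vec_def norm_mult L2_set_right_distrib)

text \<open>Multiplying \<open>y\<close> by the conjugate phase \<open>c\<close> makes the pairing
  real and nonnegative, which reduces the claim to the real Cauchy-Schwarz inequality.\<close>

lemma norm_cinner_le: "cmod (cinner x y) \<le> norm x * norm y"
proof -
  define c where "c = cnj (sgn (cinner x y))"
  have *: "of_real (cmod (cinner x y)) = cinner x (c *s y)"
  proof (cases "cinner x y = 0")
    case False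
    have "cnj (cinner x y) * cinner x y = (of_real (cmod (cinner x y)))\<^sup>2"
      using complex_norm_square[of "cinner x y"] by (simp add: mult.commute)
    with False show ?thesis
      by (simp add: cinner_smult_right c_def sgn_eq power2_eq_square)
  qed (simp add: cinner_smult_right)
  have "cmod (cinner x y) = inner x (c *s y)"
    using arg_cong[OF *, of Re] by (simp add: inner_eq_Re_cinner)
  also have "\<dots> \<le> norm x * norm (c *s y)"
    by (rule norm_cauchy_schwarz)
  also have "\<dots> \<le> norm x * norm y"
    by (intro mult_left_mono) (simp_all add: norm_vec_smult c_def norm_sgn)
  finally show ?thesis .
qed

lemma smult_of_real: "complex_of_real r *s x = r *\<^sub>R x"
  by (simp add: vec_eq_iff scaleR_conv_of_real[where 'a=complex])

lemma cinner_axis: "cinner (axis i 1) x = x $ i"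
proof -
  have "cinner (axis i 1) x = (\<Sum>j\<in>UNIV. if j = i then x $ j else 0)"
    unfolding cinner_def by (rule sum.cong) (auto simp: axis_def)
  then show ?thesis by simp
qed

lemma matrix_vector_mult_axis: "(M *v axis j (1 :: complex)) $ i = M $ i $ j"
proof -
  have "(M *v axis j 1) $ i = (\<Sum>k\<in>UNIV. if k = j then M $ i $ k else 0)"
    unfolding matrix_vector_mult_def vec_lambda_beta by (rule sum.cong) (auto simp: axis_def)
  then show ?thesis by simp
qed

lemma hermitian_nth:
  assumes "hermitian M"
  shows "cnj (M $ j $ i) = M $ i $ j"
proof -
  have "transpose M $ i $ j = (\<chi> i j. cnj (M $ i $ j)) $ i $ j"
    using assms unfolding hermitian_def by (rule arg_cong[where f="\<lambda>X. X $ i $ j"])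
  then show ?thesis
    by (simp add: transpose_def)
qed

lemma hermitianI: "(\<And>i j. cnj (M $ j $ i) = M $ i $ j) \<Longrightarrow> hermitian M"
  unfolding hermitian_def transpose_def by (simp add: vec_eq_iff)

lemma hermitian_cinner: "hermitian M \<longleftrightarrow> (\<forall>x y. cinner x (M *v y) = cinner (M *v x) y)"
proof
  assume h: "hermitian M"
  show "\<forall>x y. cinner x (M *v y) = cinner (M *v x) y"
  proof (intro allI)
    fix x y
    have "cinner x (M *v y) = (\<Sum>i\<in>UNIV. \<Sum>j\<in>UNIV. cnj (x $ i) * (M $ i $ j * y $ j))"
      by (simp add: cinner_def matrix_vector_mult_def sum_distrib_left)
    also have "\<dots> = (\<Sum>j\<in>UNIV. \<Sum>i\<in>UNIV. cnj (x $ i) * (M $ i $ j * y $ j))"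
      by (rule sum.swap)
    also have "\<dots> = cinner (M *v x) y"
      by (simp add: cinner_def matrix_vector_mult_def sum_distrib_right sum_distrib_left hermitian_nth[OF h] mult_ac)
    finally show "cinner x (M *v y) = cinner (M *v x) y" .
  qed
next
  assume a: "\<forall>x y. cinner x (M *v y) = cinner (M *v x) y"
  show "hermitian M"
  proof (rule hermitianI)
    fix i j
    have "cinner (axis i 1) (M *v axis j 1) = cnj (cinner (axis j 1) (M *v axis i 1))"
      using a cinner_commute by metis
    then show "cnj (M $ j $ i) = M $ i $ j"
      by (simp add: cinner_axis matrix_vector_mult_axis)
  qed
qed

lemma hermitianD: "hermitian M \<Longrightarrow> cinner (M *v x) y = cinner x (M *v y)"
  using hermitian_cinner by metis

lemma matrix_vector_mult_scaleR_left: "(r *\<^sub>R M) *v x = r *\<^sub>R (M *v (x :: complex ^ 'n))"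
  by (simp add: matrix_vector_mult_def vec_eq_iff scaleR_sum_right)

lemma matrix_vector_mult_minus_left: "(- M) *v x = - (M *v (x :: complex ^ 'n))"
  by (simp add: matrix_vector_mult_def vec_eq_iff sum_negf)

lemma matrix_vector_mult_sum_left: "(\<Sum>i\<in>I. M i) *v x = (\<Sum>i\<in>I. M i *v (x :: complex ^ 'n))"
  by (induction I rule: infinite_finite_induct) (auto simp: matrix_vector_mult_add_rdistrib)

lemma matrix_vector_mult_sum_right: "M *v (\<Sum>i\<in>I. f i) = (\<Sum>i\<in>I. M *v (f i :: complex ^ 'n))"
  by (induction I rule: infinite_finite_induct) (auto simp: matrix_vector_right_distrib)

lemma matrix_vector_mult_smult: "M *v (c *s x) = c *s (M *v (x :: complex ^ 'n))"
  by (simp add: vec.scale)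

lemma matrix_vector_mult_scaleR_right: "M *v (r *\<^sub>R x) = r *\<^sub>R (M *v (x :: complex ^ 'n))"
  using matrix_vector_mult_smult[of M "of_real r" x] by (simp add: smult_of_real)

lemma hermitian_zero [simp]: "hermitian 0"
  and hermitian_one [simp]: "hermitian (mat 1)"
  and hermitian_add: "hermitian M \<Longrightarrow> hermitian N \<Longrightarrow> hermitian (M + N)"
  and hermitian_diff: "hermitian M \<Longrightarrow> hermitian N \<Longrightarrow> hermitian (M - N)"
  and hermitian_minus: "hermitian M \<Longrightarrow> hermitian (- M)"
  and hermitian_scaleR: "hermitian M \<Longrightarrow> hermitian (r *\<^sub>R M)"
  unfolding hermitian_cinner
  by (simp_all add: matrix_vector_mult_add_rdistrib matrix_vector_mult_diff_rdistrib
      matrix_vector_mult_minus_left matrix_vector_mult_scaleR_left cinner_add_left cinner_add_right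
      cinner_diff_left cinner_diff_right cinner_minus_left cinner_minus_right
      cinner_scaleR_left cinner_scaleR_right)

lemma hermitian_sum: "(\<And>i. i \<in> I \<Longrightarrow> hermitian (M i)) \<Longrightarrow> hermitian (\<Sum>i\<in>I. M i)"
  by (induction I rule: infinite_finite_induct) (auto simp: hermitian_add)

text \<open>The real quadratic form of M. It determines a Hermitian matrix, so matrix identities and
  matrix integrals can be treated as real scalar statements, one vector at a time.\<close>

definition qform :: "complex ^ 'n ^ 'n \<Rightarrow> complex ^ 'n \<Rightarrow> real" where
  "qform M x = Re (cinner x (M *v x))"

lemma qform_add: "qform (M + N) x = qform M x + qform N x"
  and qform_diff: "qform (M - N) x = qform M x - qform N x"
  and qform_minus: "qform (- M) x = - qform M x"
  and qform_scaleR: "qform (r *\<^sub>R M) x = r * qform M x"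
  and qform_zero [simp]: "qform 0 x = 0"
  and qform_zero_right [simp]: "qform M 0 = 0"
  and qform_one: "qform (mat 1) x = (norm x)\<^sup>2"
  by (simp_all add: qform_def matrix_vector_mult_add_rdistrib matrix_vector_mult_diff_rdistrib
      matrix_vector_mult_minus_left matrix_vector_mult_scaleR_left cinner_add_right
      cinner_diff_right cinner_minus_right cinner_scaleR_right cinner_same flip: of_real_power)

lemma qform_sum: "qform (\<Sum>i\<in>I. M i) x = (\<Sum>i\<in>I. qform (M i) x)"
  by (induction I rule: infinite_finite_induct) (auto simp: qform_add)

lemma psd_qform: "psd M \<longleftrightarrow> hermitian M \<and> (\<forall>x. 0 \<le> qform M x)"
  by (simp add: psd_def qform_def)

lemma cinner_hermitian_real: "hermitian M \<Longrightarrow> cinner x (M *v x) = of_real (qform M x)"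
proof -
  assume "hermitian M"
  then have "cnj (cinner x (M *v x)) = cinner x (M *v x)"
    by (metis cinner_commute hermitianD)
  then have "Im (cinner x (M *v x)) = 0"
    by (metis cnj.sel(2) neg_equal_zero)
  then show ?thesis by (simp add: complex_eq_iff qform_def)
qed

text \<open>Real polarization suffices: expanding the form of the difference \<open>D\<close> at x +
  y shows that the real part of <x, D y> vanishes for all x and y, and at x = D y it equals |D
  y|^2.\<close>

lemma hermitian_eqI:
  assumes "hermitian M" "hermitian N" "\<And>x. qform M x = qform N x"
  shows "M = N"
proof -
  define D where "D = M - N"
  have D: "hermitian D" "\<And>x. qform D x = 0"
    using assms by (auto simp: D_def hermitian_diff qform_diff)
  have re: "Re (cinner x (D *v y)) = 0" for x y
  proof -
    have "Re (cinner y (D *v x)) = Re (cinner x (D *v y))"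
      by (metis D(1) cinner_commute cnj.sel(1) hermitianD)
    then have "qform D (x + y) = qform D x + qform D y + 2 * Re (cinner x (D *v y))"
      by (simp add: qform_def matrix_vector_right_distrib cinner_add_left cinner_add_right)
    then show ?thesis using D(2) by simp
  qed
  have "D *v y = 0" for y
    using re[of "D *v y" y] by (simp add: cinner_same flip: of_real_power)
  then have "D = 0" by (metis matrix_eq matrix_vector_mult_0)
  then show ?thesis by (simp add: D_def)
qed

text \<open>With y = M x, the form at x + t y is 2 t |y|^2 + O(t^2), which is negative for small t <
  0 unless y = 0. The version on an invariant subspace serves the construction of eigenvectors,
  where M is nonnegative only on \<open>W\<close>.\<close>

lemma qform_zero_imp_kernel_on:
  assumes W: "vec.subspace W" "\<And>x. x \<in> W \<Longrightarrow> M *v x \<in> W"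
    and M: "hermitian M" "\<And>x. x \<in> W \<Longrightarrow> 0 \<le> qform M x"
    and x: "x \<in> W" "qform M x = 0"
  shows "M *v x = 0"
proof (rule ccontr)
  define y where "y = M *v x"
  assume "M *v x \<noteq> 0"
  then have n: "norm y > 0" by (simp add: y_def)
  have ineq: "0 \<le> 2 * t * (norm y)\<^sup>2 + t\<^sup>2 * qform M y" for t
  proof -
    have "x + t *\<^sub>R y \<in> W"
      using W x by (metis smult_of_real vec.subspace_add vec.subspace_scale y_def)
    then have "0 \<le> qform M (x + t *\<^sub>R y)" by (rule M)
    also have "\<dots> = qform M x + 2 * t * Re (cinner y (M *v x)) + t\<^sup>2 * qform M y"
    proof -
      have "Re (cinner x (M *v y)) = Re (cinner y (M *v x))"
        by (metis M(1) cinner_commute cnj.sel(1) hermitianD)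
      then show ?thesis
        by (simp add: qform_def matrix_vector_right_distrib cinner_add_left cinner_add_right
          matrix_vector_mult_scaleR_right cinner_scaleR_left cinner_scaleR_right power2_eq_square
          algebra_simps)
    qed
    finally show ?thesis using x by (simp add: y_def[symmetric] cinner_same flip: of_real_power)
  qed
  \<comment> \<open>The \<open>+ 1\<close> keeps \<open>K\<close> positive, so that \<open>t\<close>
    can be formed. With this \<open>t\<close> the quadratic term is at most half as large as the
    linear one.\<close>
  define K where "K = \<bar>qform M y\<bar> + 1"
  have K: "K > 0" "qform M y \<le> K" by (auto simp: K_def)
  define t where "t = - ((norm y)\<^sup>2 / K)"
  have "t\<^sup>2 * qform M y \<le> t\<^sup>2 * K" using K by (intro mult_left_mono) auto
  also have "t\<^sup>2 * K = - t * (norm y)\<^sup>2" using K by (simp add: t_def power2_eq_square)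
  finally have "0 \<le> t * (norm y)\<^sup>2" using ineq[of t] by simp
  moreover have "t < 0" using n K by (simp add: t_def)
  ultimately show False using n by (simp add: zero_le_mult_iff)
qed

lemma qform_zero_imp_kernel: "psd M \<Longrightarrow> qform M x = 0 \<Longrightarrow> M *v x = 0"
  using qform_zero_imp_kernel_on[of UNIV M x] by (simp add: psd_qform vec.subspace_UNIV)

lemma continuous_on_qform: "continuous_on S (qform M)"
  unfolding qform_def cinner_def matrix_vector_mult_def
  by (intro continuous_intros)

lemma subspace_real: "vec.subspace (V :: (complex ^ 'n) set) \<Longrightarrow> subspace V"
  by (metis smult_of_real subspace_def vec.subspace_def)

text \<open>If x maximizes the form on the unit sphere of \<open>W\<close> and r is the maximum,
  then r - T is nonnegative on \<open>W\<close> with value 0 at x, so (r - T) x = 0.\<close>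

lemma exists_eigenvector:
  assumes W: "vec.subspace W" "\<And>x. x \<in> W \<Longrightarrow> T *v x \<in> W" "W \<noteq> {0}"
    and T: "hermitian T"
  shows "\<exists>x\<in>W. x \<noteq> 0 \<and> (\<exists>r::real. T *v x = complex_of_real r *s x)"
proof -
  define S where "S = W \<inter> sphere 0 1"
  have "0 \<in> W" using W by (simp add: vec.subspace_0)
  with W(3) obtain w where w: "w \<in> W" "w \<noteq> 0" by blast
  have "(1 / norm w) *\<^sub>R w \<in> S"
    using w W(1) by (auto simp: S_def subspace_real subspace_scale)
  then have "S \<noteq> {}" by blast
  moreover have "compact S"
    unfolding S_def by (intro closed_Int_compact closed_subspace subspace_real W compact_sphere)
  ultimately obtain x where x: "x \<in> S" and max: "\<And>y. y \<in> S \<Longrightarrow> qform T y \<le> qform T x"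
    using continuous_attains_sup[OF _ _ continuous_on_qform] by meson
  define r where "r = qform T x"
  define M where "M = r *\<^sub>R mat 1 - T"
  have nx: "norm x = 1" "x \<in> W" using x by (auto simp: S_def)
  have "M *v x = 0"
  proof (rule qform_zero_imp_kernel_on[OF W(1)])
    show "hermitian M" using T by (simp add: M_def hermitian_diff hermitian_scaleR)
    show "x \<in> W" "qform M x = 0" using nx by (auto simp: M_def qform_diff qform_scaleR qform_one r_def)
    show "M *v y \<in> W" if "y \<in> W" for y
      using that W by (simp add: M_def matrix_vector_mult_diff_rdistrib matrix_vector_mult_scaleR_left
          vec.subspace_diff subspace_real subspace_scale)
    show "0 \<le> qform M y" if "y \<in> W" for y
    proof (cases "y = 0")
      case False
      have "(1 / norm y) *\<^sub>R y \<in> S"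
        using that False W(1) by (auto simp: S_def subspace_real subspace_scale)
      from max[OF this] have "(1 / norm y)\<^sup>2 * qform T y \<le> r"
        by (simp add: r_def qform_def matrix_vector_mult_scaleR_right cinner_scaleR_left cinner_scaleR_right
            power2_eq_square)
      then show ?thesis using False
        by (simp add: M_def qform_diff qform_scaleR qform_one field_simps)
    qed auto
  qed
  then have "T *v x = of_real r *s x"
    by (simp add: M_def matrix_vector_mult_diff_rdistrib matrix_vector_mult_scaleR_left smult_of_real)
  with nx show ?thesis by (intro bexI[of _ x]) auto
qed

text \<open>The decomposition used here is orthogonal for the real inner product. Since V is closed
  under multiplication by \<i>, testing with y and with \<i> y kills both the real and the imaginary
  part of <y, z>. Uniqueness of the decomposition then makes the projection complex linear, hence a
  matrix.\<close>

lemma orth_proj_exists: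
  assumes V: "vec.subspace (V :: (complex ^ 'n) set)"
  shows "\<exists>P. \<forall>x. P *v x \<in> V \<and> (\<forall>y\<in>V. cinner y (x - P *v x) = 0)"
proof -
  have "\<exists>v. v \<in> V \<and> (\<forall>y\<in>V. cinner y (x - v) = 0)" for x
  proof -
    obtain v z where vz: "v \<in> span V" "\<And>w. w \<in> span V \<Longrightarrow> orthogonal z w" "x = v + z"
      using orthogonal_subspace_decomp_exists[of V x] by blast
    have sp: "span V = V" using subspace_real[OF V] by (simp add: span_eq_iff)
    have "cinner y z = 0" if "y \<in> V" for y
    proof -
      have re: "Re (cinner w z) = 0" if "w \<in> V" for w
        using vz(2)[of w] that unfolding sp orthogonal_commute[of z]
        by (simp add: orthogonal_def inner_eq_Re_cinner)
      have "\<i> *s y \<in> V" using that V by (simp add: vec.subspace_scale)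
      from re[OF this] re[OF that] show ?thesis by (simp add: cinner_smult_left complex_eq_iff)
    qed
    then show ?thesis using vz sp by (intro exI[of _ v]) auto
  qed
  then obtain p where p: "\<And>x. p x \<in> V" "\<And>x y. y \<in> V \<Longrightarrow> cinner y (x - p x) = 0"
    by metis
  have uniq: "v = p x" if "v \<in> V" "\<And>y. y \<in> V \<Longrightarrow> cinner y (x - v) = 0" for v x
  proof -
    have "p x - v \<in> V" using that p V by (simp add: vec.subspace_diff)
    then have "cinner (p x - v) (x - v) - cinner (p x - v) (x - p x) = 0"
      using that p by simp
    then show ?thesis by (simp flip: cinner_diff_right)
  qed
  have "Vector_Spaces.linear (*s) (*s) p"
  proof (unfold_locales)
    show "p (x + y) = p x + p y" for x y
    proof (rule uniq[symmetric])
      show "p x + p y \<in> V" using p V by (simp add: vec.subspace_add)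
      show "cinner z (x + y - (p x + p y)) = 0" if "z \<in> V" for z
        using p(2)[OF that, of x] p(2)[OF that, of y]
        by (simp add: cinner_diff_right cinner_add_right)
    qed
    show "p (c *s x) = c *s p x" for c x
    proof (rule uniq[symmetric])
      show "c *s p x \<in> V" using p V by (simp add: vec.subspace_scale)
      show "cinner z (c *s x - c *s p x) = 0" if "z \<in> V" for z
        using p(2)[OF that, of x] by (simp add: cinner_diff_right cinner_smult_right)
    qed
  qed
  then have "matrix p *v x = p x" for x by (rule matrix_works)
  with p show ?thesis by (intro exI[of _ "matrix p"]) auto
qed

lemma orth_proj_unique:
  assumes V: "vec.subspace (V :: (complex ^ 'n) set)"
    and "v \<in> V" "\<And>y. y \<in> V \<Longrightarrow> cinner y (x - v) = 0"
    and "w \<in> V" "\<And>y. y \<in> V \<Longrightarrow> cinner y (x - w) = 0"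
  shows "v = w"
proof -
  have "v - w \<in> V" using assms by (simp add: vec.subspace_diff)
  then have "cinner (v - w) (x - w) - cinner (v - w) (x - v) = 0"
    using assms by simp
  then show ?thesis by (simp flip: cinner_diff_right)
qed

context
  fixes V :: "(complex ^ 'n) set"
  assumes V: "vec.subspace V"
begin

lemma orth_proj_props: "orth_proj V *v x \<in> V \<and> (\<forall>y\<in>V. cinner y (x - orth_proj V *v x) = 0)"
proof -
  obtain P where P: "\<And>x. P *v x \<in> V \<and> (\<forall>y\<in>V. cinner y (x - P *v x) = 0)"
    using orth_proj_exists[OF V] by blast
  have "P' = P" if "\<forall>x. P' *v x \<in> V \<and> (\<forall>y\<in>V. cinner y (x - P' *v x) = 0)" for P'
  proof -
    have "P' *v x = P *v x" for x
      using that P[of x] by (intro orth_proj_unique[OF V, of "P' *v x" x]) auto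
    then show ?thesis by (simp add: matrix_eq)
  qed
  then have "orth_proj V = P" using P unfolding orth_proj_def by (intro the_equality) auto
  with P show ?thesis by simp
qed

lemma orth_proj_in: "orth_proj V *v x \<in> V"
  using orth_proj_props by blast

lemma orth_proj_orth: "y \<in> V \<Longrightarrow> cinner y (x - orth_proj V *v x) = 0"
  using orth_proj_props by blast

lemma orth_proj_cinner: "y \<in> V \<Longrightarrow> cinner y (orth_proj V *v x) = cinner y x"
  using orth_proj_orth[of y x] by (simp add: cinner_diff_right)

lemma orth_proj_ident: "x \<in> V \<Longrightarrow> orth_proj V *v x = x"
  using orth_proj_in orth_proj_orth by (intro orth_proj_unique[OF V, of _ x]) auto

lemma orth_proj_eq_0: "(\<And>y. y \<in> V \<Longrightarrow> cinner y x = 0) \<Longrightarrow> orth_proj V *v x = 0"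
  using orth_proj_in orth_proj_orth V by (intro orth_proj_unique[OF V, of _ x]) (auto simp: vec.subspace_0)

lemma orth_proj_hermitian: "hermitian (orth_proj V)"
  unfolding hermitian_cinner
proof (intro allI)
  fix x y
  have "cinner (orth_proj V *v x) (orth_proj V *v y) = cinner (orth_proj V *v x) y"
    by (rule orth_proj_cinner[OF orth_proj_in])
  moreover have "cinner (orth_proj V *v y) (orth_proj V *v x) = cinner (orth_proj V *v y) x"
    by (rule orth_proj_cinner[OF orth_proj_in])
  ultimately show "cinner x (orth_proj V *v y) = cinner (orth_proj V *v x) y"
    by (metis cinner_commute)
qed

lemma orth_proj_idem: "orth_proj V *v (orth_proj V *v x) = orth_proj V *v x"
  by (rule orth_proj_ident[OF orth_proj_in])

lemma qform_orth_proj: "qform (orth_proj V) x = (norm (orth_proj V *v x))\<^sup>2"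
proof -
  have "cinner x (orth_proj V *v x) = of_real ((norm (orth_proj V *v x))\<^sup>2)"
    using hermitianD[OF orth_proj_hermitian, of x "orth_proj V *v x"]
    by (simp add: orth_proj_idem cinner_same)
  then show ?thesis by (simp add: qform_def del: of_real_power)
qed

end

section \<open>Spectral theorem for a Hermitian matrix on an invariant subspace\<close>

lemma subspace_eigenspace_on: "vec.subspace V \<Longrightarrow> vec.subspace (eigenspace_on V T r)"
  by (auto simp: vec.subspace_def eigenspace_on_def matrix_vector_right_distrib vec.scale
      vec.scale_right_distrib mult.commute)

context
  fixes V :: "(complex ^ 'n) set" and T :: "complex ^ 'n ^ 'n"
  assumes V: "vec.subspace V" and T: "hermitian T" and TV: "\<And>x. x \<in> V \<Longrightarrow> T *v x \<in> V"
begin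

lemma eigenspaces_orth:
  assumes "x \<in> eigenspace_on V T r" "y \<in> eigenspace_on V T q" "r \<noteq> q"
  shows "cinner x y = 0"
proof -
  have "cinner (T *v x) y = cinner x (T *v y)" by (rule hermitianD[OF T])
  then have "of_real r * cinner x y = of_real q * cinner x y"
    using assms by (simp add: eigenspace_on_def cinner_smult_left cinner_smult_right)
  with assms(3) show ?thesis by simp
qed

text \<open>Eigenvectors for distinct eigenvalues are orthogonal, so choosing one for each
  eigenvalue injects the spectrum into a linearly independent set.\<close>

lemma finite_spectrum_on: "finite (spectrum_on V T)"
proof -
  define v where "v r = (SOME x. x \<in> eigenspace_on V T r \<and> x \<noteq> 0)" for r
  have v: "v r \<in> eigenspace_on V T r \<and> v r \<noteq> 0" if "r \<in> spectrum_on V T" for r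
  proof -
    have "\<exists>x. x \<in> eigenspace_on V T r \<and> x \<noteq> 0" using that by (auto simp: spectrum_on_def)
    then show ?thesis unfolding v_def by (rule someI_ex)
  qed
  have inj: "inj_on v (spectrum_on V T)"
  proof (rule inj_onI)
    fix r q assume rq: "r \<in> spectrum_on V T" "q \<in> spectrum_on V T" "v r = v q"
    show "r = q"
      using eigenspaces_orth[of "v r" r "v q" q] v[OF rq(1)] v[OF rq(2)] rq(3) by auto
  qed
  have "independent (v ` spectrum_on V T)"
  proof (rule pairwise_orthogonal_independent)
    show "pairwise orthogonal (v ` spectrum_on V T)"
    proof (rule pairwiseI)
      fix x y assume "x \<in> v ` spectrum_on V T" "y \<in> v ` spectrum_on V T" "x \<noteq> y"
      then obtain r q where "r \<in> spectrum_on V T" "q \<in> spectrum_on V T" "x = v r" "y = v q" "r \<noteq> q"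
        by auto
      then have "cinner x y = 0" using v eigenspaces_orth[of x r y q] by auto
      then show "orthogonal x y" by (simp add: orthogonal_def inner_eq_Re_cinner)
    qed
    show "0 \<notin> v ` spectrum_on V T" using v by auto
  qed
  then have "finite (v ` spectrum_on V T)" by (rule independent_imp_finite)
  with inj show ?thesis by (simp add: finite_image_iff)
qed

lemma proj_eigenspace_eigenvector:
  assumes "x \<in> eigenspace_on V T r"
  shows "orth_proj (eigenspace_on V T q) *v x = (if q = r then x else 0)"
  using assms eigenspaces_orth subspace_eigenspace_on[OF V]
  by (auto intro!: orth_proj_ident orth_proj_eq_0)

text \<open>The vectors of V orthogonal to all eigenspaces form a T-invariant subspace
  \<open>W\<close>. If it were nonzero it would contain an eigenvector, which would be orthogonal to
  itself.\<close>

lemma sum_proj_eigenspaces: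
  "(\<Sum>r\<in>spectrum_on V T. orth_proj (eigenspace_on V T r)) = orth_proj V" (is "?S = _")
proof -
  have "?S *v x = orth_proj V *v x" for x
  proof -
    define z where "z = orth_proj V *v x - ?S *v x"
    define W where "W = {w \<in> V. \<forall>r. \<forall>y\<in>eigenspace_on V T r. cinner y w = 0}"
    have SV: "?S *v x \<in> V"
      unfolding matrix_vector_mult_sum_left
      using orth_proj_in[OF subspace_eigenspace_on[OF V]] V
      by (intro vec.subspace_sum) (auto simp: eigenspace_on_def)
    have zV: "z \<in> V" unfolding z_def using SV V orth_proj_in[OF V] by (simp add: vec.subspace_diff)
    have zW: "z \<in> W"
      unfolding W_def
    proof (intro CollectI conjI allI ballI zV)
      fix r y assume y: "y \<in> eigenspace_on V T r"
      then have yV: "y \<in> V" by (simp add: eigenspace_on_def)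
      have 1: "cinner y (orth_proj (eigenspace_on V T q) *v x) = (if q = r then cinner y x else 0)" for q
        using hermitianD[OF orth_proj_hermitian[OF subspace_eigenspace_on[OF V, of T q]], of y x]
        by (simp add: proj_eigenspace_eigenvector[OF y] split: if_splits)
      have "cinner y (?S *v x) = (\<Sum>q\<in>spectrum_on V T. if q = r then cinner y x else 0)"
        by (simp add: matrix_vector_mult_sum_left cinner_sum_right 1)
      also have "\<dots> = cinner y x"
        using y finite_spectrum_on by (cases "y = 0") (auto simp: spectrum_on_def)
      finally show "cinner y z = 0"
        by (simp add: z_def cinner_diff_right orth_proj_cinner[OF V yV])
    qed
    have "W = {0}"
    proof (rule ccontr)
      assume "W \<noteq> {0}"
      moreover have "vec.subspace W"
        using V by (auto simp: W_def vec.subspace_def cinner_add_right cinner_smult_right)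
      moreover have "T *v w \<in> W" if "w \<in> W" for w
        unfolding W_def
      proof (intro CollectI conjI allI ballI)
        show "T *v w \<in> V" using that TV by (simp add: W_def)
        fix r y assume y: "y \<in> eigenspace_on V T r"
        have "cinner y (T *v w) = cinner (T *v y) w" by (simp add: hermitianD[OF T])
        also have "\<dots> = 0" using y that by (auto simp: eigenspace_on_def cinner_smult_left W_def)
        finally show "cinner y (T *v w) = 0" .
      qed
      ultimately obtain u r where u: "u \<in> W" "u \<noteq> 0" "T *v u = complex_of_real r *s u"
        using exists_eigenvector[of W T] T by blast
      then have "u \<in> eigenspace_on V T r" by (simp add: W_def eigenspace_on_def)
      with u have "cinner u u = 0" unfolding W_def by blast
      with u show False by simp
    qed
    with zW show ?thesis by (simp add: z_def)
  qed
  then show ?thesis by (simp add: matrix_eq)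
qed

lemma fun_calc_on_eigenvector:
  assumes "x \<in> eigenspace_on V T r"
  shows "fun_calc_on V f T *v x = f r *\<^sub>R x"
proof -
  have "fun_calc_on V f T *v x = (\<Sum>q\<in>spectrum_on V T. if q = r then f r *\<^sub>R x else 0)"
    unfolding fun_calc_on_def matrix_vector_mult_sum_left
    by (intro sum.cong refl) (auto simp: matrix_vector_mult_scaleR_left proj_eigenspace_eigenvector[OF assms])
  also have "\<dots> = f r *\<^sub>R x"
    using assms finite_spectrum_on by (cases "x = 0") (auto simp: spectrum_on_def)
  finally show ?thesis .
qed

lemma fun_calc_on_orth:
  assumes "\<And>y. y \<in> V \<Longrightarrow> cinner y x = 0"
  shows "fun_calc_on V f T *v x = 0"
proof -
  have "orth_proj (eigenspace_on V T q) *v x = 0" for q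
    using assms by (intro orth_proj_eq_0 subspace_eigenspace_on V) (auto simp: eigenspace_on_def)
  then show ?thesis
    by (simp add: fun_calc_on_def matrix_vector_mult_sum_left matrix_vector_mult_scaleR_left)
qed

text \<open>The eigenvectors in V and the orthogonal complement of V together span the space, so
  identities about the functional calculus need only be tested there: on an eigenvector it acts as a
  scalar, on the complement as 0.\<close>

lemma eq_on_eigenvectors:
  assumes "\<And>r x. x \<in> eigenspace_on V T r \<Longrightarrow> M *v x = N *v x"
    and "\<And>x. (\<And>y. y \<in> V \<Longrightarrow> cinner y x = 0) \<Longrightarrow> M *v x = N *v x"
  shows "M = N"
proof -
  have "M *v x = N *v x" for x
  proof -
    have x: "x = (\<Sum>r\<in>spectrum_on V T. orth_proj (eigenspace_on V T r)) *v x + (x - orth_proj V *v x)"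
      by (simp add: sum_proj_eigenspaces)
    have "M *v (x - orth_proj V *v x) = N *v (x - orth_proj V *v x)"
      by (rule assms(2)) (rule orth_proj_orth[OF V])
    then show ?thesis
      by (subst (1 2) x) (simp add: matrix_vector_right_distrib matrix_vector_mult_sum_left
          matrix_vector_mult_sum_right assms(1)[OF orth_proj_in[OF subspace_eigenspace_on[OF V]]])
  qed
  then show ?thesis by (simp add: matrix_eq)
qed

lemma hermitian_fun_calc_on: "hermitian (fun_calc_on V f T)"
  unfolding fun_calc_on_def
  by (intro hermitian_sum hermitian_scaleR orth_proj_hermitian subspace_eigenspace_on V)

end

section \<open>Functional calculus and positive parts\<close>

abbreviation fc :: "(real \<Rightarrow> real) \<Rightarrow> complex ^ 'n ^ 'n \<Rightarrow> complex ^ 'n ^ 'n" where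
  "fc f T \<equiv> fun_calc_on UNIV f T"

abbreviation spec :: "complex ^ 'n ^ 'n \<Rightarrow> real set" where
  "spec T \<equiv> spectrum_on UNIV T"

abbreviation eproj :: "complex ^ 'n ^ 'n \<Rightarrow> real \<Rightarrow> complex ^ 'n ^ 'n" where
  "eproj T r \<equiv> orth_proj (eigenspace_on UNIV T r)"

lemma matrix_eqI: "(\<And>x. M *v x = N *v x) \<Longrightarrow> M = N" for M N :: "complex ^ 'n ^ 'n"
  by (simp add: matrix_eq)

lemma subspace_eigenspace: "vec.subspace (eigenspace_on UNIV T r)"
  by (rule subspace_eigenspace_on) (rule vec.subspace_UNIV)

lemma cinner_all_zero: "(\<And>y. cinner y x = 0) \<Longrightarrow> x = 0"
  using cinner_eq_zero_iff by blast

lemma eproj_eigen: "T *v (eproj T r *v x) = r *\<^sub>R (eproj T r *v x)"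
  using orth_proj_in[OF subspace_eigenspace, of T r x] by (simp add: eigenspace_on_def smult_of_real)

context
  fixes T :: "complex ^ 'n ^ 'n"
  assumes T: "hermitian T"
begin

lemma finite_spec: "finite (spec T)"
  using finite_spectrum_on[OF vec.subspace_UNIV T] by simp

lemma hermitian_fc: "hermitian (fc f T)"
  using hermitian_fun_calc_on[OF vec.subspace_UNIV T] by simp

lemma fc_eigenvector: "T *v x = r *\<^sub>R x \<Longrightarrow> fc f T *v x = f r *\<^sub>R x"
  using fun_calc_on_eigenvector[OF vec.subspace_UNIV T] by (simp add: eigenspace_on_def smult_of_real)

lemma eq_on_all_eigenvectors:
  assumes "\<And>r x. T *v x = r *\<^sub>R x \<Longrightarrow> M *v x = N *v x"
  shows "M = N"
proof (rule eq_on_eigenvectors[OF vec.subspace_UNIV T])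
  show "M *v x = N *v x" if "x \<in> eigenspace_on UNIV T r" for r x
    using that assms[of x r] by (simp add: eigenspace_on_def smult_of_real)
  show "M *v x = N *v x" if "\<And>y. y \<in> UNIV \<Longrightarrow> cinner y x = 0" for x
    using cinner_all_zero[of x] that by simp
qed simp

lemma sum_eproj: "(\<Sum>r\<in>spec T. eproj T r) = mat 1"
proof -
  have "orth_proj UNIV = (mat 1 :: complex ^ 'n ^ 'n)"
    by (rule matrix_eqI) (simp add: orth_proj_ident[OF vec.subspace_UNIV])
  then show ?thesis using sum_proj_eigenspaces[OF vec.subspace_UNIV T] by simp
qed

lemma sum_eproj_vec: "(\<Sum>r\<in>spec T. eproj T r *v x) = x"
  by (simp add: sum_eproj flip: matrix_vector_mult_sum_left)

lemma qform_fc: "qform (fc f T) x = (\<Sum>r\<in>spec T. f r * (norm (eproj T r *v x))\<^sup>2)"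
  unfolding fun_calc_on_def by (simp add: qform_sum qform_scaleR qform_orth_proj[OF subspace_eigenspace])

lemma fc_ident: "fc (\<lambda>r. r) T = T"
proof (rule eq_on_all_eigenvectors)
  fix r x assume x: "T *v x = r *\<^sub>R x"
  show "fc (\<lambda>r. r) T *v x = T *v x"
    by (simp add: fc_eigenvector[OF x] x)
qed

lemma fc_mult: "fc f T ** fc g T = fc (\<lambda>r. f r * g r) T"
proof (rule eq_on_all_eigenvectors)
  fix r x assume x: "T *v x = r *\<^sub>R x"
  show "(fc f T ** fc g T) *v x = fc (\<lambda>r. f r * g r) T *v x"
    by (simp add: fc_eigenvector[OF x] matrix_vector_mult_scaleR_right flip: matrix_vector_mul_assoc)
qed

lemma fc_diff: "fc (\<lambda>r. f r - g r) T = fc f T - fc g T"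
proof (rule eq_on_all_eigenvectors)
  fix r x assume x: "T *v x = r *\<^sub>R x"
  show "fc (\<lambda>r. f r - g r) T *v x = (fc f T - fc g T) *v x"
    by (simp add: fc_eigenvector[OF x] matrix_vector_mult_diff_rdistrib scaleR_left_diff_distrib)
qed

lemma fc_const: "fc (\<lambda>_. c) T = c *\<^sub>R mat 1"
proof (rule eq_on_all_eigenvectors)
  fix r x assume x: "T *v x = r *\<^sub>R x"
  show "fc (\<lambda>_. c) T *v x = (c *\<^sub>R mat 1) *v x"
    by (simp add: fc_eigenvector[OF x] matrix_vector_mult_scaleR_left)
qed

lemma norm_eq_sum_eproj: "(norm x)\<^sup>2 = (\<Sum>r\<in>spec T. (norm (eproj T r *v x))\<^sup>2)"
  using qform_fc[of "\<lambda>_. 1" x] by (simp add: fc_const qform_one)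

lemma qform_sum_eproj: "qform T x = (\<Sum>r\<in>spec T. r * (norm (eproj T r *v x))\<^sup>2)"
  using qform_fc[of "\<lambda>r. r" x] by (simp add: fc_ident)

lemma spec_eigenvector: "r \<in> spec T \<Longrightarrow> \<exists>x. x \<noteq> 0 \<and> T *v x = r *\<^sub>R x"
  by (auto simp: spectrum_on_def eigenspace_on_def smult_of_real)

lemma spec_lower_bound:
  assumes "\<And>x. c * (norm x)\<^sup>2 \<le> qform T x" "r \<in> spec T"
  shows "c \<le> r"
proof -
  obtain x where x: "x \<noteq> 0" "T *v x = r *\<^sub>R x" using spec_eigenvector assms by blast
  then have "c * (norm x)\<^sup>2 \<le> r * (norm x)\<^sup>2"
    using assms(1)[of x] by (simp add: qform_def cinner_scaleR_right cinner_same flip: of_real_power)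
  with x show ?thesis by simp
qed

lemma spec_upper_bound:
  assumes "\<And>x. qform T x \<le> c * (norm x)\<^sup>2" "r \<in> spec T"
  shows "r \<le> c"
proof -
  obtain x where x: "x \<noteq> 0" "T *v x = r *\<^sub>R x" using spec_eigenvector assms by blast
  then have "r * (norm x)\<^sup>2 \<le> c * (norm x)\<^sup>2"
    using assms(1)[of x] by (simp add: qform_def cinner_scaleR_right cinner_same flip: of_real_power)
  with x show ?thesis by simp
qed

lemma psd_fc: "(\<And>r. r \<in> spec T \<Longrightarrow> 0 \<le> f r) \<Longrightarrow> psd (fc f T)"
  by (auto simp: psd_qform hermitian_fc qform_fc intro!: sum_nonneg)

lemma fc_cong: "(\<And>r. r \<in> spec T \<Longrightarrow> f r = g r) \<Longrightarrow> fc f T = fc g T"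
  unfolding fun_calc_on_def by (intro sum.cong) auto

lemma cinner_eigenvectors:
  assumes "T *v x = r *\<^sub>R x" "T *v y = q *\<^sub>R y" "r \<noteq> q"
  shows "cinner x y = 0"
  using eigenspaces_orth[OF vec.subspace_UNIV T, of x r y q] assms
  by (simp add: eigenspace_on_def smult_of_real)

text \<open>An eigenvector with positive eigenvalue lies in the span, and any other eigenvector is
  orthogonal to all generators. The projection thus acts on eigenvectors like the indicator function
  of (0, oo).\<close>

lemma spectral_pos_fc: "spectral_pos T = fc (\<lambda>r. if 0 < r then 1 else 0) T"
proof -
  define E where "E = {x. x \<noteq> 0 \<and> (\<exists>r::real. 0 < r \<and> T *v x = complex_of_real r *s x)}"
  have U: "vec.subspace (vec.span E)" by (rule vec.subspace_span)
  have "orth_proj (vec.span E) = fc (\<lambda>r. if 0 < r then 1 else 0) T"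
  proof (rule eq_on_all_eigenvectors)
    fix r x assume x: "T *v x = r *\<^sub>R x"
    have "orth_proj (vec.span E) *v x = (if 0 < r then 1 else 0) *\<^sub>R x"
    proof (cases "0 < r")
      case True
      have "x \<in> vec.span E"
      proof (cases "x = 0")
        case False
        then have "x \<in> E" using x True by (auto simp: E_def smult_of_real)
        then show ?thesis by (rule vec.span_base)
      qed (simp add: vec.span_zero)
      then show ?thesis using True by (simp add: orth_proj_ident[OF U])
    next
      case False
      have "vec.span E \<subseteq> {y. cinner y x = 0}"
      proof (rule vec.span_minimal)
        show "E \<subseteq> {y. cinner y x = 0}"
          using cinner_eigenvectors[OF _ x] False by (auto simp: E_def smult_of_real)
        show "vec.subspace {y. cinner y x = 0}"
          by (auto simp: vec.subspace_def cinner_add_left cinner_smult_left)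
      qed
      then show ?thesis using False by (auto intro!: orth_proj_eq_0[OF U])
    qed
    then show "orth_proj (vec.span E) *v x = fc (\<lambda>r. if 0 < r then 1 else 0) T *v x"
      using fc_eigenvector[OF x, of "\<lambda>r. if 0 < r then 1 else 0"] by simp
  qed
  then show ?thesis by (simp add: spectral_pos_def E_def)
qed

lemma pos_part_fc: "pos_part T = fc (\<lambda>r. max 0 r) T"
proof -
  have "pos_part T = fc (\<lambda>r. r) T ** fc (\<lambda>r. if 0 < r then 1 else 0) T"
    by (simp add: pos_part_def spectral_pos_fc fc_ident)
  also have "\<dots> = fc (\<lambda>r. max 0 r) T"
    unfolding fc_mult by (rule fc_cong) auto
  finally show ?thesis .
qed

lemma hermitian_pos_part: "hermitian (pos_part T)"
  by (simp add: pos_part_fc hermitian_fc)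

lemma psd_pos_part: "psd (pos_part T)"
  by (simp add: pos_part_fc psd_fc)

lemma pos_part_ge: "qform T x \<le> qform (pos_part T) x"
  unfolding pos_part_fc qform_fc qform_sum_eproj by (intro sum_mono mult_right_mono) auto

lemma pos_part_eq_0:
  assumes "\<And>x. qform T x \<le> 0"
  shows "pos_part T = 0"
proof -
  have "pos_part T = fc (\<lambda>_. 0) T"
    unfolding pos_part_fc using spec_upper_bound[of 0] assms by (intro fc_cong) auto
  then show ?thesis by (simp add: fc_const)
qed

lemma fc_minus: "fc f (- T) = fc (\<lambda>r. f (- r)) T"
proof (rule eq_on_all_eigenvectors)
  fix r x assume x: "T *v x = r *\<^sub>R x"
  have "fc f (- T) *v x = f (- r) *\<^sub>R x"
    using fun_calc_on_eigenvector[OF vec.subspace_UNIV hermitian_minus[OF T], of x "- r" f] x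
    by (simp add: eigenspace_on_def smult_of_real matrix_vector_mult_minus_left)
  then show "fc f (- T) *v x = fc (\<lambda>r. f (- r)) T *v x"
    using fc_eigenvector[OF x, of "\<lambda>r. f (- r)"] by simp
qed

end

lemma neg_part_pos_part: "neg_part T = pos_part (- T)"
  by (simp add: neg_part_def pos_part_def)

lemma pos_part_minus: "hermitian T \<Longrightarrow> pos_part T - pos_part (- T) = T"
  by (simp add: pos_part_fc hermitian_minus fc_minus flip: fc_diff)
    (subst (2) fc_ident[symmetric], auto intro!: fc_cong)

lemma pos_part_scaleR:
  assumes T: "hermitian T" and c: "0 \<le> c"
  shows "pos_part (c *\<^sub>R T) = c *\<^sub>R pos_part T"
proof (rule eq_on_all_eigenvectors[OF T])
  fix r x assume x: "T *v x = r *\<^sub>R x"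
  then have cx: "(c *\<^sub>R T) *v x = (c * r) *\<^sub>R x" by (simp add: matrix_vector_mult_scaleR_left)
  have "max 0 (c * r) = c * max 0 r" using c by (simp add: max_mult_distrib_left)
  then show "pos_part (c *\<^sub>R T) *v x = (c *\<^sub>R pos_part T) *v x"
    using fc_eigenvector[OF T x, of "\<lambda>r. max 0 r"] fc_eigenvector[OF hermitian_scaleR[OF T] cx, of "\<lambda>r. max 0 r"]
    by (simp add: pos_part_fc hermitian_scaleR T matrix_vector_mult_scaleR_left)
qed

text \<open>Giving the complement of V the eigenvalue \<open>c\<close> moves the calculus on V to
  the whole space. When f c = 0 the complement leaves no trace: this is used with c = 1 for the
  logarithm and c = 0 for r ln r.\<close>

lemma fc_add_complement:
  assumes V: "vec.subspace V" and T: "hermitian T" and TV: "\<And>x. T *v x \<in> V"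
  shows "fc f (T + c *\<^sub>R (mat 1 - orth_proj V)) = fun_calc_on V f T + f c *\<^sub>R (mat 1 - orth_proj V)"
    (is "fc f ?S = _")
proof (rule eq_on_eigenvectors[OF V T TV])
  have S: "hermitian ?S" by (intro hermitian_add hermitian_scaleR hermitian_diff T hermitian_one orth_proj_hermitian V)
  show "fc f ?S *v x = (fun_calc_on V f T + f c *\<^sub>R (mat 1 - orth_proj V)) *v x"
    if x: "x \<in> eigenspace_on V T r" for r x
  proof -
    have xV: "x \<in> V" "T *v x = r *\<^sub>R x" using x by (auto simp: eigenspace_on_def smult_of_real)
    then have "?S *v x = r *\<^sub>R x"
      by (simp add: matrix_vector_mult_add_rdistrib matrix_vector_mult_diff_rdistrib
          matrix_vector_mult_scaleR_left orth_proj_ident[OF V])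
    then show ?thesis using xV
      by (simp add: fc_eigenvector[OF S] matrix_vector_mult_add_rdistrib matrix_vector_mult_diff_rdistrib
          matrix_vector_mult_scaleR_left orth_proj_ident[OF V] fun_calc_on_eigenvector[OF V T TV x])
  qed
  show "fc f ?S *v x = (fun_calc_on V f T + f c *\<^sub>R (mat 1 - orth_proj V)) *v x"
    if x: "\<And>y. y \<in> V \<Longrightarrow> cinner y x = 0" for x
  proof -
    have "cinner y (T *v x) = 0" for y using x[OF TV, of y] by (simp add: hermitianD[OF T])
    then have "T *v x = 0" by (rule cinner_all_zero)
    moreover have "orth_proj V *v x = 0" by (rule orth_proj_eq_0[OF V x])
    ultimately have "?S *v x = c *\<^sub>R x"
      by (simp add: matrix_vector_mult_add_rdistrib matrix_vector_mult_diff_rdistrib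
          matrix_vector_mult_scaleR_left)
    then show ?thesis using \<open>orth_proj V *v x = 0\<close> fun_calc_on_orth[OF V T TV x]
      by (simp add: fc_eigenvector[OF S] matrix_vector_mult_add_rdistrib matrix_vector_mult_diff_rdistrib
          matrix_vector_mult_scaleR_left)
  qed
qed

section \<open>The trace inner product and the cone of positive semidefinite matrices\<close>

lemma inner_matrix_columns: "inner M N = (\<Sum>i\<in>UNIV. inner (M *v axis i 1) (N *v axis i 1))"
  for M N :: "complex ^ 'n ^ 'n"
proof -
  have "inner M N = (\<Sum>j\<in>UNIV. \<Sum>i\<in>UNIV. inner (M $ j $ i) (N $ j $ i))"
    by (simp add: inner_vec_def)
  also have "\<dots> = (\<Sum>i\<in>UNIV. \<Sum>j\<in>UNIV. inner (M $ j $ i) (N $ j $ i))"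
    by (rule sum.swap)
  finally show ?thesis by (simp add: inner_vec_def matrix_vector_mult_axis)
qed

lemma trace_sum_cinner: "trace M = (\<Sum>i\<in>UNIV. cinner (axis i 1) (M *v axis i 1))"
  by (simp add: trace_def cinner_axis matrix_vector_mult_axis)

text \<open>The Euclidean inner product of matrices is the trace pairing, so \<open>norm\<close> on
  matrices is the Frobenius norm and positivity under the trace applies to it.\<close>

lemma inner_hermitian_trace:
  assumes "hermitian M"
  shows "inner M N = Re (trace (M ** N))"
  unfolding inner_matrix_columns trace_sum_cinner inner_eq_Re_cinner
  by (simp add: hermitianD[OF assms] flip: matrix_vector_mul_assoc)

text \<open>A projection P is idempotent, so tr(P N) = tr(P N P), which is a sum of values of the
  form of N. Spectral decomposition then extends the claim from projections to all positive
  semidefinite matrices.\<close>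

lemma inner_orth_proj_psd:
  assumes V: "vec.subspace V" and N: "psd N"
  shows "0 \<le> inner (orth_proj V) N"
proof -
  let ?P = "orth_proj V"
  have PP: "?P ** ?P = ?P"
    by (rule matrix_eqI) (simp add: orth_proj_idem[OF V] flip: matrix_vector_mul_assoc)
  have "trace (?P ** N) = trace (?P ** (N ** ?P))"
    by (metis PP matrix_mul_assoc trace_mul_sym)
  also have "Re \<dots> = (\<Sum>i\<in>UNIV. qform N (?P *v axis i 1))"
    unfolding trace_sum_cinner qform_def
    by (simp add: hermitianD[OF orth_proj_hermitian[OF V]] flip: matrix_vector_mul_assoc)
  also have "\<dots> \<ge> 0" using N by (auto simp: psd_qform intro!: sum_nonneg)
  finally show ?thesis by (simp add: inner_hermitian_trace[OF orth_proj_hermitian[OF V]])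
qed

lemma inner_psd_nonneg:
  assumes M: "psd M" and N: "psd N"
  shows "0 \<le> inner M N"
proof -
  have h: "hermitian M" using M by (simp add: psd_qform)
  have "0 \<le> inner (fc (\<lambda>r. r) M) N"
    unfolding fun_calc_on_def inner_sum_left inner_scaleR_left
    using spec_lower_bound[OF h, of 0] M
    by (intro sum_nonneg mult_nonneg_nonneg inner_orth_proj_psd subspace_eigenspace N) (auto simp: psd_qform)
  then show ?thesis by (simp add: fc_ident[OF h])
qed

lemma inner_pos_neg_part:
  assumes "hermitian T"
  shows "inner (pos_part (- T)) (pos_part T) = 0"
proof -
  have "pos_part (- T) ** pos_part T = fc (\<lambda>_. 0) T"
    unfolding pos_part_fc[OF assms] pos_part_fc[OF hermitian_minus[OF assms]] fc_minus[OF assms] fc_mult[OF assms]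
    by (intro fc_cong assms) auto
  then show ?thesis
    by (simp add: inner_hermitian_trace hermitian_pos_part hermitian_minus assms fc_const trace_def)
qed

text \<open>In the Frobenius norm, the positive part is the nearest-point projection onto the convex cone of
  positive semidefinite matrices, hence nonexpansive.\<close>

lemma pos_part_lipschitz:
  assumes "hermitian S" "hermitian T"
  shows "norm (pos_part S - pos_part T) \<le> norm (S - T)"
proof -
  let ?D = "pos_part S - pos_part T"
  have S: "S = pos_part S - pos_part (- S)" and T: "T = pos_part T - pos_part (- T)"
    using pos_part_minus assms by metis+
  have nn: "inner (pos_part (- S)) (pos_part T) \<ge> 0" "inner (pos_part (- T)) (pos_part S) \<ge> 0"
    by (intro inner_psd_nonneg psd_pos_part hermitian_minus assms)+
  \<comment> \<open>The variational inequality of the nearest-point projection: the two parts of a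
    single matrix are orthogonal, and the mixed pairings are nonnegative.\<close>
  have "inner (S - T - ?D) ?D = inner (pos_part (- T) - pos_part (- S)) ?D"
    by (subst S, subst T) simp
  also have "\<dots> \<ge> 0"
    using nn inner_pos_neg_part[OF assms(1)] inner_pos_neg_part[OF assms(2)]
    by (simp add: inner_diff_left inner_diff_right)
  finally have "inner ?D ?D \<le> inner (S - T) ?D" by (simp add: inner_diff_left)
  also have "\<dots> \<le> norm (S - T) * norm ?D" by (rule norm_cauchy_schwarz)
  finally have "norm ?D * norm ?D \<le> norm (S - T) * norm ?D"
    by (simp add: power2_norm_eq_inner[symmetric] power2_eq_square)
  then show ?thesis
    by (cases "norm ?D = 0") (auto simp: mult_le_cancel_right)
qed

section \<open>Resolvents\<close>

lemma mat_vector_mult: "mat c *v x = c *s (x :: complex ^ 'n)"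
proof -
  have "(mat c *v x) $ i = (\<Sum>j\<in>UNIV. if j = i then c * x $ j else 0)" for i
    unfolding matrix_vector_mult_def mat_def vec_lambda_beta by (rule sum.cong) auto
  then show ?thesis by (simp add: vec_eq_iff)
qed

lemma norm_matrix_vector_le: "norm (M *v x) \<le> op_norm M * norm x"
  unfolding op_norm_def by (rule onorm) (rule matrix_vector_mul_bounded_linear)

lemma op_norm_nonneg: "0 \<le> op_norm M"
  unfolding op_norm_def by (rule onorm_pos_le) (rule matrix_vector_mul_bounded_linear)

lemma abs_qform_le: "\<bar>qform M x\<bar> \<le> op_norm M * (norm x)\<^sup>2"
proof -
  have "\<bar>qform M x\<bar> \<le> norm x * norm (M *v x)"
    unfolding qform_def using abs_Re_le_cmod norm_cinner_le order_trans by blast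
  also have "\<dots> \<le> norm x * (op_norm M * norm x)"
    by (intro mult_left_mono norm_matrix_vector_le) simp
  finally show ?thesis by (simp add: power2_eq_square mult_ac)
qed

text \<open>Quantitative invertibility: the inverse has operator norm at most 1/m. All resolvent
  estimates pass through such an \<open>m\<close>.\<close>

definition bounded_below :: "real \<Rightarrow> complex ^ 'n ^ 'n \<Rightarrow> bool" where
  "bounded_below m M \<longleftrightarrow> 0 < m \<and> (\<forall>x. m * norm x \<le> norm (M *v x))"

lemma bounded_belowI:
  assumes "0 < m" "\<And>x. m * (norm x)\<^sup>2 \<le> cmod (cinner x (M *v x))"
  shows "bounded_below m M"
  unfolding bounded_below_def
proof (intro conjI allI assms(1))
  fix x
  have "norm x * (m * norm x) \<le> norm x * norm (M *v x)"
    using assms(2)[of x] norm_cinner_le[of x "M *v x"] by (simp add: power2_eq_square mult_ac)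
  then show "m * norm x \<le> norm (M *v x)"
    by (cases "x = 0") (auto simp: mult_le_cancel_left)
qed

lemma bounded_below_invertible:
  assumes "bounded_below m M"
  shows "invertible M"
proof -
  have "inj ((*v) M)"
  proof (rule injI)
    fix x y assume "M *v x = M *v y"
    then have "M *v (x - y) = 0" by (simp add: matrix_vector_mult_diff_distrib)
    then have "m * norm (x - y) \<le> 0"
      using assms unfolding bounded_below_def by (metis norm_zero)
    then show "x = y" using assms by (simp add: bounded_below_def mult_le_0_iff)
  qed
  then show ?thesis
    by (metis invertible_def matrix_left_invertible_injective matrix_left_right_inverse)
qed

lemma matrix_inv_invertible:
  assumes "invertible (M :: complex ^ 'n ^ 'n)"
  shows "M ** matrix_inv M = mat 1" "matrix_inv M ** M = mat 1"
proof -
  have "\<exists>A'. M ** A' = mat 1 \<and> A' ** M = mat 1"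
    using assms by (simp add: invertible_def)
  from someI_ex[OF this] show "M ** matrix_inv M = mat 1" "matrix_inv M ** M = mat 1"
    by (auto simp: matrix_inv_def)
qed

lemma matrix_inv_vec:
  assumes "invertible (M :: complex ^ 'n ^ 'n)"
  shows "M *v (matrix_inv M *v x) = x" "matrix_inv M *v (M *v x) = x"
  using matrix_inv_invertible[OF assms] by (simp_all add: matrix_vector_mul_assoc)

lemma norm_matrix_inv_le:
  assumes "bounded_below m M"
  shows "norm (matrix_inv M *v x) \<le> norm x / m"
proof -
  have "m * norm (matrix_inv M *v x) \<le> norm x"
    using assms matrix_inv_vec(1)[OF bounded_below_invertible[OF assms], of x]
    unfolding bounded_below_def by metis
  then show ?thesis using assms by (simp add: bounded_below_def field_simps)
qed

lemma cmod_cinner_matrix_inv_le: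
  assumes "bounded_below m M"
  shows "cmod (cinner x (matrix_inv M *v y)) \<le> norm x * norm y / m"
proof -
  have "cmod (cinner x (matrix_inv M *v y)) \<le> norm x * norm (matrix_inv M *v y)"
    by (rule norm_cinner_le)
  also have "\<dots> \<le> norm x * (norm y / m)"
    by (intro mult_left_mono norm_matrix_inv_le assms) simp
  finally show ?thesis by simp
qed

lemma matrix_inv_diff:
  assumes "invertible (M :: complex ^ 'n ^ 'n)" "invertible N"
  shows "matrix_inv M *v x - matrix_inv N *v x = matrix_inv M *v ((N - M) *v (matrix_inv N *v x))"
  using matrix_inv_vec[OF assms(1)] matrix_inv_vec[OF assms(2)]
  by (simp add: matrix_vector_mult_diff_rdistrib matrix_vector_mult_diff_distrib)

text \<open>Cramer's rule makes the inverse a rational function of the matrix entries, from which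
  both continuity and holomorphy of resolvents follow.\<close>

lemma matrix_inv_cramer:
  assumes "invertible (M :: complex ^ 'n ^ 'n)"
  shows "(matrix_inv M *v x) $ k = det (\<chi> i j. if j = k then x $ i else M $ i $ j) / det M"
proof -
  have "matrix_inv M *v x = (\<chi> k. det (\<chi> i j. if j = k then x $ i else M $ i $ j) / det M)"
    using cramer[of M "matrix_inv M *v x" x] assms
    by (simp add: invertible_det_nz[symmetric] matrix_inv_vec)
  then show ?thesis by simp
qed

lemma continuous_on_matrix_inv:
  fixes M :: "'a::topological_space \<Rightarrow> complex ^ 'n ^ 'n"
  assumes c: "\<And>i j. continuous_on S (\<lambda>a. M a $ i $ j)" and i: "\<And>a. a \<in> S \<Longrightarrow> invertible (M a)"
  shows "continuous_on S (\<lambda>a. matrix_inv (M a) *v x)"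
proof (rule continuous_on_cong[THEN iffD2])
  let ?g = "\<lambda>a. \<chi> k::'n. det (\<chi> (i::'n) (j::'n). if j = k then x $ i else M a $ i $ j) / det (M a)"
  show "matrix_inv (M a) *v x = ?g a" if "a \<in> S" for a
    using matrix_inv_cramer[OF i[OF that]] by (simp add: vec_eq_iff)
  have d: "continuous_on S (\<lambda>a. det (N a))"
    if "\<And>i j. continuous_on S (\<lambda>a. N a $ i $ j)" for N :: "'a \<Rightarrow> complex ^ 'n ^ 'n"
    unfolding det_def by (intro continuous_intros that)
  show "continuous_on S ?g"
  proof (intro continuous_on_vec_lambda continuous_on_divide d c)
    show "continuous_on S (\<lambda>a. (\<chi> i j. if j = k then x $ i else M a $ i $ j) $ i $ j)" for k i j
      using c by (cases "j = k") auto
    show "\<forall>a\<in>S. det (M a) \<noteq> 0" using i by (simp add: invertible_det_nz)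
  qed
qed simp

lemma holomorphic_on_cinner_matrix_inv:
  fixes M :: "complex \<Rightarrow> complex ^ 'n ^ 'n"
  assumes c: "\<And>i j. (\<lambda>a. M a $ i $ j) holomorphic_on S" and i: "\<And>a. a \<in> S \<Longrightarrow> invertible (M a)"
  shows "(\<lambda>a. cinner y (matrix_inv (M a) *v x)) holomorphic_on S"
proof (rule holomorphic_transform)
  let ?g = "\<lambda>a. \<Sum>k\<in>UNIV. cnj (y $ k) * (det (\<chi> (i::'n) (j::'n). if j = k then x $ i else M a $ i $ j) / det (M a))"
  show "?g a = cinner y (matrix_inv (M a) *v x)" if "a \<in> S" for a
    using matrix_inv_cramer[OF i[OF that]] by (simp add: cinner_def)
  have d: "(\<lambda>a. det (N a)) holomorphic_on S"
    if "\<And>i j. (\<lambda>a. N a $ i $ j) holomorphic_on S" for N :: "complex \<Rightarrow> complex ^ 'n ^ 'n"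
    unfolding det_def by (intro holomorphic_intros that)
  show "?g holomorphic_on S"
  proof (intro holomorphic_intros d c)
    show "(\<lambda>a. (\<chi> i j. if j = k then x $ i else M a $ i $ j) $ i $ j) holomorphic_on S" for k i j
      using c by (cases "j = k") auto
    show "det (M a) \<noteq> 0" if "a \<in> S" for a using i[OF that] by (simp add: invertible_det_nz)
  qed
qed

text \<open>The matrix s + c X. For Hermitian X and c = \<i> or c = - \<i>, its form has real part s
  |x|^2, which keeps it invertible whatever the sign of X.\<close>

definition shifted :: "real \<Rightarrow> complex \<Rightarrow> complex ^ 'n ^ 'n \<Rightarrow> complex ^ 'n ^ 'n" where
  "shifted s c X = mat (of_real s) + mat c ** X"

lemma shifted_vec: "shifted s c X *v x = s *\<^sub>R x + c *s (X *v x)"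
  by (simp add: shifted_def matrix_vector_mult_add_rdistrib mat_vector_mult smult_of_real
      flip: matrix_vector_mul_assoc)

lemma shifted_minus: "shifted s c (- X) = shifted s (- c) X"
  by (rule matrix_eqI) (simp add: shifted_vec matrix_vector_mult_minus_left vec_eq_iff)

lemma shifted_diff: "(shifted s c X - shifted s c Y) *v x = c *s ((X - Y) *v x)"
  by (simp add: shifted_vec matrix_vector_mult_diff_rdistrib vec_eq_iff algebra_simps)

definition resolvent :: "real \<Rightarrow> complex ^ 'n ^ 'n \<Rightarrow> complex ^ 'n ^ 'n" where
  "resolvent s X = matrix_inv (shifted s \<i> X)"

lemma cinner_shifted:
  assumes "hermitian X"
  shows "cinner x (shifted s c X *v x) = of_real (s * (norm x)\<^sup>2) + c * of_real (qform X x)"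
  using cinner_hermitian_real[OF assms, of x]
  by (simp add: shifted_vec cinner_add_right cinner_scaleR_right cinner_smult_right cinner_same)

lemma bounded_below_shifted:
  assumes "hermitian X" "0 < s" "c = \<i> \<or> c = - \<i>"
  shows "bounded_below s (shifted s c X)"
proof (rule bounded_belowI[OF assms(2)])
  fix x
  have "s * (norm x)\<^sup>2 = \<bar>Re (cinner x (shifted s c X *v x))\<bar>"
    using assms by (auto simp: cinner_shifted)
  also have "\<dots> \<le> cmod (cinner x (shifted s c X *v x))" by (rule abs_Re_le_cmod)
  finally show "s * (norm x)\<^sup>2 \<le> cmod (cinner x (shifted s c X *v x))" .
qed

text \<open>The complementary bound, taken from the imaginary part: it improves with the size of X
  instead of s, which provides the decay for large g when X is close to g B.\<close>

lemma bounded_below_shifted_Im: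
  assumes "hermitian X" "0 < m" "\<And>x. m * (norm x)\<^sup>2 \<le> \<bar>qform X x\<bar>" 
  shows "bounded_below m (shifted s \<i> X)"
proof (rule bounded_belowI[OF assms(2)])
  fix x
  have "m * (norm x)\<^sup>2 \<le> \<bar>Im (cinner x (shifted s \<i> X *v x))\<bar>"
    using assms by (auto simp: cinner_shifted)
  also have "\<dots> \<le> cmod (cinner x (shifted s \<i> X *v x))" by (rule abs_Im_le_cmod)
  finally show "m * (norm x)\<^sup>2 \<le> cmod (cinner x (shifted s \<i> X *v x))" .
qed

text \<open>On the eigenspace of r the inverse is multiplication by 1 / (s + c r). Its real and
  imaginary parts give the even kernel s / (s^2 + r^2) and, up to sign, the odd kernel r / (s^2 +
  r^2).\<close>

lemma cinner_inv_shifted: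
  assumes T: "hermitian T" and s: "0 < s" and c: "c = \<i> \<or> c = - \<i>"
  shows "cinner x (matrix_inv (shifted s c T) *v x) =
    (\<Sum>r\<in>spec T. of_real ((norm (eproj T r *v x))\<^sup>2) / (of_real s + c * of_real r))"
proof -
  let ?M = "shifted s c T"
  have inv: "invertible ?M" by (rule bounded_below_invertible[OF bounded_below_shifted[OF T s c]])
  define z where "z = (\<Sum>r\<in>spec T. (1 / (of_real s + c * of_real r)) *s (eproj T r *v x))"
  have nz: "of_real s + c * of_real r \<noteq> 0" for r
    using s c by (auto simp: complex_eq_iff)
  have "?M *v z = (\<Sum>r\<in>spec T. eproj T r *v x)"
    unfolding z_def matrix_vector_mult_sum_right
  proof (rule sum.cong)
    fix r
    define k where "k = of_real s + c * of_real r"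
    have "?M *v ((1 / k) *s (eproj T r *v x)) = (1 / k) *s (k *s (eproj T r *v x))"
      by (simp add: matrix_vector_mult_smult shifted_vec eproj_eigen vec.scale_left_distrib k_def flip: smult_of_real)
    also have "\<dots> = eproj T r *v x"
      using nz[of r] by (simp add: k_def[symmetric])
    finally show "?M *v ((1 / (of_real s + c * of_real r)) *s (eproj T r *v x)) = eproj T r *v x"
      by (simp only: k_def)
  qed simp
  also have "\<dots> = x" by (rule sum_eproj_vec[OF T])
  finally have "matrix_inv ?M *v x = z" using matrix_inv_vec(2)[OF inv, of z] by simp
  moreover have "cinner x (eproj T r *v x) = of_real ((norm (eproj T r *v x))\<^sup>2)" for r
    using cinner_hermitian_real[OF orth_proj_hermitian[OF subspace_eigenspace], of x T r]
    by (simp add: qform_orth_proj[OF subspace_eigenspace])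
  ultimately show ?thesis
    by (simp add: z_def cinner_sum_right cinner_smult_right)
qed

lemma resolvent_Re:
  assumes "hermitian T" "0 < s"
  shows "Re (cinner x (resolvent s T *v x)) = (\<Sum>r\<in>spec T. s / (s\<^sup>2 + r\<^sup>2) * (norm (eproj T r *v x))\<^sup>2)"
  unfolding resolvent_def cinner_inv_shifted[OF assms disjI1[OF refl]] Re_sum
  by (intro sum.cong) (auto simp: Re_divide power2_eq_square)

lemma resolvent_minus_Re:
  assumes "hermitian T" "0 < s"
  shows "Re (cinner x (resolvent s (- T) *v x)) = Re (cinner x (resolvent s T *v x))"
  unfolding resolvent_Re[OF assms]
  unfolding resolvent_def shifted_minus cinner_inv_shifted[OF assms disjI2[OF refl]] Re_sum
  by (intro sum.cong) (auto simp: Re_divide power2_eq_square)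

lemma resolvent_minus_Im:
  assumes "hermitian T" "0 < s"
  shows "Im (cinner x (resolvent s (- T) *v x)) = (\<Sum>r\<in>spec T. r / (s\<^sup>2 + r\<^sup>2) * (norm (eproj T r *v x))\<^sup>2)"
  unfolding resolvent_def shifted_minus cinner_inv_shifted[OF assms disjI2[OF refl]] Im_sum
  by (intro sum.cong) (auto simp: Im_divide power2_eq_square)

section \<open>A resolvent integral over the half-line\<close>

lemma integral_Ioi_FTC:
  fixes f F :: "real \<Rightarrow> real"
  assumes F: "\<And>x. 0 < x \<Longrightarrow> (F has_real_derivative f x) (at x)"
    and f: "continuous_on {0<..} f" and i: "set_integrable lborel {0<..} f"
    and A: "(F \<longlongrightarrow> A) (at_right 0)" and B: "(F \<longlongrightarrow> B) at_top"
  shows "(LINT x:{0<..}|lborel. f x) = B - A"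
proof -
  have "(LBINT x=0..\<infinity>. f x) = B - A"
  proof (rule interval_integral_FTC_integrable)
    show "(F has_vector_derivative f x) (at x)" if "0 < ereal x" for x
      using F[of x] that by (simp add: has_real_derivative_iff_has_vector_derivative)
    show "isCont f x" if "0 < ereal x" for x
      using f that by (simp add: continuous_on_eq_continuous_at)
    have "einterval 0 \<infinity> = {0<..}" by (auto simp: einterval_def)
    then show "set_integrable lborel (einterval 0 \<infinity>) f" using i by simp
    show "((F \<circ> real_of_ereal) \<longlongrightarrow> A) (at_right 0)" 
      using A ereal_tendsto_simps1(2)[of F A 0] by (simp add: zero_ereal_def)
    show "((F \<circ> real_of_ereal) \<longlongrightarrow> B) (at_left \<infinity>)" 
      using B by (simp add: ereal_tendsto_simps1)
  qed auto
  then show ?thesis by (simp add: interval_lebesgue_integral_0_infty)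
qed

lemma integral_Ioi_FTC_nonneg:
  fixes f F :: "real \<Rightarrow> real"
  assumes F: "\<And>x. 0 < x \<Longrightarrow> (F has_real_derivative f x) (at x)"
    and f: "continuous_on {0<..} f" and nn: "\<And>x. 0 < x \<Longrightarrow> 0 \<le> f x"
    and A: "(F \<longlongrightarrow> A) (at_right 0)" and B: "(F \<longlongrightarrow> B) at_top"
  shows "set_integrable lborel {0<..} f"
proof -
  have e: "einterval 0 \<infinity> = {0<..}" by (auto simp: einterval_def)
  have "set_integrable lborel (einterval 0 \<infinity>) f"
  proof (rule interval_integral_FTC_nonneg)
    show "(F has_real_derivative f x) (at x)" if "0 < ereal x" for x
      using F[of x] that by simp
    show "isCont f x" if "0 < ereal x" for x
      using f that by (simp add: continuous_on_eq_continuous_at)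
    show "AE x in lborel. 0 < ereal x \<longrightarrow> ereal x < \<infinity> \<longrightarrow> 0 \<le> f x" using nn by simp
    show "((F \<circ> real_of_ereal) \<longlongrightarrow> A) (at_right 0)" 
      using A ereal_tendsto_simps1(2)[of F A 0] by (simp add: zero_ereal_def)
    show "((F \<circ> real_of_ereal) \<longlongrightarrow> B) (at_left \<infinity>)" 
      using B by (simp add: ereal_tendsto_simps1)
  qed auto
  then show ?thesis by (simp add: e)
qed

lemma set_integrable_inverse_1_plus_square: "set_integrable lborel {0<..} (\<lambda>x::real. 1 / (1 + x\<^sup>2))"
proof (rule integral_Ioi_FTC_nonneg)
  show "(arctan has_real_derivative 1 / (1 + x\<^sup>2)) (at x)" for x
    using DERIV_arctan[of x] by (simp add: inverse_eq_divide)
  show "continuous_on {0<..} (\<lambda>x::real. 1 / (1 + x\<^sup>2))"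
    by (intro continuous_intros) (metis add_pos_nonneg less_irrefl zero_le_power2 zero_less_one)
  show "(arctan \<longlongrightarrow> arctan 0) (at_right 0)"
    using isCont_arctan[of 0] by (simp add: isCont_def filterlim_at_split)
  show "(arctan \<longlongrightarrow> pi / 2) at_top" by (rule tendsto_arctan_at_top)
qed simp

lemma set_integrable_norm_bound:
  fixes f :: "real \<Rightarrow> 'b::{banach, second_countable_topology}"
  assumes "set_integrable lborel S g" "continuous_on S f" "S \<in> sets borel" "\<And>x. x \<in> S \<Longrightarrow> norm (f x) \<le> g x"
  shows "set_integrable lborel S f"
proof (rule set_integrable_bound[OF assms(1)])
  show "set_borel_measurable lborel S f"
    using assms(2,3) borel_measurable_continuous_on_indicator[of S f]
    by (simp add: set_borel_measurable_def)
  show "AE x in lborel. x \<in> S \<longrightarrow> norm (f x) \<le> norm (g x)"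
    using assms(4) by (intro AE_I2) (metis abs_ge_self order_trans real_norm_def)
qed

definition resolvent_form :: "real \<Rightarrow> complex ^ 'n \<Rightarrow> complex ^ 'n ^ 'n \<Rightarrow> real" where
  "resolvent_form s x X = Re (cinner x (resolvent s X *v x))"

text \<open>At w = \<i> g the matrix s - \<i> A + w B is s + \<i> (g B - A). At w = - \<i> g it is s
  - \<i> (g B + A), and the form of its inverse has the same real part as that of s + \<i> (g B +
  A). The integrand is therefore the real part of (f w - f (- w)) / g, so the integral is a
  principal value of f w / w along the imaginary axis. Closing the contour on the right leaves half
  a residue at 0, which contributes pi * Im (f 0).\<close>

lemma resolvent_scaled_difference_integral:
  fixes A B :: "complex ^ 'n ^ 'n" and x :: "complex ^ 'n"
  assumes A: "hermitian A" and B: "hermitian B" and \<beta>: "0 < \<beta>" "\<And>v. \<beta> * (norm v)\<^sup>2 \<le> qform B v"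
    and s: "0 < s"
  defines "\<phi> \<equiv> resolvent_form s x"
  shows "set_integrable lborel {0<..} (\<lambda>g. (\<phi> (g *\<^sub>R B - A) - \<phi> (g *\<^sub>R B + A)) / g)" (is ?int)
    and "(LINT g:{0<..}|lborel. (\<phi> (g *\<^sub>R B - A) - \<phi> (g *\<^sub>R B + A)) / g) =
      pi * (\<Sum>r\<in>spec A. r / (s\<^sup>2 + r\<^sup>2) * (norm (eproj A r *v x))\<^sup>2)" (is ?eq)
proof -
  define P where "P = shifted s \<i> (- A)"
  define M where "M w = P + mat w ** B" for w
  define f where "f w = cinner x (matrix_inv (M w) *v x)" for w
  define b where "b = op_norm B + 1"
  \<comment> \<open>The half-plane reaches slightly to the left of the imaginary axis, so that the
    axis lies inside an open set of holomorphy. The margin s / (2 b) costs at most half of the lower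
    bound s.\<close>
  define U where "U = {w. - (s / (2 * b)) < Re w}"
  have b: "0 < b" using op_norm_nonneg[of B] by (simp add: b_def)
  have Mvec: "M w *v v = s *\<^sub>R v - \<i> *s (A *v v) + w *s (B *v v)" for w v
    by (simp add: M_def P_def matrix_vector_mult_add_rdistrib shifted_vec matrix_vector_mult_minus_left
        mat_vector_mult vec_eq_iff flip: matrix_vector_mul_assoc)
  have cM: "cinner v (M w *v v) = of_real (s * (norm v)\<^sup>2) - \<i> * of_real (qform A v) + w * of_real (qform B v)" for v w
    using cinner_hermitian_real[OF A, of v] cinner_hermitian_real[OF B, of v]
    by (simp add: Mvec cinner_add_right cinner_diff_right cinner_scaleR_right cinner_smult_right cinner_same)
  have qB: "0 \<le> qform B v" for v using \<beta> by (meson mult_nonneg_nonneg order_trans less_imp_le zero_le_power2)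
  have bbU: "bounded_below (s / 2) (M w)" if "w \<in> U" for w
  proof (rule bounded_belowI)
    fix v
    have "qform B v \<le> b * (norm v)\<^sup>2"
      using abs_qform_le[of B v] by (simp add: b_def algebra_simps add_increasing)
    then have "(s / (2 * b)) * qform B v \<le> (s / (2 * b)) * (b * (norm v)\<^sup>2)"
      using s b by (intro mult_left_mono) auto
    also have "\<dots> = s / 2 * (norm v)\<^sup>2" using b by (simp add: field_simps)
    finally have 1: "(s / (2 * b)) * qform B v \<le> s / 2 * (norm v)\<^sup>2" .
    have "- (s / (2 * b)) * qform B v \<le> Re w * qform B v"
      using that qB by (intro mult_right_mono) (auto simp: U_def)
    with 1 have "s / 2 * (norm v)\<^sup>2 \<le> Re (cinner v (M w *v v))"
      by (simp add: cM)
    also have "\<dots> \<le> cmod (cinner v (M w *v v))" by (rule complex_Re_le_cmod)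
    finally show "s / 2 * (norm v)\<^sup>2 \<le> cmod (cinner v (M w *v v))" .
  qed (use s in simp)
  have inv: "invertible (M w)" if "w \<in> U" for w
    by (rule bounded_below_invertible[OF bbU[OF that]])
  have U0: "w \<in> U" if "0 \<le> Re w" for w
    using that s b by (auto simp: U_def intro: less_le_trans[of _ 0])
  define p where "p = op_norm P"
  \<comment> \<open>For |w| beyond \<open>R0\<close> the term w B dominates the fixed part
    \<open>P\<close>, because |w| \<beta> is then at least 2 p. The 1 keeps w away from 0.\<close>
  define R0 where "R0 = max 1 (2 * p / \<beta>)"
  have R0: "1 \<le> R0" "2 * p / \<beta> \<le> R0" by (auto simp: R0_def)
  have f_decay: "cmod (f w) \<le> 2 * (norm x)\<^sup>2 / \<beta> / cmod w" if w: "0 \<le> Re w" "R0 \<le> cmod w" for w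
  proof -
    have w0: "0 < cmod w" using w R0 by linarith
    have "bounded_below (cmod w * \<beta> / 2) (M w)"
    proof (rule bounded_belowI)
      show "0 < cmod w * \<beta> / 2" using w0 \<beta> by simp
      fix v :: "complex ^ 'n"
      have "2 * p / \<beta> \<le> cmod w" using w(2) R0(2) by linarith
      then have "2 * p \<le> cmod w * \<beta>" using \<beta> by (simp add: pos_divide_le_eq)
      then have "cmod w * \<beta> / 2 * (norm v)\<^sup>2 \<le> (cmod w * \<beta> - p) * (norm v)\<^sup>2"
        by (intro mult_right_mono, linarith, simp)
      also have "\<dots> \<le> cmod w * qform B v - p * (norm v)\<^sup>2"
        using mult_left_mono[OF \<beta>(2)[of v], of "cmod w"] by (simp add: algebra_simps)
      also have "\<dots> \<le> cmod (w * of_real (qform B v)) - cmod (cinner v (P *v v))"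
      proof -
        have "cmod (cinner v (P *v v)) \<le> norm v * (p * norm v)"
          using norm_cinner_le[of v "P *v v"] mult_left_mono[OF norm_matrix_vector_le[of P v], of "norm v"]
          unfolding p_def by simp
        then show ?thesis using qB[of v] by (simp add: norm_mult power2_eq_square mult_ac)
      qed
      also have "\<dots> \<le> cmod (w * of_real (qform B v) + cinner v (P *v v))" by (rule norm_diff_ineq)
      also have "w * of_real (qform B v) + cinner v (P *v v) = cinner v (M w *v v)"
        using cM[of v w] cM[of v 0] by (simp add: M_def)
      finally show "cmod w * \<beta> / 2 * (norm v)\<^sup>2 \<le> cmod (cinner v (M w *v v))" .
    qed
    from cmod_cinner_matrix_inv_le[OF this, of x x] show ?thesis
      using w0 \<beta> by (simp add: f_def power2_eq_square field_simps)
  qed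
  \<comment> \<open>\<open>\<psi> w\<close> is \<open>(f w - f 0 / (1 + w)) / w\<close>, written so that the removable singularity at 0 does not appear.\<close>
  define \<psi> where "\<psi> w = f 0 / (1 + w) - cinner x (matrix_inv (M w) *v (B *v (matrix_inv P *v x)))" for w
  have M0: "M 0 = P" unfolding M_def by (rule matrix_eqI) (simp add: matrix_vector_mult_add_rdistrib mat_vector_mult flip: matrix_vector_mul_assoc)
  have invP: "invertible P" using inv[of 0] U0[of 0] by (simp add: M0)
  have \<psi>: "w * \<psi> w = f w - f 0 / (1 + w)" if "w \<in> U" "1 + w \<noteq> 0" for w
  proof -
    have "f w - f 0 = cinner x (matrix_inv (M w) *v ((P - M w) *v (matrix_inv P *v x)))"
      unfolding f_def M0 by (simp add: matrix_inv_diff[OF inv[OF that(1)] invP, symmetric] flip: cinner_diff_right)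
    also have "(P - M w) *v (matrix_inv P *v x) = - (w *s (B *v (matrix_inv P *v x)))"
      by (simp add: M_def matrix_vector_mult_minus_left mat_vector_mult flip: matrix_vector_mul_assoc)
    finally have "f w - f 0 = - (w * cinner x (matrix_inv (M w) *v (B *v (matrix_inv P *v x))))"
      by (simp add: vec.neg matrix_vector_mult_smult cinner_minus_right cinner_smult_right)
    then have fw: "f w = f 0 - w * cinner x (matrix_inv (M w) *v (B *v (matrix_inv P *v x)))"
      by (simp add: algebra_simps)
    have "f 0 - f 0 / (1 + w) = w * (f 0 / (1 + w))"
      using that(2) by (simp add: field_simps)
    then show ?thesis unfolding \<psi>_def fw right_diff_distrib by (simp add: algebra_simps)
  qed
  have one_w: "1 + w \<noteq> 0 \<and> cmod w \<le> cmod (1 + w)" if "0 \<le> Re w" for w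
  proof
    show "1 + w \<noteq> 0" using that by (auto simp: complex_eq_iff)
    show "cmod w \<le> cmod (1 + w)" using that unfolding cmod_def by (intro real_sqrt_le_mono) (auto simp: power2_eq_square algebra_simps)
  qed
  define C where "C = 2 * (norm x)\<^sup>2 / \<beta> + cmod (f 0)"
  have C: "0 \<le> C" using \<beta> by (simp add: C_def)
  \<comment> \<open>Subtracting f 0 / (1 + w) rather than the constant f 0 preserves the decay at
    infinity, so \<psi> is O(|w|^-2) and its integral over a large arc vanishes in the
    limit.\<close>
  have \<psi>_decay: "cmod (\<psi> w) \<le> C / (cmod w)\<^sup>2" if w: "0 \<le> Re w" "R0 \<le> cmod w" for w
  proof -
    have w0: "0 < cmod w" using w R0 by linarith
    have "cmod w * cmod (\<psi> w) = cmod (f w - f 0 / (1 + w))"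
      using \<psi>[OF U0[OF w(1)]] one_w[OF w(1)] by (metis norm_mult)
    also have "\<dots> \<le> cmod (f w) + cmod (f 0) / cmod (1 + w)"
      using norm_triangle_ineq4 by (metis norm_divide)
    also have "\<dots> \<le> 2 * (norm x)\<^sup>2 / \<beta> / cmod w + cmod (f 0) / cmod w"
      using w0 one_w[OF w(1)] f_decay[OF w] by (intro add_mono divide_left_mono) auto
    also have "\<dots> = C / cmod w" by (simp add: C_def add_divide_distrib)
    finally show ?thesis using w0 by (simp add: field_simps power2_eq_square)
  qed
  have entries: "(\<lambda>w. M w $ i $ j) holomorphic_on S" for i j S
  proof -
    have "M w $ i $ j = P $ i $ j + w * B $ i $ j" for w
    proof -
      have "(M w *v axis j 1) $ i = (P *v axis j 1) $ i + w * (B *v axis j 1) $ i"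
        by (simp add: M_def matrix_vector_mult_add_rdistrib mat_vector_mult flip: matrix_vector_mul_assoc)
      then show ?thesis by (simp only: matrix_vector_mult_axis)
    qed
    then show ?thesis by (auto intro!: holomorphic_intros)
  qed
  \<comment> \<open>The second half-plane excludes the pole of 1 / (1 + w) at -1; the intersection
    is still convex, so a primitive exists.\<close>
  define U' where "U' = U \<inter> {w. - 1 < Re w}"
  have U': "w \<in> U'" if "0 \<le> Re w" for w using U0[OF that] that by (simp add: U'_def)
  have hol: "\<psi> holomorphic_on U'"
    unfolding \<psi>_def using inv
    by (intro holomorphic_intros holomorphic_on_cinner_matrix_inv entries)
      (auto simp: U'_def complex_eq_iff)
  have "convex U'" "open U'"
    unfolding U'_def U_def by (auto intro!: convex_Int open_Int convex_halfspace_Re_gt open_halfspace_Re_gt)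
  then obtain \<Psi> where \<Psi>: "\<And>w. w \<in> U' \<Longrightarrow> (\<Psi> has_field_derivative \<psi> w) (at w within U')"
    using holomorphic_convex_primitive'[OF _ _ hol] by blast
  then have \<Psi>': "(\<Psi> has_field_derivative \<psi> w) (at w)" if "w \<in> U'" for w
    using \<open>open U'\<close> that by (metis at_within_open)
  have arc: "cmod (\<Psi> (\<i> * of_real R) - \<Psi> (- (\<i> * of_real R))) \<le> C * pi / R" if R: "R0 \<le> R" for R
  proof -
    have R': "0 < R" using R R0 by linarith
    let ?g = "part_circlepath 0 R (- pi / 2) (pi / 2)"
    have img: "0 \<le> Re w \<and> cmod w = R" if "w \<in> path_image ?g" for w
    proof -
      obtain u where u: "w = of_real R * exp (\<i> * of_real u)" "- pi / 2 \<le> u" "u \<le> pi / 2"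
        using \<open>w \<in> path_image ?g\<close> by (auto simp: path_image_part_circlepath)
      have "Re w = R * cos u" by (simp add: u(1) Re_exp)
      moreover have "0 \<le> cos u" using u by (intro cos_ge_zero) auto
      ultimately show ?thesis using R' u by (simp add: norm_mult)
    qed
    have "(\<psi> has_contour_integral (\<Psi> (pathfinish ?g) - \<Psi> (pathstart ?g))) ?g"
      using \<Psi> img U' by (intro contour_integral_primitive[where S=U']) auto
    then have "norm (\<Psi> (pathfinish ?g) - \<Psi> (pathstart ?g)) \<le> C / R\<^sup>2 * R * (pi / 2 - (- pi / 2))"
      using R' C img R \<psi>_decay by (intro has_contour_integral_bound_part_circlepath) auto
    moreover have "pathfinish ?g = \<i> * of_real R" "pathstart ?g = - (\<i> * of_real R)"
      by (auto simp: exp_eq_polar cis_conv_exp[symmetric] complex_eq_iff)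
    ultimately show ?thesis using R' by (simp add: power2_eq_square field_simps)
  qed
  define h where "h g = (\<phi> (g *\<^sub>R B - A) - \<phi> (g *\<^sub>R B + A)) / g" for g
  have f_\<phi>: "Re (f (\<i> * of_real g)) = \<phi> (g *\<^sub>R B - A)" for g
  proof -
    have "M (\<i> * of_real g) = shifted s \<i> (g *\<^sub>R B - A)"
      by (rule matrix_eqI) (simp add: Mvec shifted_vec matrix_vector_mult_diff_rdistrib
          matrix_vector_mult_scaleR_left vec_eq_iff scaleR_conv_of_real[where 'a=complex] algebra_simps)
    then show ?thesis by (simp add: f_def \<phi>_def resolvent_form_def resolvent_def)
  qed
  have f_\<phi>': "Re (f (- (\<i> * of_real g))) = \<phi> (g *\<^sub>R B + A)" for g
  proof -
    have "\<phi> (- (g *\<^sub>R B + A)) = \<phi> (g *\<^sub>R B + A)"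
      unfolding \<phi>_def resolvent_form_def by (intro resolvent_minus_Re hermitian_add hermitian_scaleR A B s)
    moreover have "- (g *\<^sub>R B + A) = (- g) *\<^sub>R B - A" by simp
    ultimately show ?thesis using f_\<phi>[of "- g"] by simp
  qed
  \<comment> \<open>The integrand without the division by g, hence continuous at 0. The term with 1
    / (1 + g^2) is what remains of f 0 / (1 + w) at w = \<i> g and w = - \<i> g.\<close>
  define h' where "h' g = Re (\<i> * (\<psi> (\<i> * of_real g) + \<psi> (- (\<i> * of_real g)))) - Re (2 * \<i> * f 0) * (1 / (1 + g\<^sup>2))" for g
  have h_h': "h g = h' g" if "0 < g" for g
  proof -
    let ?w = "\<i> * of_real g"
    have 1: "?w * \<psi> ?w = f ?w - f 0 / (1 + ?w)" "- ?w * \<psi> (- ?w) = f (- ?w) - f 0 / (1 - ?w)"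
      using \<psi>[OF U0, of ?w] \<psi>[OF U0, of "- ?w"] one_w[of ?w] one_w[of "- ?w"] by simp_all
    have nz: "1 + ?w \<noteq> 0" "1 - ?w \<noteq> 0" using one_w[of ?w] one_w[of "- ?w"] by simp_all
    have sq: "(1 + ?w) * (1 - ?w) = of_real (1 + g\<^sup>2)" by (simp add: complex_eq_iff power2_eq_square)
    have "f 0 / (1 + ?w) - f 0 / (1 - ?w) = f 0 * ((1 - ?w) - (1 + ?w)) / ((1 + ?w) * (1 - ?w))"
      using nz by (simp add: field_simps)
    also have "\<dots> = - (?w * (2 * f 0 / of_real (1 + g\<^sup>2)))" unfolding sq by simp
    finally have 2: "f 0 / (1 + ?w) - f 0 / (1 - ?w) = - (?w * (2 * f 0 / of_real (1 + g\<^sup>2)))" .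
    have "f ?w - f (- ?w) = ?w * \<psi> ?w - (- ?w * \<psi> (- ?w)) + (f 0 / (1 + ?w) - f 0 / (1 - ?w))"
      unfolding 1 by (simp only: algebra_simps)
    also have "\<dots> = of_real g * (\<i> * (\<psi> ?w + \<psi> (- ?w)) - 2 * \<i> * f 0 * of_real (1 / (1 + g\<^sup>2)))"
      unfolding 2 by (simp add: algebra_simps)
    finally have "f ?w - f (- ?w) = of_real g * (\<i> * (\<psi> ?w + \<psi> (- ?w)) - 2 * \<i> * f 0 * of_real (1 / (1 + g\<^sup>2)))" .
    from arg_cong[OF this, of Re] have "\<phi> (g *\<^sub>R B - A) - \<phi> (g *\<^sub>R B + A) = g * h' g"
      by (simp only: h'_def f_\<phi>[symmetric] f_\<phi>'[symmetric] minus_complex.sel Re_complex_of_real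
          times_complex.sel Im_complex_of_real) simp
    then show ?thesis using that by (simp add: h_def)
  qed
  have cont: "continuous_on UNIV h'"
    unfolding h'_def
    by (intro continuous_intros continuous_on_compose2[OF holomorphic_on_imp_continuous_on[OF hol]] subsetI U')
      (auto simp: add_nonneg_eq_0_iff U')
  define K where "K = (C + C + \<bar>Re (2 * \<i> * f 0)\<bar>) * 2"
  have h'_bound: "\<exists>D. \<forall>g>0. \<bar>h' g\<bar> \<le> D * (1 / (1 + g\<^sup>2))"
  proof -
    have "bounded ((\<lambda>g. h' g * (1 + g\<^sup>2)) ` {0..R0})"
      by (intro compact_imp_bounded compact_continuous_image continuous_intros continuous_on_subset[OF cont]) auto
    then obtain D where "\<forall>y\<in>(\<lambda>g. h' g * (1 + g\<^sup>2)) ` {0..R0}. norm y \<le> D"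
      unfolding bounded_iff by blast
    then have D: "\<And>g. g \<in> {0..R0} \<Longrightarrow> \<bar>h' g * (1 + g\<^sup>2)\<bar> \<le> D"
      by simp
    have "\<bar>h' g\<bar> \<le> max D K * (1 / (1 + g\<^sup>2))" if g: "0 < g" for g
    proof -
      have p1: "0 < 1 + g\<^sup>2" by (simp add: add_pos_nonneg)
      have "\<bar>h' g * (1 + g\<^sup>2)\<bar> \<le> max D K"
      proof (cases "g \<le> R0")
        case True
        then show ?thesis using D[of g] g by (simp add: max.coboundedI1)
      next
        case False
        let ?w = "\<i> * of_real g"
        have g1: "1 \<le> g" using False R0 by linarith
        have "\<bar>Re (\<i> * (\<psi> ?w + \<psi> (- ?w)))\<bar> \<le> cmod (\<psi> ?w + \<psi> (- ?w))"
          using abs_Re_le_cmod[of "\<i> * (\<psi> ?w + \<psi> (- ?w))"] by (simp add: norm_mult)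
        also have "\<dots> \<le> C / g\<^sup>2 + C / g\<^sup>2"
          using \<psi>_decay[of ?w] \<psi>_decay[of "- ?w"] False g by (intro norm_triangle_le add_mono) (auto simp: norm_mult)
        finally have "\<bar>h' g\<bar> \<le> (C / g\<^sup>2 + C / g\<^sup>2) + \<bar>Re (2 * \<i> * f 0)\<bar> * (1 / (1 + g\<^sup>2))"
          unfolding h'_def using abs_triangle_ineq4[of "Re (\<i> * (\<psi> ?w + \<psi> (- ?w)))" "Re (2 * \<i> * f 0) * (1 / (1 + g\<^sup>2))"]
          by (simp add: abs_mult)
        also have "1 / (1 + g\<^sup>2) \<le> 1 / g\<^sup>2" using g by (intro divide_left_mono) (auto simp: add_pos_nonneg)
        finally have "\<bar>h' g\<bar> \<le> (C / g\<^sup>2 + C / g\<^sup>2) + \<bar>Re (2 * \<i> * f 0)\<bar> * (1 / g\<^sup>2)"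
          by (simp add: mult_left_mono)
        then have "\<bar>h' g\<bar> * (1 + g\<^sup>2) \<le> ((C / g\<^sup>2 + C / g\<^sup>2) + \<bar>Re (2 * \<i> * f 0)\<bar> * (1 / g\<^sup>2)) * (g\<^sup>2 + g\<^sup>2)"
          using g1 p1 C by (intro mult_mono) (auto simp: one_le_power)
        also have "\<dots> = K" using g by (simp add: K_def field_simps)
        finally show ?thesis using p1 by (simp add: abs_mult max.coboundedI2)
      qed
      then show ?thesis using p1 by (simp add: abs_mult field_simps)
    qed
    then show ?thesis by blast
  qed
  then obtain D where D: "\<And>g. 0 < g \<Longrightarrow> \<bar>h' g\<bar> \<le> D * (1 / (1 + g\<^sup>2))" by blast
  have int': "set_integrable lborel {0<..} h'"
  proof (rule set_integrable_norm_bound)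
    show "set_integrable lborel {0<..} (\<lambda>g. D * (1 / (1 + g\<^sup>2)))"
      by (rule set_integrable_mult_right) (rule set_integrable_inverse_1_plus_square)
    show "continuous_on {0<..} h'" by (rule continuous_on_subset[OF cont]) simp
  qed (use D in auto)
  have h_cong: "set_integrable lborel {0<..} h = set_integrable lborel {0<..} h'"
    "(LINT g:{0<..}|lborel. h g) = (LINT g:{0<..}|lborel. h' g)"
  proof -
    have "(\<lambda>g. indicator {0<..} g *\<^sub>R h g) = (\<lambda>g. indicator {0<..} g *\<^sub>R h' g)"
      by (auto simp: h_h' indicator_def fun_eq_iff)
    then show "set_integrable lborel {0<..} h = set_integrable lborel {0<..} h'"
      "(LINT g:{0<..}|lborel. h g) = (LINT g:{0<..}|lborel. h' g)"
      by (simp_all add: set_integrable_def set_lebesgue_integral_def)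
  qed
  show ?int using int' unfolding h_cong(1)[symmetric] h_def .
  \<comment> \<open>A primitive of \<open>h'\<close> with value 0 at 0. At infinity the part with
    \<Psi> vanishes by the arc bound and only the arctangent survives.\<close>
  define F where "F g = Re (\<Psi> (\<i> * of_real g) - \<Psi> (- (\<i> * of_real g))) - Re (2 * \<i> * f 0) * arctan g" for g
  have dF: "(F has_real_derivative h' g) (at g)" for g
  proof -
    have l: "((\<lambda>t. c * complex_of_real t) has_vector_derivative c) (at g)" for c
      unfolding has_vector_derivative_def
      by (auto intro!: derivative_eq_intros simp: scaleR_conv_of_real mult.commute)
    have 1: "((\<lambda>t. \<Psi> (\<i> * of_real t)) has_vector_derivative \<i> * \<psi> (\<i> * of_real g)) (at g)"
      using field_vector_diff_chain_at[OF l[of \<i>] \<Psi>'[OF U'[of "\<i> * of_real g"]]] by (simp add: o_def)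
    have 2: "((\<lambda>t. \<Psi> (- (\<i> * of_real t))) has_vector_derivative - \<i> * \<psi> (- (\<i> * of_real g))) (at g)"
      using field_vector_diff_chain_at[OF l[of "- \<i>"] \<Psi>'[OF U'[of "- \<i> * of_real g"]]] by (simp add: o_def)
    have "((\<lambda>t. Re (\<Psi> (\<i> * of_real t) - \<Psi> (- (\<i> * of_real t)))) has_vector_derivative
      Re (\<i> * \<psi> (\<i> * of_real g) - - \<i> * \<psi> (- (\<i> * of_real g)))) (at g)"
      by (rule bounded_linear.has_vector_derivative[OF bounded_linear_Re has_vector_derivative_diff[OF 1 2]])
    then have "((\<lambda>t. Re (\<Psi> (\<i> * of_real t) - \<Psi> (- (\<i> * of_real t)))) has_real_derivative
      Re (\<i> * (\<psi> (\<i> * of_real g) + \<psi> (- (\<i> * of_real g))))) (at g)"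
      by (simp add: has_real_derivative_iff_has_vector_derivative algebra_simps)
    from DERIV_diff[OF this DERIV_cmult[OF DERIV_arctan, of "Re (2 * \<i> * f 0)"]] show ?thesis
      unfolding F_def h'_def by (simp only: inverse_eq_divide)
  qed
  have "(LINT g:{0<..}|lborel. h' g) = pi * Im (f 0) - 0"
  proof (rule integral_Ioi_FTC[OF dF continuous_on_subset[OF cont] int'])
    have "isCont F 0" using dF[of 0] by (rule DERIV_isCont)
    then show "(F \<longlongrightarrow> 0) (at_right 0)" by (simp add: F_def isCont_def filterlim_at_split)
    have "((\<lambda>R. \<Psi> (\<i> * of_real R) - \<Psi> (- (\<i> * of_real R))) \<longlongrightarrow> 0) at_top"
    proof (rule Lim_null_comparison)
      show "eventually (\<lambda>R. cmod (\<Psi> (\<i> * of_real R) - \<Psi> (- (\<i> * of_real R))) \<le> C * pi / R) at_top"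
        using arc by (auto simp: eventually_at_top_linorder)
      show "((\<lambda>R. C * pi / R) \<longlongrightarrow> 0) at_top"
        by (rule real_tendsto_divide_at_top[OF tendsto_const filterlim_ident])
    qed
    then have "(F \<longlongrightarrow> Re 0 - Re (2 * \<i> * f 0) * (pi / 2)) at_top"
      unfolding F_def by (intro tendsto_intros tendsto_arctan_at_top)
    then show "(F \<longlongrightarrow> pi * Im (f 0)) at_top" by (simp add: mult.commute)
  qed simp
  also have "Im (f 0) = (\<Sum>r\<in>spec A. r / (s\<^sup>2 + r\<^sup>2) * (norm (eproj A r *v x))\<^sup>2)"
    using resolvent_minus_Im[OF A s, of x] by (simp add: f_def M0 P_def resolvent_def)
  finally show ?eq using h_cong(2) unfolding h_def by simp
qed

section \<open>Integrability of the resolvent weights\<close>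

lemma resolvent_form_bounds:
  assumes "hermitian X" "0 < s"
  shows "0 \<le> s * resolvent_form s x X" "s * resolvent_form s x X \<le> (norm x)\<^sup>2"
proof -
  show "0 \<le> s * resolvent_form s x X"
    unfolding resolvent_form_def resolvent_Re[OF assms]
    using assms(2) by (intro mult_nonneg_nonneg sum_nonneg) auto
  have "s * resolvent_form s x X = (\<Sum>r\<in>spec X. s * s / (s\<^sup>2 + r\<^sup>2) * (norm (eproj X r *v x))\<^sup>2)"
    unfolding resolvent_form_def resolvent_Re[OF assms] sum_distrib_left by (simp add: mult.assoc)
  also have "\<dots> \<le> (\<Sum>r\<in>spec X. 1 * (norm (eproj X r *v x))\<^sup>2)"
    using assms(2) by (intro sum_mono mult_right_mono) (auto simp: power2_eq_square divide_le_eq_1 add_pos_nonneg)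
  also have "\<dots> = (norm x)\<^sup>2" by (simp add: norm_eq_sum_eproj[OF assms(1), of x])
  finally show "s * resolvent_form s x X \<le> (norm x)\<^sup>2" .
qed

lemma op_norm_scaleR: "op_norm (r *\<^sub>R M) = \<bar>r\<bar> * op_norm M"
proof -
  have "(*v) (r *\<^sub>R M) = (\<lambda>v. r *\<^sub>R (M *v v))"
    by (rule ext) (rule matrix_vector_mult_scaleR_left)
  then show ?thesis
    unfolding op_norm_def using onorm_scaleR[OF matrix_vector_mul_bounded_linear[of M], of r] by simp
qed

lemma norm_smult_i: "norm (\<i> *s (x :: complex ^ 'n)) = norm x" "norm (- \<i> *s (x :: complex ^ 'n)) = norm x"
  by (simp_all only: norm_vec_smult norm_ii norm_minus_cancel mult_1)

lemma resolvent_form_diff_le: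
  assumes X: "hermitian X" and Y: "hermitian Y" and s: "0 < s"
  shows "\<bar>resolvent_form s x X - resolvent_form s x Y\<bar> \<le> op_norm (Y - X) * (norm x)\<^sup>2 / s\<^sup>2"
proof -
  have bX: "bounded_below s (shifted s \<i> X)" and bY: "bounded_below s (shifted s \<i> Y)"
    using bounded_below_shifted assms by blast+
  let ?z = "(shifted s \<i> Y - shifted s \<i> X) *v (resolvent s Y *v x)"
  have "resolvent_form s x X - resolvent_form s x Y = Re (cinner x (matrix_inv (shifted s \<i> X) *v ?z))"
    unfolding resolvent_form_def resolvent_def
    using arg_cong[OF matrix_inv_diff[OF bounded_below_invertible[OF bX] bounded_below_invertible[OF bY], of x],
        of "\<lambda>v. Re (cinner x v)"]
    by (simp add: cinner_diff_right)
  also have "\<bar>\<dots>\<bar> \<le> norm x * norm ?z / s"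
    using cmod_cinner_matrix_inv_le[OF bX, of x ?z] abs_Re_le_cmod order_trans by blast
  also have "\<dots> \<le> norm x * (op_norm (Y - X) * (norm x / s)) / s"
  proof (intro divide_right_mono mult_left_mono)
    have "norm ?z = norm ((Y - X) *v (resolvent s Y *v x))"
      unfolding shifted_diff by (rule norm_smult_i)
    also have "\<dots> \<le> op_norm (Y - X) * norm (resolvent s Y *v x)" by (rule norm_matrix_vector_le)
    also have "\<dots> \<le> op_norm (Y - X) * (norm x / s)"
      unfolding resolvent_def by (intro mult_left_mono norm_matrix_inv_le bY op_norm_nonneg)
    finally show "norm ?z \<le> op_norm (Y - X) * (norm x / s)" .
  qed (use s in auto)
  finally show ?thesis by (simp add: power2_eq_square mult_ac)
qed

text \<open>The derivative of \<open>resolvent_form s x\<close> at X in direction A: to first order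
  the inverse R of s + \<i> X changes by - \<i> R A R. Its linearity in A is the source of the
  cancellation in weighted sums.\<close>

definition resolvent_slope :: "real \<Rightarrow> complex ^ 'n \<Rightarrow> complex ^ 'n ^ 'n \<Rightarrow> complex ^ 'n ^ 'n \<Rightarrow> real" where
  "resolvent_slope s x X A = Re (- \<i> * cinner x (resolvent s X *v (A *v (resolvent s X *v x))))"

lemma resolvent_slope_minus: "resolvent_slope s x X (- A) = - resolvent_slope s x X A"
  by (simp add: resolvent_slope_def matrix_vector_mult_minus_left vec.neg cinner_minus_right)

lemma resolvent_slope_sum: "(\<Sum>k\<in>K. c k * resolvent_slope s x X (A k)) = resolvent_slope s x X (\<Sum>k\<in>K. c k *\<^sub>R A k)"
  by (simp add: resolvent_slope_def matrix_vector_mult_sum_left matrix_vector_mult_scaleR_left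
      matrix_vector_mult_sum_right matrix_vector_mult_scaleR_right cinner_sum_right cinner_scaleR_right
      sum_distrib_left sum_negf)

text \<open>Applying the resolvent identity twice leaves a remainder with three inverses and two
  factors A. The bound \<open>m\<close> is kept general because it is later taken to be s in one
  range and a multiple of g in another.\<close>

lemma resolvent_form_taylor:
  assumes b: "bounded_below m (shifted s \<i> X)" "bounded_below m (shifted s \<i> (X + A))"
  shows "\<bar>resolvent_form s x (X + A) - resolvent_form s x X - resolvent_slope s x X A\<bar> \<le>
    (op_norm A)\<^sup>2 * (norm x)\<^sup>2 / m ^ 3"
proof -
  let ?R = "resolvent s X" and ?S = "resolvent s (X + A)"
  have m: "0 < m" using b by (simp add: bounded_below_def)
  define T where "T v = - \<i> *s (A *v v)" for v
  have step: "?S *v v = ?R *v v + ?S *v T (?R *v v)" for v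
  proof -
    have "?S *v v - ?R *v v = ?S *v ((shifted s \<i> X - shifted s \<i> (X + A)) *v (?R *v v))"
      unfolding resolvent_def using matrix_inv_diff[OF bounded_below_invertible[OF b(2)] bounded_below_invertible[OF b(1)]] .
    also have "(shifted s \<i> X - shifted s \<i> (X + A)) *v (?R *v v) = T (?R *v v)"
      unfolding shifted_diff T_def by (simp add: matrix_vector_mult_minus_left)
    finally show ?thesis by (simp add: algebra_simps)
  qed
  define y where "y = T (?R *v x)"
  have "?S *v x - ?R *v x - ?R *v y = ?S *v T (?R *v y)"
    using step[of x] step[of y] by (simp add: y_def)
  moreover have "Re (cinner x (?R *v y)) = resolvent_slope s x X A"
    by (simp add: y_def T_def resolvent_slope_def matrix_vector_mult_smult cinner_smult_right vec.neg cinner_minus_right)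
  ultimately have "resolvent_form s x (X + A) - resolvent_form s x X - resolvent_slope s x X A =
      Re (cinner x (?S *v T (?R *v y)))"
    unfolding resolvent_form_def by (simp add: cinner_diff_right flip: \<open>?S *v x - ?R *v x - ?R *v y = ?S *v T (?R *v y)\<close>)
  also have "\<bar>\<dots>\<bar> \<le> norm x * norm (T (?R *v y)) / m"
    unfolding resolvent_def using cmod_cinner_matrix_inv_le[OF b(2)] abs_Re_le_cmod order_trans by blast
  also have "\<dots> \<le> norm x * (op_norm A * (op_norm A * (norm x / m) / m)) / m"
  proof -
    have T: "norm (T (?R *v v)) \<le> op_norm A * (norm v / m)" for v
    proof -
      have "norm (T (?R *v v)) = norm (A *v (?R *v v))" unfolding T_def by (rule norm_smult_i)
      also have "\<dots> \<le> op_norm A * norm (?R *v v)" by (rule norm_matrix_vector_le)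
      also have "\<dots> \<le> op_norm A * (norm v / m)"
        unfolding resolvent_def by (intro mult_left_mono norm_matrix_inv_le b op_norm_nonneg)
      finally show ?thesis .
    qed
    have "norm (T (?R *v y)) \<le> op_norm A * (norm y / m)" by (rule T)
    also have "\<dots> \<le> op_norm A * (op_norm A * (norm x / m) / m)"
      unfolding y_def using m by (intro mult_left_mono divide_right_mono T op_norm_nonneg) auto
    finally show ?thesis using m by (intro divide_right_mono mult_left_mono) auto
  qed
  also have "\<dots> = (op_norm A)\<^sup>2 * (norm x)\<^sup>2 / m ^ 3"
    by (simp add: power2_eq_square power3_eq_cube)
  finally show ?thesis .
qed

text \<open>This weight, taken once in g and once in s, forms the product majorant for Fubini. It
  behaves like t^(-1/2) at 0 and like t^(-3/2) at infinity.\<close>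

lemma set_integrable_inv_sqrt: "set_integrable lborel {0<..} (\<lambda>t::real. 1 / (sqrt t * (1 + t)))"
proof (rule integral_Ioi_FTC_nonneg)
  show "((\<lambda>t. 2 * arctan (sqrt t)) has_real_derivative 1 / (sqrt t * (1 + t))) (at t)" if "0 < t" for t
    using that by (auto intro!: derivative_eq_intros simp: divide_simps)
  show "continuous_on {0<..} (\<lambda>t::real. 1 / (sqrt t * (1 + t)))"
    by (intro continuous_intros) auto
  have "isCont (\<lambda>t. 2 * arctan (sqrt t)) 0" by (intro continuous_intros)
  then show "((\<lambda>t. 2 * arctan (sqrt t)) \<longlongrightarrow> 0) (at_right 0)"
    by (simp add: isCont_def filterlim_at_split)
  show "((\<lambda>t. 2 * arctan (sqrt t)) \<longlongrightarrow> 2 * (pi / 2)) at_top"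
    by (intro tendsto_intros filterlim_compose[OF tendsto_arctan_at_top] sqrt_at_top)
qed auto

lemma integrable_product_real:
  fixes f g :: "real \<Rightarrow> real"
  assumes f: "integrable lborel f" and g: "integrable lborel g"
  shows "integrable (lborel \<Otimes>\<^sub>M lborel) (\<lambda>(x, y). f x * g y)"
proof -
  have [measurable]: "f \<in> borel_measurable lborel" "g \<in> borel_measurable lborel"
    using f g by auto
  show ?thesis
  proof (rule lborel_pair.Fubini_integrable)
    show "(\<lambda>(x, y). f x * g y) \<in> borel_measurable (lborel \<Otimes>\<^sub>M lborel)" by measurable
    have "integrable lborel (\<lambda>x. norm (f x) * (\<integral>y. norm (g y) \<partial>lborel))"
      using f by (intro integrable_mult_left integrable_norm)
    then show "integrable lborel (\<lambda>x. \<integral>y. norm (case (x, y) of (x, y) \<Rightarrow> f x * g y) \<partial>lborel)"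
      by (simp add: abs_mult)
    show "AE x in lborel. integrable lborel (\<lambda>y. case (x, y) of (x, y) \<Rightarrow> f x * g y)"
      using g by auto
  qed
qed

text \<open>The integrand shared by the two iterated integrals. The factor s is the one that makes
  integration over s produce absolute values.\<close>

definition rweight :: "complex ^ 'n ^ 'n \<Rightarrow> complex ^ 'n \<Rightarrow> complex ^ 'n ^ 'n \<Rightarrow> real \<Rightarrow> real \<Rightarrow> real" where
  "rweight B x A g s = s * ((resolvent_form s x (g *\<^sub>R B - A) - resolvent_form s x (g *\<^sub>R B + A)) / g)"

lemma continuous_on_cinner: "continuous_on S f \<Longrightarrow> continuous_on S (\<lambda>a. cinner x (f a))"
  unfolding cinner_def by (intro continuous_intros)

lemma shifted_nth: "shifted s c X $ i $ j = (if i = j then of_real s else 0) + c * X $ i $ j"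
proof -
  have "(shifted s c X *v axis j 1) $ i = s *\<^sub>R axis j 1 $ i + c * (X *v axis j 1) $ i"
    by (simp add: shifted_vec)
  then show ?thesis
    unfolding matrix_vector_mult_axis by (simp add: axis_def scaleR_conv_of_real[where 'a=complex])
qed

text \<open>Joint continuity in (g, s) supplies the measurability on the product space that Fubini
  requires.\<close>

lemma continuous_on_resolvent_form:
  assumes X: "\<And>g. hermitian (X g)" and c: "\<And>i j. continuous_on UNIV (\<lambda>g::real. X g $ i $ j)"
  shows "continuous_on (S \<times> {0<..}) (\<lambda>(g, s). resolvent_form s x (X g))"
proof -
  have 1: "continuous_on (S \<times> {0<..}) (\<lambda>p. X (fst p) $ i $ j)" for i j
    by (rule continuous_on_compose2[OF c]) (auto intro: continuous_intros)
  have "continuous_on (S \<times> {0<..}) (\<lambda>p. matrix_inv (shifted (snd p) \<i> (X (fst p))) *v x)"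
  proof (rule continuous_on_matrix_inv)
    show "continuous_on (S \<times> {0<..}) (\<lambda>p. shifted (snd p) \<i> (X (fst p)) $ i $ j)" for i j
      unfolding shifted_nth by (cases "i = j") (auto intro!: continuous_intros 1)
    show "invertible (shifted (snd p) \<i> (X (fst p)))" if "p \<in> S \<times> {0<..}" for p
      using that by (intro bounded_below_invertible[OF bounded_below_shifted[OF X]]) auto
  qed
  then show ?thesis
    unfolding resolvent_form_def resolvent_def case_prod_unfold
    by (intro continuous_intros continuous_on_cinner)
qed

lemma continuous_on_rweight:
  assumes "hermitian A" "hermitian B"
  shows "continuous_on ({0<..} \<times> {0<..}) (\<lambda>(g, s). rweight B x A g s)"
proof -
  have 1: "continuous_on ({0<..} \<times> {0<..}) (\<lambda>(g, s). resolvent_form s x (g *\<^sub>R B + A))"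
    using assms by (intro continuous_on_resolvent_form hermitian_add hermitian_scaleR) (auto intro!: continuous_intros)
  have 2: "continuous_on ({0<..} \<times> {0<..}) (\<lambda>(g, s). resolvent_form s x (g *\<^sub>R B - A))"
    using assms by (intro continuous_on_resolvent_form hermitian_diff hermitian_scaleR) (auto intro!: continuous_intros)
  from 1 2 show ?thesis
    unfolding rweight_def case_prod_unfold by (intro continuous_intros) auto
qed

context
  fixes B :: "complex ^ 'n ^ 'n" and \<beta> :: real and x :: "complex ^ 'n"
    and K :: "'k set" and c :: "'k \<Rightarrow> real" and As :: "'k \<Rightarrow> complex ^ 'n ^ 'n"
  assumes B: "hermitian B" and \<beta>: "0 < \<beta>" "\<And>v. \<beta> * (norm v)\<^sup>2 \<le> qform B v"
    and K: "finite K" and As: "\<And>k. k \<in> K \<Longrightarrow> hermitian (As k)" and sum0: "(\<Sum>k\<in>K. c k *\<^sub>R As k) = 0"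
begin

text \<open>The terms of first order in \<open>As k\<close> cancel because \<open>sum0\<close> holds; this cancellation is what makes the
  sum integrable for large \<open>g\<close> and \<open>s\<close>, unlike its individual terms.\<close>

lemma rweight_sum_bounds:
  obtains C where "0 \<le> C"
    "\<And>g s. 0 < g \<Longrightarrow> 0 < s \<Longrightarrow> \<bar>\<Sum>k\<in>K. c k * rweight B x (As k) g s\<bar> \<le> C / g"
    "\<And>g s. 0 < g \<Longrightarrow> 0 < s \<Longrightarrow> \<bar>\<Sum>k\<in>K. c k * rweight B x (As k) g s\<bar> \<le> C / s"
    "\<And>g s. 0 < g \<Longrightarrow> 0 < s \<Longrightarrow> \<bar>\<Sum>k\<in>K. c k * rweight B x (As k) g s\<bar> \<le> C / (g * s\<^sup>2)"
    "\<And>g s. C \<le> g \<Longrightarrow> 0 < g \<Longrightarrow> 0 < s \<Longrightarrow> \<bar>\<Sum>k\<in>K. c k * rweight B x (As k) g s\<bar> \<le> C * s / g ^ 4"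
proof -
  let ?W = "\<lambda>g s. \<Sum>k\<in>K. c k * rweight B x (As k) g s"
  define n where "n = (norm x)\<^sup>2"
  define a where "a = (\<Sum>k\<in>K. op_norm (As k))"
  define d where "d = (\<Sum>k\<in>K. \<bar>c k\<bar>)"
  have n: "0 \<le> n" and a: "0 \<le> a" and d: "0 \<le> d"
    by (auto simp: n_def a_def d_def intro!: sum_nonneg op_norm_nonneg)
  have ak: "op_norm (As k) \<le> a" if "k \<in> K" for k
    unfolding a_def using K that by (intro member_le_sum op_norm_nonneg) auto
  have Y: "hermitian (g *\<^sub>R B + As k)" "hermitian (g *\<^sub>R B - As k)" "hermitian (g *\<^sub>R B)" if "k \<in> K" for g k
    using B As[OF that] by (auto intro: hermitian_add hermitian_diff hermitian_scaleR)
  have sum_bound: "\<bar>\<Sum>k\<in>K. c k * v k\<bar> \<le> d * e" if "\<And>k. k \<in> K \<Longrightarrow> \<bar>v k\<bar> \<le> e" for v :: "'k \<Rightarrow> real" and e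
  proof -
    have "\<bar>\<Sum>k\<in>K. c k * v k\<bar> \<le> (\<Sum>k\<in>K. \<bar>c k\<bar> * e)"
      using that by (intro order_trans[OF sum_abs] sum_mono) (auto simp: abs_mult intro: mult_left_mono)
    then show ?thesis by (simp add: d_def sum_distrib_right)
  qed
  have 1: "\<bar>?W g s\<bar> \<le> d * (n / g)" if "0 < g" "0 < s" for g s
  proof (rule sum_bound)
    fix k assume k: "k \<in> K"
    have "\<bar>s * resolvent_form s x (g *\<^sub>R B - As k) - s * resolvent_form s x (g *\<^sub>R B + As k)\<bar> \<le> n"
      using resolvent_form_bounds[OF Y(1)[OF k] that(2)] resolvent_form_bounds[OF Y(2)[OF k] that(2)]
      unfolding n_def by (smt (verit))
    then have "\<bar>s * resolvent_form s x (g *\<^sub>R B - As k) - s * resolvent_form s x (g *\<^sub>R B + As k)\<bar> / g \<le> n / g"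
      using that by (intro divide_right_mono) auto
    then show "\<bar>rweight B x (As k) g s\<bar> \<le> n / g"
      using that by (simp add: rweight_def abs_mult right_diff_distrib[symmetric])
  qed
  have 2: "\<bar>?W g s\<bar> \<le> d * (2 * op_norm B * n / s)" if g: "0 < g" and s: "0 < s" for g s
  proof (rule sum_bound)
    fix k assume k: "k \<in> K"
    \<comment> \<open>By evenness g B + A_k may be replaced by its negative, which differs from g B
      - A_k by 2 g B alone; this factor g cancels the division by g.\<close>
    have e0: "resolvent_form s x (g *\<^sub>R B + As k) = resolvent_form s x (- (g *\<^sub>R B + As k))"
      unfolding resolvent_form_def using resolvent_minus_Re[OF Y(1)[OF k] s] by simp
    have "\<bar>resolvent_form s x (g *\<^sub>R B - As k) - resolvent_form s x (g *\<^sub>R B + As k)\<bar>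
      \<le> op_norm (- (g *\<^sub>R B + As k) - (g *\<^sub>R B - As k)) * n / s\<^sup>2"
      unfolding n_def e0 by (rule resolvent_form_diff_le[OF Y(2)[OF k] hermitian_minus[OF Y(1)[OF k]] s])
    also have "- (g *\<^sub>R B + As k) - (g *\<^sub>R B - As k) = (- 2) *\<^sub>R (g *\<^sub>R B)"
      by (simp only: scaleR_minus_left scaleR_2) simp
    also have "op_norm \<dots> = 2 * g * op_norm B"
      unfolding op_norm_scaleR using g by simp
    finally have "s * (\<bar>resolvent_form s x (g *\<^sub>R B - As k) - resolvent_form s x (g *\<^sub>R B + As k)\<bar> / g)
      \<le> s * ((2 * g * op_norm B * n / s\<^sup>2) / g)"
      using g s by (intro mult_left_mono divide_right_mono) auto
    then show "\<bar>rweight B x (As k) g s\<bar> \<le> 2 * op_norm B * n / s"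
      using g s by (simp add: rweight_def abs_mult power2_eq_square)
  qed
  have 3: "\<bar>?W g s\<bar> \<le> d * (2 * (a\<^sup>2 * n / m ^ 3) * (s / g))"
    if g: "0 < g" and s: "0 < s" and m: "0 < m"
      and b: "\<And>k. k \<in> K \<Longrightarrow> bounded_below m (shifted s \<i> (g *\<^sub>R B)) \<and>
        bounded_below m (shifted s \<i> (g *\<^sub>R B + As k)) \<and> bounded_below m (shifted s \<i> (g *\<^sub>R B - As k))" for g s m
  proof -
    define L where "L k = resolvent_slope s x (g *\<^sub>R B) (As k)" for k
    \<comment> \<open>Adding 2 L k changes the weighted sum only by a multiple of the vanishing sum
      of the slopes, and it makes every single term of second order in \<open>As k\<close>.\<close>
    define v where "v k = (s / g) * (resolvent_form s x (g *\<^sub>R B - As k) - resolvent_form s x (g *\<^sub>R B + As k) + 2 * L k)" for k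
    have "(\<Sum>k\<in>K. c k * L k) = 0"
      unfolding L_def resolvent_slope_sum sum0 by (simp add: resolvent_slope_def)
    have "c k * v k = c k * rweight B x (As k) g s + 2 * (s / g) * (c k * L k)" for k
      using g by (simp add: v_def rweight_def field_simps)
    then have "(\<Sum>k\<in>K. c k * v k) = ?W g s + 2 * (s / g) * (\<Sum>k\<in>K. c k * L k)"
      by (simp only: sum.distrib sum_distrib_left)
    also have "\<dots> = ?W g s" using \<open>(\<Sum>k\<in>K. c k * L k) = 0\<close> by simp
    finally have W: "?W g s = (\<Sum>k\<in>K. c k * v k)" by simp
    show ?thesis unfolding W
    proof (rule sum_bound)
      fix k assume k: "k \<in> K"
      have e: "(op_norm (As k))\<^sup>2 * (norm x)\<^sup>2 / m ^ 3 \<le> a\<^sup>2 * n / m ^ 3"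
        unfolding n_def using ak[OF k] m
        by (intro divide_right_mono mult_right_mono power_mono op_norm_nonneg) auto
      have "op_norm (- As k) = op_norm (As k)"
        unfolding op_norm_def matrix_vector_mult_minus_left using onorm_neg by blast
      then have "\<bar>resolvent_form s x (g *\<^sub>R B - As k) - resolvent_form s x (g *\<^sub>R B) + L k\<bar> \<le> a\<^sup>2 * n / m ^ 3"
        using resolvent_form_taylor[of m s "g *\<^sub>R B" "- As k" x] b[OF k] e
        by (simp add: L_def resolvent_slope_minus)
      moreover have "\<bar>resolvent_form s x (g *\<^sub>R B + As k) - resolvent_form s x (g *\<^sub>R B) - L k\<bar> \<le> a\<^sup>2 * n / m ^ 3"
        using resolvent_form_taylor[of m s "g *\<^sub>R B" "As k" x] b[OF k] e by (simp add: L_def)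
      ultimately have "\<bar>resolvent_form s x (g *\<^sub>R B - As k) - resolvent_form s x (g *\<^sub>R B + As k) + 2 * L k\<bar> \<le> 2 * (a\<^sup>2 * n / m ^ 3)"
        by linarith
      then have "(s / g) * \<bar>resolvent_form s x (g *\<^sub>R B - As k) - resolvent_form s x (g *\<^sub>R B + As k) + 2 * L k\<bar> \<le> (s / g) * (2 * (a\<^sup>2 * n / m ^ 3))"
        using g s by (intro mult_left_mono) auto
      then show "\<bar>v k\<bar> \<le> 2 * (a\<^sup>2 * n / m ^ 3) * (s / g)"
        using g s by (simp add: v_def abs_mult mult.commute)
    qed
  qed
  have w3: "\<bar>?W g s\<bar> \<le> 2 * d * a\<^sup>2 * n / (g * s\<^sup>2)" if g: "0 < g" and s: "0 < s" for g s
  proof -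
    have "\<bar>?W g s\<bar> \<le> d * (2 * (a\<^sup>2 * n / s ^ 3) * (s / g))"
      using Y s by (intro 3 g s) (auto intro!: bounded_below_shifted)
    also have "\<dots> = 2 * d * a\<^sup>2 * n / (g * s\<^sup>2)" using s by (simp add: power2_eq_square power3_eq_cube mult_ac)
    finally show ?thesis .
  qed
  have 4: "\<bar>?W g s\<bar> \<le> 16 * d * a\<^sup>2 * n / \<beta> ^ 3 * s / g ^ 4" if ga: "2 * a / \<beta> \<le> g" and g: "0 < g" and s: "0 < s" for g s
  proof -
    \<comment> \<open>Half of the lower bound g \<beta> of g B. The other half absorbs
      \<open>As k\<close>, because a \<le> m for these g.\<close>
    define m where "m = g * \<beta> / 2"
    have m: "0 < m" using g \<beta> by (simp add: m_def)
    have am: "a \<le> m" using ga \<beta> by (simp add: m_def field_simps)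
    have q: "2 * m * (norm v)\<^sup>2 \<le> qform (g *\<^sub>R B) v" for v
      using \<beta>(2)[of v] g by (simp add: qform_scaleR m_def mult.assoc)
    have qA: "\<bar>qform (As k) v\<bar> \<le> m * (norm v)\<^sup>2" if "k \<in> K" for k v
      using abs_qform_le[of "As k" v] ak[OF that] am by (meson mult_right_mono order_trans zero_le_power2)
    have nn: "0 \<le> m * (norm v)\<^sup>2" for v :: "complex ^ 'n" using m by simp
    have "\<bar>?W g s\<bar> \<le> d * (2 * (a\<^sup>2 * n / m ^ 3) * (s / g))"
    proof (intro 3 g s m conjI bounded_below_shifted_Im)
      fix k v assume k: "k \<in> K"
      show "m * (norm v)\<^sup>2 \<le> \<bar>qform (g *\<^sub>R B) v\<bar>" using q[of v] nn[of v] by linarith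
      show "m * (norm v)\<^sup>2 \<le> \<bar>qform (g *\<^sub>R B + As k) v\<bar>"
        using q[of v] qA[OF k, of v] by (simp add: qform_add)
      show "m * (norm v)\<^sup>2 \<le> \<bar>qform (g *\<^sub>R B - As k) v\<bar>"
        using q[of v] qA[OF k, of v] by (simp add: qform_diff)
    qed (use Y in auto)
    also have "\<dots> = 16 * d * a\<^sup>2 * n / \<beta> ^ 3 * s / g ^ 4"
      by (simp add: m_def field_simps power3_eq_cube power4_eq_xxxx)
    finally show ?thesis .
  qed
  \<comment> \<open>The last summand lets the same constant serve as the threshold for g in the
    fourth bound.\<close>
  define C where "C = d * n + d * 2 * op_norm B * n + 2 * d * a\<^sup>2 * n + 16 * d * a\<^sup>2 * n / \<beta> ^ 3 + 2 * a / \<beta>"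
  have p: "0 \<le> d * n" "0 \<le> d * 2 * op_norm B * n" "0 \<le> 2 * d * a\<^sup>2 * n" "0 \<le> 16 * d * a\<^sup>2 * n / \<beta> ^ 3" "0 \<le> 2 * a / \<beta>"
    using d n a \<beta> op_norm_nonneg[of B] by simp_all
  show thesis
  proof (rule that[of C])
    show "0 \<le> C" using p by (simp add: C_def)
    show "\<bar>?W g s\<bar> \<le> C / g" if "0 < g" "0 < s" for g s
    proof -
      have "\<bar>?W g s\<bar> \<le> (d * n) / g" using 1[OF that] by simp
      also have "\<dots> \<le> C / g" using that p by (intro divide_right_mono) (simp_all add: C_def)
      finally show ?thesis .
    qed
    show "\<bar>?W g s\<bar> \<le> C / s" if "0 < g" "0 < s" for g s
    proof -
      have "\<bar>?W g s\<bar> \<le> (d * 2 * op_norm B * n) / s" using 2[OF that] by (simp add: mult.assoc)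
      also have "\<dots> \<le> C / s" using that p by (intro divide_right_mono) (simp_all add: C_def)
      finally show ?thesis .
    qed
    show "\<bar>?W g s\<bar> \<le> C / (g * s\<^sup>2)" if "0 < g" "0 < s" for g s
    proof -
      have "2 * d * a\<^sup>2 * n \<le> C" using p unfolding C_def by linarith
      then have "2 * d * a\<^sup>2 * n / (g * s\<^sup>2) \<le> C / (g * s\<^sup>2)"
        using that by (intro divide_right_mono) auto
      with w3[OF that] show ?thesis by linarith
    qed
    show "\<bar>?W g s\<bar> \<le> C * s / g ^ 4" if "C \<le> g" "0 < g" "0 < s" for g s
    proof -
      have "2 * a / \<beta> \<le> g" using that(1) p unfolding C_def by linarith
      then have "\<bar>?W g s\<bar> \<le> (16 * d * a\<^sup>2 * n / \<beta> ^ 3) * s / g ^ 4" using 4 that by blast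
      also have "\<dots> \<le> C * s / g ^ 4"
      proof (intro divide_right_mono mult_right_mono)
        show "16 * d * a\<^sup>2 * n / \<beta> ^ 3 \<le> C" using p unfolding C_def by linarith
      qed (use that in auto)
      finally show ?thesis .
    qed
  qed
qed

text \<open>In each region of (g, s) two of the four bounds, or one of them twice, are multiplied,
  which interpolates between them; squaring avoids the square roots of the majorant. Near the origin
  C / g and C / s together give (g s)^(-1/2). For large g the fourth bound is strong enough while s
  < g, and the third takes over once s is at least g.\<close>

lemma rweight_sum_dominated:
  obtains D where "\<And>g s. 0 < g \<Longrightarrow> 0 < s \<Longrightarrow>
    \<bar>\<Sum>k\<in>K. c k * rweight B x (As k) g s\<bar> \<le> D * (1 / (sqrt g * (1 + g)) * (1 / (sqrt s * (1 + s))))"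
proof -
  let ?W = "\<lambda>g s. \<bar>\<Sum>k\<in>K. c k * rweight B x (As k) g s\<bar>"
  obtain C where C: "0 \<le> C" "\<And>g s. 0 < g \<Longrightarrow> 0 < s \<Longrightarrow> ?W g s \<le> C / g"
    "\<And>g s. 0 < g \<Longrightarrow> 0 < s \<Longrightarrow> ?W g s \<le> C / s"
    "\<And>g s. 0 < g \<Longrightarrow> 0 < s \<Longrightarrow> ?W g s \<le> C / (g * s\<^sup>2)"
    "\<And>g s. C \<le> g \<Longrightarrow> 0 < g \<Longrightarrow> 0 < s \<Longrightarrow> ?W g s \<le> C * s / g ^ 4"
    by (rule rweight_sum_bounds) blast
  define G where "G = max 1 C"
  have G: "1 \<le> G" "C \<le> G" by (auto simp: G_def)
  define D where "D = 4 * C * (1 + G)"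
  have key: "(?W g s)\<^sup>2 * (g * s * (1 + g)\<^sup>2 * (1 + s)\<^sup>2) \<le> D\<^sup>2" if g: "0 < g" and s: "0 < s" for g s
  proof -
    have D2: "D\<^sup>2 = C\<^sup>2 * ((1 + G)\<^sup>2 * 16)" by (simp add: D_def power_mult_distrib)
    have G4: "4 \<le> (1 + G)\<^sup>2" using G power_mono[of 2 "1 + G" 2] by simp
    have gs: "0 \<le> g * s * (1 + g)\<^sup>2 * (1 + s)\<^sup>2" using g s by simp
    have s4: "(1 + s)\<^sup>2 \<le> 4" if "s < 1" using s that power_mono[of "1 + s" 2 2] by simp
    have s4': "(1 + s)\<^sup>2 \<le> 4 * s\<^sup>2" if "1 \<le> s" using that power_mono[of "1 + s" "2 * s" 2] by (simp add: power_mult_distrib)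
    have s4'': "(1 + s)\<^sup>2 / s\<^sup>2 \<le> 16" if "1 \<le> s"
    proof -
      have "(1 + s)\<^sup>2 \<le> 16 * s\<^sup>2" using s4'[OF that] zero_le_power2[of s] by linarith
      then show ?thesis using s by (simp add: divide_le_eq)
    qed
    consider (a) "g < G" "s < 1" | (b) "g < G" "1 \<le> s" | (c) "G \<le> g" "s < 1" | (d) "G \<le> g" "1 \<le> s" "g \<le> s" | (e) "G \<le> g" "1 \<le> s" "s < g"
      by linarith
    then show ?thesis
    proof cases
      case a
      have "(?W g s)\<^sup>2 \<le> (C / g) * (C / s)"
        unfolding power2_eq_square using C(1,2,3) g s by (intro mult_mono) auto
      then have "(?W g s)\<^sup>2 * (g * s * (1 + g)\<^sup>2 * (1 + s)\<^sup>2) \<le> (C / g) * (C / s) * (g * s * (1 + g)\<^sup>2 * (1 + s)\<^sup>2)"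
        using gs by (rule mult_right_mono)
      also have "\<dots> = C\<^sup>2 * ((1 + g)\<^sup>2 * (1 + s)\<^sup>2)" using g s by (simp add: power2_eq_square)
      also have "\<dots> \<le> C\<^sup>2 * ((1 + G)\<^sup>2 * 16)"
        using s4 a g by (intro mult_left_mono mult_mono power_mono) auto
      finally show ?thesis unfolding D2 .
    next
      case b
      have "(?W g s)\<^sup>2 \<le> (C / s) * (C / (g * s\<^sup>2))"
        unfolding power2_eq_square[of "?W g s"] using C(1,3,4) g s by (intro mult_mono) auto
      then have "(?W g s)\<^sup>2 * (g * s * (1 + g)\<^sup>2 * (1 + s)\<^sup>2) \<le> (C / s) * (C / (g * s\<^sup>2)) * (g * s * (1 + g)\<^sup>2 * (1 + s)\<^sup>2)"
        using gs by (rule mult_right_mono)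
      also have "\<dots> = C\<^sup>2 * ((1 + g)\<^sup>2 * ((1 + s)\<^sup>2 / s\<^sup>2))" using g s by (simp add: power2_eq_square)
      also have "\<dots> \<le> C\<^sup>2 * ((1 + G)\<^sup>2 * 16)"
        using s4'' b g s by (intro mult_left_mono mult_mono power_mono) auto
      finally show ?thesis unfolding D2 .
    next
      case c
      have g1: "1 \<le> g" "C \<le> g" using c G by auto
      have "(?W g s)\<^sup>2 \<le> (C * s / g ^ 4) * (C * s / g ^ 4)"
        unfolding power2_eq_square using C(1,5) g1 g s by (intro mult_mono) auto
      also have "\<dots> \<le> (C / g ^ 4) * (C / g ^ 4)"
        using C(1) c g s by (intro mult_mono divide_right_mono) (auto simp: mult_left_le)
      also have "\<dots> = C\<^sup>2 / (g ^ 8)" by (simp add: power2_eq_square flip: power_add)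
      also have "\<dots> \<le> C\<^sup>2 / (g ^ 3)" using g1 by (intro divide_left_mono power_increasing) auto
      finally have "(?W g s)\<^sup>2 * (g * s * (1 + g)\<^sup>2 * (1 + s)\<^sup>2) \<le> C\<^sup>2 / (g ^ 3) * (g * s * (1 + g)\<^sup>2 * (1 + s)\<^sup>2)"
        using gs by (rule mult_right_mono)
      also have "\<dots> \<le> C\<^sup>2 / (g ^ 3) * (g * 1 * (4 * g\<^sup>2) * 4)"
        using c s4 s g g1 power_mono[of "1 + g" "2 * g" 2]
        by (intro mult_left_mono mult_mono) (auto simp: power_mult_distrib)
      also have "\<dots> = C\<^sup>2 * 16" using g by (simp add: power2_eq_square power3_eq_cube)
      also have "\<dots> \<le> C\<^sup>2 * ((1 + G)\<^sup>2 * 16)" using G4 by (intro mult_left_mono) auto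
      finally show ?thesis unfolding D2 .
    next
      case d
      have g1: "1 \<le> g" using d G by auto
      have "(?W g s)\<^sup>2 \<le> (C / (g * s\<^sup>2)) * (C / (g * s\<^sup>2))"
        unfolding power2_eq_square[of "?W g s"] using C(1,4) g s by (intro mult_mono) auto
      \<comment> \<open>Since g \<le> s, one factor s is given up for a factor g, which balances the
        decay in the two variables.\<close>
      also have "\<dots> \<le> (C / (g * s * g)) * (C / (g * s\<^sup>2))"
        using C(1) d g s by (intro mult_right_mono divide_left_mono) (auto simp: power2_eq_square)
      finally have "(?W g s)\<^sup>2 * (g * s * (1 + g)\<^sup>2 * (1 + s)\<^sup>2) \<le> (C / (g * s * g)) * (C / (g * s\<^sup>2)) * (g * s * (1 + g)\<^sup>2 * (1 + s)\<^sup>2)"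
        using gs by (rule mult_right_mono)
      also have "\<dots> \<le> (C / (g * s * g)) * (C / (g * s\<^sup>2)) * (g * s * (4 * g\<^sup>2) * (4 * s\<^sup>2))"
        using C(1) d s4' s g g1 power_mono[of "1 + g" "2 * g" 2]
        by (intro mult_left_mono mult_mono) (auto simp: power_mult_distrib)
      also have "\<dots> = C\<^sup>2 * 16" using g s by (simp add: power2_eq_square)
      also have "\<dots> \<le> C\<^sup>2 * ((1 + G)\<^sup>2 * 16)" using G4 by (intro mult_left_mono) auto
      finally show ?thesis unfolding D2 .
    next
      case e
      have g1: "1 \<le> g" "C \<le> g" using e G by auto
      have "(?W g s)\<^sup>2 \<le> (C * s / g ^ 4) * (C * s / g ^ 4)"
        unfolding power2_eq_square using C(1,5) g1 g s by (intro mult_mono) auto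
      then have "(?W g s)\<^sup>2 * (g * s * (1 + g)\<^sup>2 * (1 + s)\<^sup>2) \<le> (C * s / g ^ 4) * (C * s / g ^ 4) * (g * s * (1 + g)\<^sup>2 * (1 + s)\<^sup>2)"
        using gs by (rule mult_right_mono)
      also have "\<dots> \<le> (C * s / g ^ 4) * (C * s / g ^ 4) * (g * s * (4 * g\<^sup>2) * (4 * s\<^sup>2))"
        using C(1) e s4' s g g1 power_mono[of "1 + g" "2 * g" 2]
        by (intro mult_left_mono mult_mono) (auto simp: power_mult_distrib)
      also have "\<dots> = C\<^sup>2 * 16 * ((s / g) ^ 5)"
        using g s by (simp add: power2_eq_square power4_eq_xxxx eval_nat_numeral)
      also have "\<dots> \<le> C\<^sup>2 * 16 * 1"
        using e g s by (intro mult_left_mono power_le_one) auto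
      also have "\<dots> = C\<^sup>2 * 16" by simp
      also have "\<dots> \<le> C\<^sup>2 * ((1 + G)\<^sup>2 * 16)" using G4 by (intro mult_left_mono) auto
      finally show ?thesis unfolding D2 .
    qed
  qed
  show thesis
  proof (rule that[of D])
    fix g s :: real assume g: "0 < g" and s: "0 < s"
    let ?d = "sqrt g * (1 + g) * (sqrt s * (1 + s))"
    have d: "0 < ?d" using g s by simp
    have "(?W g s * ?d)\<^sup>2 \<le> D\<^sup>2"
      using key[OF g s] g s by (simp add: power_mult_distrib mult_ac)
    moreover have "0 \<le> D" using C(1) G by (simp add: D_def)
    ultimately have "?W g s * ?d \<le> D" by (rule power2_le_imp_le)
    then show "?W g s \<le> D * (1 / (sqrt g * (1 + g)) * (1 / (sqrt s * (1 + s))))"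
      using d by (simp add: pos_le_divide_eq)
  qed
qed

lemma integrable_rweight_sum:
  "integrable (lborel \<Otimes>\<^sub>M lborel) (\<lambda>(g, s). indicator {0<..} g * indicator {0<..} s * (\<Sum>k\<in>K. c k * rweight B x (As k) g s))"
proof -
  obtain D where D: "\<And>g s. 0 < g \<Longrightarrow> 0 < s \<Longrightarrow>
    \<bar>\<Sum>k\<in>K. c k * rweight B x (As k) g s\<bar> \<le> D * (1 / (sqrt g * (1 + g)) * (1 / (sqrt s * (1 + s))))"
    by (rule rweight_sum_dominated) blast
  let ?a = "\<lambda>t::real. indicator {0<..} t * (1 / (sqrt t * (1 + t)))"
  have a: "integrable lborel ?a"
    using set_integrable_inv_sqrt by (simp add: set_integrable_def)
  show ?thesis
  proof (rule Bochner_Integration.integrable_bound)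
    show "integrable (lborel \<Otimes>\<^sub>M lborel) (\<lambda>p. D * (case p of (g, s) \<Rightarrow> ?a g * ?a s))"
      by (intro integrable_mult_right integrable_product_real a)
    have "continuous_on ({0<..} \<times> {0<..}) (\<lambda>(g, s). rweight B x (As k) g s)" if "k \<in> K" for k
      by (intro continuous_on_rweight As B that)
    then have "continuous_on ({0<..} \<times> {0<..}) (\<lambda>p. \<Sum>k\<in>K. c k * rweight B x (As k) (fst p) (snd p))"
      by (intro continuous_intros) (auto simp: case_prod_unfold)
    then have "(\<lambda>p. indicator ({0<..} \<times> {0<..}) p *\<^sub>R (\<Sum>k\<in>K. c k * rweight B x (As k) (fst p) (snd p)))
      \<in> borel_measurable borel"
      by (intro borel_measurable_continuous_on_indicator) (auto intro!: borel_open open_Times)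
    then show "(\<lambda>(g, s). indicator {0<..} g * indicator {0<..} s * (\<Sum>k\<in>K. c k * rweight B x (As k) g s))
      \<in> borel_measurable (lborel \<Otimes>\<^sub>M lborel)"
      unfolding lborel_prod by (simp add: case_prod_unfold indicator_times)
    show "AE p in lborel \<Otimes>\<^sub>M lborel. norm (case p of (g, s) \<Rightarrow> indicator {0<..} g * indicator {0<..} s * (\<Sum>k\<in>K. c k * rweight B x (As k) g s))
      \<le> norm (D * (case p of (g, s) \<Rightarrow> ?a g * ?a s))"
    proof (intro AE_I2)
      fix p :: "real \<times> real"
      obtain g s where p: "p = (g, s)" by (cases p)
      show "norm (case p of (g, s) \<Rightarrow> indicator {0<..} g * indicator {0<..} s * (\<Sum>k\<in>K. c k * rweight B x (As k) g s))
        \<le> norm (D * (case p of (g, s) \<Rightarrow> ?a g * ?a s))"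
      proof (cases "0 < g \<and> 0 < s")
        case True
        then show ?thesis using order_trans[OF D[of g s] abs_ge_self] by (simp add: p)
      next
        case False
        then have "indicator {0<..} g * indicator {0<..} s = (0::real)" by auto
        then show ?thesis by (auto simp: p)
      qed
    qed
  qed
qed

end

section \<open>Absolute values and logarithms as resolvent integrals\<close>

lemma integral_square_resolvent:
  "set_integrable lborel {0<..} (\<lambda>s::real. r\<^sup>2 / (s\<^sup>2 + r\<^sup>2))"
  "(LINT s:{0<..}|lborel. r\<^sup>2 / (s\<^sup>2 + r\<^sup>2)) = \<bar>r\<bar> * (pi / 2)"
proof -
  have *: "set_integrable lborel {0<..} (\<lambda>s::real. r\<^sup>2 / (s\<^sup>2 + r\<^sup>2)) \<and>
    (LINT s:{0<..}|lborel. r\<^sup>2 / (s\<^sup>2 + r\<^sup>2)) = r * (pi / 2)" if r: "0 < r" for r :: real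
  proof -
    let ?F = "\<lambda>s. r * arctan (s / r)"
    have d: "(?F has_real_derivative r\<^sup>2 / (s\<^sup>2 + r\<^sup>2)) (at s)" for s
      using r by (auto intro!: derivative_eq_intros simp: divide_simps power2_eq_square add.commute add_nonneg_eq_0_iff)
    have c: "continuous_on {0<..} (\<lambda>s. r\<^sup>2 / (s\<^sup>2 + r\<^sup>2))"
      using r by (intro continuous_intros) (auto simp: sum_power2_eq_zero_iff)
    have "isCont ?F 0" using r by (intro continuous_intros) auto
    then have l0: "(?F \<longlongrightarrow> 0) (at_right 0)"
      by (simp add: isCont_def filterlim_at_split)
    have "filterlim (\<lambda>s. inverse r * s) at_top at_top"
      using r by (intro filterlim_tendsto_pos_mult_at_top[OF tendsto_const _ filterlim_ident]) simp
    then have "filterlim (\<lambda>s. s / r) at_top at_top"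
      by (simp only: divide_inverse mult.commute)
    then have l1: "(?F \<longlongrightarrow> r * (pi / 2)) at_top"
      by (intro tendsto_intros filterlim_compose[OF tendsto_arctan_at_top])
    have i: "set_integrable lborel {0<..} (\<lambda>s. r\<^sup>2 / (s\<^sup>2 + r\<^sup>2))"
      by (rule integral_Ioi_FTC_nonneg[OF d c _ l0 l1]) simp
    show ?thesis using i integral_Ioi_FTC[OF d c i l0 l1] by simp
  qed
  have "set_integrable lborel {0<..} (\<lambda>s::real. r\<^sup>2 / (s\<^sup>2 + r\<^sup>2)) \<and>
    (LINT s:{0<..}|lborel. r\<^sup>2 / (s\<^sup>2 + r\<^sup>2)) = \<bar>r\<bar> * (pi / 2)"
  proof (cases "r = 0")
    case False
    then show ?thesis using *[of "\<bar>r\<bar>"] by simp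
  qed (simp add: set_integrable_def set_lebesgue_integral_def)
  then show "set_integrable lborel {0<..} (\<lambda>s::real. r\<^sup>2 / (s\<^sup>2 + r\<^sup>2))"
    "(LINT s:{0<..}|lborel. r\<^sup>2 / (s\<^sup>2 + r\<^sup>2)) = \<bar>r\<bar> * (pi / 2)" by blast+
qed

lemma set_integrable_real_sum:
  fixes f :: "'i \<Rightarrow> 'a \<Rightarrow> real"
  assumes "\<And>i. i \<in> I \<Longrightarrow> set_integrable M S (f i)"
  shows "set_integrable M S (\<lambda>x. \<Sum>i\<in>I. f i x)"
    and "(LINT x:S|M. (\<Sum>i\<in>I. f i x)) = (\<Sum>i\<in>I. LINT x:S|M. f i x)"
proof -
  have "integrable M (\<lambda>x. \<Sum>i\<in>I. indicator S x *\<^sub>R f i x)"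
    using assms by (intro Bochner_Integration.integrable_sum) (simp add: set_integrable_def)
  then show "set_integrable M S (\<lambda>x. \<Sum>i\<in>I. f i x)"
    by (simp add: set_integrable_def sum_distrib_left)
  have "(\<integral>x. (\<Sum>i\<in>I. indicator S x *\<^sub>R f i x) \<partial>M) = (\<Sum>i\<in>I. \<integral>x. indicator S x *\<^sub>R f i x \<partial>M)"
    using assms by (intro Bochner_Integration.integral_sum) (simp add: set_integrable_def)
  then show "(LINT x:S|M. (\<Sum>i\<in>I. f i x)) = (\<Sum>i\<in>I. LINT x:S|M. f i x)"
    by (simp add: set_lebesgue_integral_def sum_distrib_left)
qed

lemma set_integral_congr:
  fixes f g :: "'a \<Rightarrow> 'b::{banach, second_countable_topology}"
  assumes "\<And>x. x \<in> S \<Longrightarrow> f x = g x"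
  shows "set_integrable M S f \<longleftrightarrow> set_integrable M S g" "(LINT x:S|M. f x) = (LINT x:S|M. g x)"
proof -
  have "(\<lambda>x. indicator S x *\<^sub>R f x) = (\<lambda>x. indicator S x *\<^sub>R g x)"
  proof
    fix x
    show "indicator S x *\<^sub>R f x = indicator S x *\<^sub>R g x"
      using assms by (cases "x \<in> S") auto
  qed
  then show "set_integrable M S f \<longleftrightarrow> set_integrable M S g" "(LINT x:S|M. f x) = (LINT x:S|M. g x)"
    by (simp_all add: set_integrable_def set_lebesgue_integral_def)
qed

text \<open>For each eigenvalue r, 1 - s^2 / (s^2 + r^2) = r^2 / (s^2 + r^2) integrates to pi |r| /
  2. The constant |x|^2 makes the integral converge and cancels between g B + A and g B - A in
  \<open>rweight\<close>.\<close>

lemma resolvent_form_integral: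
  assumes X: "hermitian X"
  shows "set_integrable lborel {0<..} (\<lambda>s. (norm x)\<^sup>2 - s * resolvent_form s x X)"
    and "(LINT s:{0<..}|lborel. (norm x)\<^sup>2 - s * resolvent_form s x X) = pi / 2 * qform (fc abs X) x"
proof -
  have e: "(norm x)\<^sup>2 - s * resolvent_form s x X = (\<Sum>r\<in>spec X. (norm (eproj X r *v x))\<^sup>2 * (r\<^sup>2 / (s\<^sup>2 + r\<^sup>2)))"
    if "s \<in> {0<..}" for s
  proof -
    have s: "0 < s" using that by simp
    have "1 - s * (s / (s\<^sup>2 + r\<^sup>2)) = r\<^sup>2 / (s\<^sup>2 + r\<^sup>2)" for r :: real
    proof -
      have "s\<^sup>2 + r\<^sup>2 \<noteq> 0" using s by (simp add: sum_power2_eq_zero_iff)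
      then show ?thesis by (simp add: field_simps power2_eq_square)
    qed
    then have t: "p - s * (s / (s\<^sup>2 + r\<^sup>2) * p) = p * (r\<^sup>2 / (s\<^sup>2 + r\<^sup>2))" for r p :: real
      by (metis (no_types, opaque_lifting) mult.assoc mult.commute mult.right_neutral right_diff_distrib)
    show ?thesis
      unfolding resolvent_form_def resolvent_Re[OF X s] norm_eq_sum_eproj[OF X, of x]
      by (simp only: sum_distrib_left t flip: sum_subtractf)
  qed
  have i: "set_integrable lborel {0<..} (\<lambda>s. (norm (eproj X r *v x))\<^sup>2 * (r\<^sup>2 / (s\<^sup>2 + r\<^sup>2)))" for r
    by (rule set_integrable_mult_right) (rule integral_square_resolvent)
  show "set_integrable lborel {0<..} (\<lambda>s. (norm x)\<^sup>2 - s * resolvent_form s x X)"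
    by (rule iffD2[OF set_integral_congr(1)[OF e] set_integrable_real_sum(1)[OF i]])
  have "(LINT s:{0<..}|lborel. (norm x)\<^sup>2 - s * resolvent_form s x X) =
    (\<Sum>r\<in>spec X. LINT s:{0<..}|lborel. (norm (eproj X r *v x))\<^sup>2 * (r\<^sup>2 / (s\<^sup>2 + r\<^sup>2)))"
    by (rule trans[OF set_integral_congr(2)[OF e] set_integrable_real_sum(2)[OF i]])
  also have "\<dots> = pi / 2 * qform (fc abs X) x"
    unfolding qform_fc[OF X] sum_distrib_left set_integral_mult_right integral_square_resolvent(2)
    by (intro sum.cong) auto
  finally show "(LINT s:{0<..}|lborel. (norm x)\<^sup>2 - s * resolvent_form s x X) = pi / 2 * qform (fc abs X) x" .
qed

lemma rweight_integral_s:
  assumes A: "hermitian A" and B: "hermitian B" and g: "0 < g"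
  shows "set_integrable lborel {0<..} (\<lambda>s. rweight B x A g s)"
    and "(LINT s:{0<..}|lborel. rweight B x A g s) =
      pi / 2 * ((qform (fc abs (g *\<^sub>R B + A)) x - qform (fc abs (g *\<^sub>R B - A)) x) / g)"
proof -
  have h: "hermitian (g *\<^sub>R B + A)" "hermitian (g *\<^sub>R B - A)"
    using A B by (auto intro: hermitian_add hermitian_diff hermitian_scaleR)
  have e: "(\<lambda>s. rweight B x A g s) = (\<lambda>s. (1 / g) * (((norm x)\<^sup>2 - s * resolvent_form s x (g *\<^sub>R B + A)) -
      ((norm x)\<^sup>2 - s * resolvent_form s x (g *\<^sub>R B - A))))"
    by (simp add: rweight_def fun_eq_iff algebra_simps diff_divide_distrib)
  note i = resolvent_form_integral[OF h(1), of x] resolvent_form_integral[OF h(2), of x]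
  show "set_integrable lborel {0<..} (\<lambda>s. rweight B x A g s)"
    unfolding e by (intro set_integrable_mult_right set_integral_diff i)
  show "(LINT s:{0<..}|lborel. rweight B x A g s) =
      pi / 2 * ((qform (fc abs (g *\<^sub>R B + A)) x - qform (fc abs (g *\<^sub>R B - A)) x) / g)"
    unfolding e set_integral_mult_right set_integral_diff(2)[OF i(1,3)] i(2,4)
    by (simp add: algebra_simps diff_divide_distrib)
qed

text \<open>A primitive is the weighted sum of r ln (s^2 + r^2) / 2. At infinity it behaves like ln
  s times the sum of the w r, so the vanishing of that sum forces the limit 0; at 0 it tends to the
  sum of the w r ln r.\<close>

lemma log_derivative_integral_family:
  fixes I :: "'i set" and w r :: "'i \<Rightarrow> real"
  assumes I: "finite I" and r: "\<And>i. i \<in> I \<Longrightarrow> 0 \<le> r i" and w: "(\<Sum>i\<in>I. w i * r i) = 0"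
    and int: "set_integrable lborel {0<..} (\<lambda>s. \<Sum>i\<in>I. w i * (s * (r i / (s\<^sup>2 + (r i)\<^sup>2))))"
  shows "(LINT s:{0<..}|lborel. (\<Sum>i\<in>I. w i * (s * (r i / (s\<^sup>2 + (r i)\<^sup>2))))) = - (\<Sum>i\<in>I. w i * (r i * ln (r i)))"
proof -
  define F where "F s = (\<Sum>i\<in>I. w i * (r i * (ln (s\<^sup>2 + (r i)\<^sup>2) / 2)))" for s
  have pos: "0 < s\<^sup>2 + (r i)\<^sup>2" if "0 < s" for s i using that by (simp add: add_pos_nonneg)
  have d: "(F has_real_derivative (\<Sum>i\<in>I. w i * (s * (r i / (s\<^sup>2 + (r i)\<^sup>2))))) (at s)" if s: "0 < s" for s
    unfolding F_def
  proof (rule DERIV_sum)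
    fix i
    show "((\<lambda>s. w i * (r i * (ln (s\<^sup>2 + (r i)\<^sup>2) / 2))) has_real_derivative w i * (s * (r i / (s\<^sup>2 + (r i)\<^sup>2)))) (at s)"
    proof -
      have "((\<lambda>s. ln (s\<^sup>2 + (r i)\<^sup>2) / 2) has_real_derivative s / (s\<^sup>2 + (r i)\<^sup>2)) (at s)"
      proof -
        have "((\<lambda>s. s\<^sup>2 + (r i)\<^sup>2) has_real_derivative 2 * s) (at s)"
          by (auto intro!: derivative_eq_intros)
        from DERIV_cdivide[OF DERIV_chain2[OF DERIV_ln_divide[OF pos[OF s]] this], of 2]
        show ?thesis by (rule DERIV_cong) (simp del: distrib_right_numeral distrib_left_numeral)
      qed
      from DERIV_cmult[OF DERIV_cmult[OF this, of "r i"], of "w i"] show ?thesis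
        by (simp add: mult_ac)
    qed
  qed
  have c: "continuous_on {0<..} (\<lambda>s. \<Sum>i\<in>I. w i * (s * (r i / (s\<^sup>2 + (r i)\<^sup>2))))"
    using pos by (intro continuous_intros) (metis greaterThan_iff less_irrefl)
  have l0: "(F \<longlongrightarrow> (\<Sum>i\<in>I. w i * (r i * ln (r i)))) (at_right 0)"
    unfolding F_def
  proof (rule tendsto_sum)
    fix i assume i: "i \<in> I"
    show "((\<lambda>s. w i * (r i * (ln (s\<^sup>2 + (r i)\<^sup>2) / 2))) \<longlongrightarrow> w i * (r i * ln (r i))) (at_right 0)"
    \<comment> \<open>For r i = 0 the factor \<open>r i\<close> kills the term, in accordance with 0
      ln 0 = 0; otherwise the logarithm is continuous at s = 0.\<close>
    proof (cases "r i = 0")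
      case False
      with r[OF i] have ri: "0 < r i" by simp
      have "isCont (\<lambda>s. w i * (r i * (ln (s\<^sup>2 + (r i)\<^sup>2) / 2))) 0"
        using ri by (intro continuous_intros) auto
      then show ?thesis using ri by (simp add: isCont_def filterlim_at_split ln_realpow)
    qed simp
  qed
  have l1: "(F \<longlongrightarrow> 0) at_top"
  proof (rule Lim_transform_eventually)
    have "((\<lambda>s. \<Sum>i\<in>I. w i * (r i * (ln (1 + (r i)\<^sup>2 / s\<^sup>2) / 2))) \<longlongrightarrow> (\<Sum>i\<in>I. w i * (r i * (ln (1 + 0) / 2)))) at_top"
      by (intro tendsto_intros real_tendsto_divide_at_top[OF tendsto_const] filterlim_pow_at_top filterlim_ident) auto
    then show "((\<lambda>s. \<Sum>i\<in>I. w i * (r i * (ln (1 + (r i)\<^sup>2 / s\<^sup>2) / 2))) \<longlongrightarrow> 0) at_top" by simp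
    show "eventually (\<lambda>s. (\<Sum>i\<in>I. w i * (r i * (ln (1 + (r i)\<^sup>2 / s\<^sup>2) / 2))) = F s) at_top"
      using eventually_gt_at_top[of 0]
    proof eventually_elim
      case (elim s)
      have L: "ln (1 + (r i)\<^sup>2 / s\<^sup>2) = ln (s\<^sup>2 + (r i)\<^sup>2) - ln (s\<^sup>2)" for i
      proof -
        have "1 + (r i)\<^sup>2 / s\<^sup>2 = (s\<^sup>2 + (r i)\<^sup>2) / s\<^sup>2" using elim by (simp add: field_simps)
        then show ?thesis using pos[OF elim, of i] elim by (simp add: ln_div)
      qed
      have "w i * (r i * (ln (1 + (r i)\<^sup>2 / s\<^sup>2) / 2)) =
          w i * (r i * (ln (s\<^sup>2 + (r i)\<^sup>2) / 2)) - ln (s\<^sup>2) / 2 * (w i * r i)" for i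
        unfolding L by (simp add: algebra_simps diff_divide_distrib)
      then have "(\<Sum>i\<in>I. w i * (r i * (ln (1 + (r i)\<^sup>2 / s\<^sup>2) / 2))) = F s - ln (s\<^sup>2) / 2 * (\<Sum>i\<in>I. w i * r i)"
        by (simp only: F_def sum_subtractf sum_distrib_left)
      then show ?case using w by simp
    qed
  qed
  show ?thesis using integral_Ioi_FTC[OF d c int l0 l1] by simp
qed

text \<open>Fubini for \<open>?H\<close>: integration over s yields pi / 2 times \<open>e\<close>,
  integration over g yields \<open>Q\<close>, and the integral of \<open>Q\<close> is - pi times the
  weighted sum of the r ln r terms. The ratio of these constants is the factor - 2.\<close>

lemma absolute_value_family_identity:
  fixes B :: "complex ^ 'n ^ 'n" and K :: "'k set" and c :: "'k \<Rightarrow> real"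
    and As :: "'k \<Rightarrow> complex ^ 'n ^ 'n" and x :: "complex ^ 'n"
  assumes B: "hermitian B" and \<beta>: "0 < \<beta>" "\<And>v. \<beta> * (norm v)\<^sup>2 \<le> qform B v"
    and K: "finite K" and As: "\<And>k. k \<in> K \<Longrightarrow> psd (As k)" and sum0: "(\<Sum>k\<in>K. c k *\<^sub>R As k) = 0"
  defines "e \<equiv> \<lambda>g. \<Sum>k\<in>K. c k * ((qform (fc abs (g *\<^sub>R B + As k)) x - qform (fc abs (g *\<^sub>R B - As k)) x) / g)"
  shows "set_integrable lborel {0<..} e"
    and "(LINT g:{0<..}|lborel. e g) = - 2 * (\<Sum>k\<in>K. c k * qform (fc (\<lambda>r. r * ln r) (As k)) x)"
proof -
  have h: "hermitian (As k)" if "k \<in> K" for k using As[OF that] by (simp add: psd_qform)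
  let ?W = "\<lambda>g s. \<Sum>k\<in>K. c k * rweight B x (As k) g s"
  let ?H = "\<lambda>g s. indicator {0<..} g * indicator {0<..} s * ?W g s :: real"
  have H: "integrable (lborel \<Otimes>\<^sub>M lborel) (case_prod ?H)"
    using integrable_rweight_sum[OF B \<beta> K h sum0, of x] by (simp add: case_prod_unfold)
  define Q where "Q s = pi * (\<Sum>k\<in>K. c k * (s * (\<Sum>r\<in>spec (As k). r / (s\<^sup>2 + r\<^sup>2) * (norm (eproj (As k) r *v x))\<^sup>2)))" for s
  have in_s: "(\<integral>s. ?H g s \<partial>lborel) = indicator {0<..} g * (pi / 2 * e g)" for g
  proof (cases "0 < g")
    case True
    have i: "set_integrable lborel {0<..} (\<lambda>s. c k * rweight B x (As k) g s)" if "k \<in> K" for k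
      by (intro set_integrable_mult_right rweight_integral_s h B that True)
    have "(\<integral>s. ?H g s \<partial>lborel) = (LINT s:{0<..}|lborel. ?W g s)"
      using True by (simp add: set_lebesgue_integral_def)
    also have "\<dots> = (\<Sum>k\<in>K. c k * (LINT s:{0<..}|lborel. rweight B x (As k) g s))"
      using set_integrable_real_sum(2)[OF i, of K "\<lambda>k. k"] by simp
    also have "\<dots> = pi / 2 * e g"
      using rweight_integral_s(2)[OF h B True] by (simp add: e_def sum_distrib_left mult_ac)
    finally show ?thesis using True by simp
  qed simp
  have in_g: "(\<integral>g. ?H g s \<partial>lborel) = indicator {0<..} s * Q s" for s
  proof (cases "0 < s")
    case True
    have w: "rweight B x (As k) g s = s * ((resolvent_form s x (g *\<^sub>R B - As k) - resolvent_form s x (g *\<^sub>R B + As k)) / g)" for k g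
      by (simp add: rweight_def)
    have i: "set_integrable lborel {0<..} (\<lambda>g. c k * rweight B x (As k) g s)" if "k \<in> K" for k
      unfolding w by (intro set_integrable_mult_right resolvent_scaled_difference_integral[OF h B \<beta>] that True)
    have "(\<integral>g. ?H g s \<partial>lborel) = (LINT g:{0<..}|lborel. ?W g s)"
      using True by (simp add: set_lebesgue_integral_def)
    also have "\<dots> = (\<Sum>k\<in>K. c k * (LINT g:{0<..}|lborel. rweight B x (As k) g s))"
      using set_integrable_real_sum(2)[OF i, of K "\<lambda>k. k"] by simp
    also have "\<dots> = Q s"
      unfolding w set_integral_mult_right Q_def sum_distrib_left[of pi]
      using resolvent_scaled_difference_integral(2)[OF h B \<beta> True] by (intro sum.cong) (auto simp: mult_ac)
    finally show ?thesis using True by simp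
  qed simp
  have "integrable lborel (\<lambda>g. \<integral>s. ?H g s \<partial>lborel)"
    using lborel_pair.integrable_fst'[OF H] by simp
  then have "set_integrable lborel {0<..} (\<lambda>g. pi / 2 * e g)"
    unfolding in_s by (simp add: set_integrable_def)
  then have "set_integrable lborel {0<..} (\<lambda>g. 2 / pi * (pi / 2 * e g))"
    by (rule set_integrable_mult_right)
  then show "set_integrable lborel {0<..} e" by simp
  have "integrable lborel (\<lambda>s. \<integral>g. ?H g s \<partial>lborel)"
    using lborel_pair.integrable_snd[OF H] by simp
  then have iQ: "set_integrable lborel {0<..} Q"
    unfolding in_g by (simp add: set_integrable_def)
  \<comment> \<open>The eigenvalues of all \<open>As k\<close> are gathered in one finite index set,
    because the integral over s is controlled only for the full sum over k.\<close>
  define I where "I = Sigma K (\<lambda>k. spec (As k))"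
  define w where "w = (\<lambda>(k, r). c k * (norm (eproj (As k) r *v x))\<^sup>2)"
  have fI: "finite I" unfolding I_def using K finite_spec[OF h] by blast
  have sumI: "(\<Sum>i\<in>I. w i * f (snd i)) = (\<Sum>k\<in>K. c k * (\<Sum>r\<in>spec (As k). f r * (norm (eproj (As k) r *v x))\<^sup>2))" for f
  proof -
    have "(\<Sum>i\<in>I. w i * f (snd i)) = (\<Sum>k\<in>K. \<Sum>r\<in>spec (As k). w (k, r) * f r)"
      unfolding I_def using K finite_spec[OF h] by (subst sum.Sigma) (auto intro!: sum.cong)
    then show ?thesis by (simp add: w_def sum_distrib_left mult_ac)
  qed
  have Qe: "Q s = pi * (\<Sum>i\<in>I. w i * (s * (snd i / (s\<^sup>2 + (snd i)\<^sup>2))))" for s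
    unfolding sumI[of "\<lambda>r. s * (r / (s\<^sup>2 + r\<^sup>2))"] Q_def by (simp add: sum_distrib_left mult_ac)
  have rI: "0 \<le> snd i" if "i \<in> I" for i
    using that As spec_lower_bound[OF h, of _ 0] by (auto simp: I_def psd_qform)
  have w0: "(\<Sum>i\<in>I. w i * snd i) = 0"
  proof -
    have "(\<Sum>i\<in>I. w i * snd i) = (\<Sum>k\<in>K. c k * qform (As k) x)"
      unfolding sumI[of "\<lambda>r. r"] using qform_sum_eproj[OF h] by (intro sum.cong) auto
    also have "\<dots> = qform (\<Sum>k\<in>K. c k *\<^sub>R As k) x" by (simp add: qform_sum qform_scaleR)
    finally show ?thesis by (simp add: sum0)
  qed
  have iQ': "set_integrable lborel {0<..} (\<lambda>s. \<Sum>i\<in>I. w i * (s * (snd i / (s\<^sup>2 + (snd i)\<^sup>2))))"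
    using set_integrable_mult_right[OF iQ, of "1 / pi"] unfolding Qe by simp
  have "(LINT s:{0<..}|lborel. Q s) = - pi * (\<Sum>i\<in>I. w i * (snd i * ln (snd i)))"
    unfolding Qe set_integral_mult_right
    using log_derivative_integral_family[where r=snd, OF fI rI w0 iQ'] by simp
  also have "(\<Sum>i\<in>I. w i * (snd i * ln (snd i))) = (\<Sum>k\<in>K. c k * qform (fc (\<lambda>r. r * ln r) (As k)) x)"
    unfolding sumI[of "\<lambda>r. r * ln r"] using qform_fc[OF h] by (intro sum.cong) auto
  finally have 1: "(LINT s:{0<..}|lborel. Q s) = - pi * (\<Sum>k\<in>K. c k * qform (fc (\<lambda>r. r * ln r) (As k)) x)" .
  have "(\<integral>s. (\<integral>g. ?H g s \<partial>lborel) \<partial>lborel) = (\<integral>g. (\<integral>s. ?H g s \<partial>lborel) \<partial>lborel)"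
    by (rule lborel_pair.Fubini_integral[OF H])
  then have "(LINT s:{0<..}|lborel. Q s) = (LINT g:{0<..}|lborel. pi / 2 * e g)"
    unfolding in_s in_g set_lebesgue_integral_def by (simp only: real_scaleR_def)
  then have "pi * ((LINT g:{0<..}|lborel. e g) + 2 * (\<Sum>k\<in>K. c k * qform (fc (\<lambda>r. r * ln r) (As k)) x)) = 0"
    unfolding 1 set_integral_mult_right by (simp add: algebra_simps)
  then show "(LINT g:{0<..}|lborel. e g) = - 2 * (\<Sum>k\<in>K. c k * qform (fc (\<lambda>r. r * ln r) (As k)) x)"
    by simp
qed

section \<open>The integral of the positive parts\<close>

text \<open>The substitution u = 1 / g is carried out as v = - 1 / g, which is increasing in g,
  followed by the reflection u = - v.\<close>

lemma integral_substitution_inverse: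
  fixes f :: "real \<Rightarrow> real"
  assumes c: "continuous_on {0<..<1} f" and nn: "\<And>u. 0 < u \<Longrightarrow> u < 1 \<Longrightarrow> 0 \<le> f u"
    and i: "set_integrable lborel {1<..} (\<lambda>g. f (1 / g) * (1 / g\<^sup>2))"
  shows "set_integrable lborel {0<..<1} f"
    and "(LINT u:{0<..<1}|lborel. f u) = (LINT g:{1<..}|lborel. f (1 / g) * (1 / g\<^sup>2))"
proof -
  let ?h = "\<lambda>v. f (- v)"
  have e1: "einterval 1 \<infinity> = {1<..}" by (auto simp: einterval_def one_ereal_def)
  have e2: "einterval (- 1) 0 = {-1<..<0}"
    by (auto simp: einterval_def one_ereal_def zero_ereal_def)
  have l1: "((\<lambda>g::real. - (1 / g)) \<longlongrightarrow> - 1) (at_right 1)"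
  proof -
    have "isCont (\<lambda>g::real. - (1 / g)) 1" by (intro continuous_intros) auto
    then show ?thesis by (simp add: isCont_def filterlim_at_split)
  qed
  have l2: "((\<lambda>g::real. - (1 / g)) \<longlongrightarrow> - 0) at_top"
    by (intro tendsto_intros real_tendsto_divide_at_top[OF tendsto_const filterlim_ident])
  let ?g = "\<lambda>g::real. - (1 / g)" and ?g' = "\<lambda>g::real. 1 / g\<^sup>2"
  have p1: "(1::ereal) < \<infinity>" by simp
  have p2: "(?g has_real_derivative ?g' y) (at y)" if "1 < ereal y" "ereal y < \<infinity>" for y
    using that by (auto intro!: derivative_eq_intros simp: power2_eq_square)
  have p3: "isCont ?h (?g y)" if y: "1 < ereal y" "ereal y < \<infinity>" for y
  proof -
    have y1: "1 < y" using y by simp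
    then have "isCont f (- (?g y))"
      using c by (simp add: continuous_on_eq_continuous_at)
    then show ?thesis by (rule isCont_o2[rotated]) (intro continuous_intros)
  qed
  have p4: "isCont ?g' y" if "1 < ereal y" "ereal y < \<infinity>" for y
    using that by (intro continuous_intros) auto
  have p5: "0 \<le> ?h (?g y)" if "1 < ereal y" "ereal y < \<infinity>" for y
    using that by (auto intro!: nn)
  have p6: "0 \<le> ?g' y" if "1 \<le> ereal y" "ereal y \<le> \<infinity>" for y by simp
  have p7: "((ereal \<circ> ?g \<circ> real_of_ereal) \<longlongrightarrow> - 1) (at_right 1)"
    using l1 ereal_tendsto_simps1(2)[of "ereal \<circ> ?g" "- 1" 1]
    by (simp add: one_ereal_def comp_def)
  have p8: "((ereal \<circ> ?g \<circ> real_of_ereal) \<longlongrightarrow> 0) (at_left \<infinity>)"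
    using l2 ereal_tendsto_simps1(3)[of "ereal \<circ> ?g" 0]
    by (simp add: zero_ereal_def comp_def)
  have p9: "set_integrable lborel (einterval 1 \<infinity>) (\<lambda>g. ?h (?g g) * ?g' g)"
    using i by (simp add: e1)
  note * = interval_integral_substitution_nonneg[where f="?h" and g="?g" and g'="?g'", OF p1 p2 p3 p4 p5 p6 p7 p8 p9]
  have "integrable lborel (\<lambda>v. indicator {-1<..<0} v *\<^sub>R f (- v))"
    using *(1) by (simp add: e2 set_integrable_def)
  moreover have "(\<lambda>v. indicator {-1<..<0} v *\<^sub>R f (- v)) = (\<lambda>v. (\<lambda>u. indicator {0<..<1} u *\<^sub>R f u) (0 + (- 1) * v))"
    by (auto simp: indicator_def)
  ultimately have "integrable lborel (\<lambda>u. indicator {0<..<1} u *\<^sub>R f u)"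
    using lborel_integrable_real_affine_iff[of "- 1" "\<lambda>u. indicator {0<..<1} u *\<^sub>R f u" 0] by simp
  then show "set_integrable lborel {0<..<1} f" by (simp add: set_integrable_def)
  have "(LINT u:{0<..<1}|lborel. f u) = (LBINT u=0..1. f u)"
    by (simp add: zero_ereal_def one_ereal_def interval_integral_Ioo)
  also have "\<dots> = (LBINT v=-1..0. ?h v)" by (subst interval_integral_reflect) simp
  also have "\<dots> = (LINT g:{1<..}|lborel. f (1 / g) * (1 / g\<^sup>2))"
    using *(2) by (simp add: one_ereal_def interval_integral_to_infinity_eq)
  finally show "(LINT u:{0<..<1}|lborel. f u) = (LINT g:{1<..}|lborel. f (1 / g) * (1 / g\<^sup>2))" .
qed

section \<open>Integrability and positivity of the divergence integrand\<close>

lemma continuous_on_pos_part: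
  fixes X :: "real \<Rightarrow> complex ^ 'n ^ 'n"
  assumes "\<And>g. hermitian (X g)" "continuous_on S X"
  shows "continuous_on S (\<lambda>g. pos_part (X g))"
  unfolding continuous_on_iff
proof (intro ballI allI impI)
  fix a and e :: real assume a: "a \<in> S" "0 < e"
  then obtain d where d: "0 < d" "\<And>b. b \<in> S \<Longrightarrow> dist b a < d \<Longrightarrow> dist (X b) (X a) < e"
    using assms(2) unfolding continuous_on_iff by blast
  show "\<exists>d>0. \<forall>b\<in>S. dist b a < d \<longrightarrow> dist (pos_part (X b)) (pos_part (X a)) < e"
    using d pos_part_lipschitz[OF assms(1) assms(1)] unfolding dist_norm by (meson le_less_trans)
qed

lemma continuous_on_div_integrand:
  assumes "hermitian A" "hermitian B"
  shows "continuous_on {0<..} (div_integrand A B)"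
proof -
  have "continuous_on {0<..} (\<lambda>g. pos_part (A - g *\<^sub>R B))" "continuous_on {0<..} (\<lambda>g. pos_part (B - g *\<^sub>R A))"
    using assms by (auto intro!: continuous_on_pos_part hermitian_diff hermitian_scaleR continuous_intros)
  then show ?thesis
    unfolding div_integrand_def by (intro continuous_intros) auto
qed

lemma set_integrable_inverse_square: "set_integrable lborel {1..} (\<lambda>g::real. C * (1 / g\<^sup>2))"
proof (rule set_integrable_norm_bound)
  have "set_integrable lborel {1..} (\<lambda>g::real. 1 / (1 + g\<^sup>2))"
    by (rule set_integrable_subset[OF set_integrable_inverse_1_plus_square]) auto
  then show "set_integrable lborel {1..} (\<lambda>g::real. \<bar>C\<bar> * 2 * (1 / (1 + g\<^sup>2)))"
    by (rule set_integrable_mult_right)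
  show "continuous_on {1..} (\<lambda>g::real. C * (1 / g\<^sup>2))"
    by (intro continuous_intros) auto
  fix g :: real assume "g \<in> {1..}"
  then have g: "1 \<le> g" by simp
  then have "1 \<le> g\<^sup>2" by simp
  then have "2 / (2 * g\<^sup>2) \<le> 2 / (1 + g\<^sup>2)" by (intro divide_left_mono mult_pos_pos) linarith+
  then have "1 / g\<^sup>2 \<le> 2 * (1 / (1 + g\<^sup>2))" by simp
  then have "\<bar>C\<bar> * (1 / g\<^sup>2) \<le> \<bar>C\<bar> * (2 * (1 / (1 + g\<^sup>2)))" by (rule mult_left_mono) simp
  then show "norm (C * (1 / g\<^sup>2)) \<le> \<bar>C\<bar> * 2 * (1 / (1 + g\<^sup>2))" by (simp add: abs_mult)
qed simp

text \<open>A Hermitian Y with nonpositive form has positive part 0, so nonexpansiveness of the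
  positive part compares X with Y directly. A good choice of Y gives each later size
  estimate.\<close>

lemma norm_pos_part_le:
  assumes "hermitian X" "hermitian Y" "\<And>v. qform Y v \<le> 0"
  shows "norm (pos_part X) \<le> norm (X - Y)"
  using pos_part_lipschitz[OF assms(1,2)] pos_part_eq_0[OF assms(2,3)] by simp

lemma qform_psd_nonneg: "psd M \<Longrightarrow> 0 \<le> qform M x"
  by (simp add: psd_qform)

lemma qform_domination:
  assumes \<beta>: "0 < \<beta>" "\<And>v. \<beta> * (norm v)\<^sup>2 \<le> qform B v"
  obtains \<tau> where "0 < \<tau>" "\<And>v. qform A v \<le> \<tau> * qform B v"
proof -
  define \<tau> where "\<tau> = (op_norm A + 1) / \<beta>"
  have \<tau>: "0 < \<tau>" using \<beta> op_norm_nonneg[of A] by (simp add: \<tau>_def add_nonneg_pos)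
  have "qform A v \<le> \<tau> * qform B v" for v
  proof -
    have "qform A v \<le> op_norm A * (norm v)\<^sup>2" using abs_qform_le[of A v] by linarith
    also have "\<dots> \<le> (op_norm A + 1) * (norm v)\<^sup>2" by (intro mult_right_mono) auto
    also have "\<dots> = \<tau> * (\<beta> * (norm v)\<^sup>2)" using \<beta> by (simp add: \<tau>_def)
    also have "\<dots> \<le> \<tau> * qform B v" using \<tau> \<beta>(2)[of v] by (intro mult_left_mono) auto
    finally show ?thesis .
  qed
  with \<tau> show ?thesis using that by blast
qed

text \<open>Comparison with - g B bounds (A - g B)_+ by the norm of A, and it vanishes for g >
  \<tau>, so it is O(1/g). Comparison with - g A bounds (B - g A)_+ by the norm of B. With the
  weights 1/g and 1/g^2 both terms become O(1/g^2).\<close>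

lemma set_integrable_div_integrand:
  assumes A: "psd A" and B: "psd B" and \<tau>: "0 < \<tau>" "\<And>v. qform A v \<le> \<tau> * qform B v"
  shows "set_integrable lborel {1..} (div_integrand A B)"
proof (rule set_integrable_norm_bound)
  have h: "hermitian A" "hermitian B" using A B by (auto simp: psd_qform)
  define C where "C = norm A * (max 1 \<tau>) + norm B"
  show "set_integrable lborel {1..} (\<lambda>g. C * (1 / g\<^sup>2))" by (rule set_integrable_inverse_square)
  show "continuous_on {1..} (div_integrand A B)"
    by (rule continuous_on_subset[OF continuous_on_div_integrand[OF h]]) auto
  fix g :: real assume "g \<in> {1..}"
  then have g: "1 \<le> g" by simp
  have 1: "norm (pos_part (A - g *\<^sub>R B)) \<le> norm A * (max 1 \<tau>) / g"
  proof (cases "g \<le> \<tau>")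
    case True
    have "norm (pos_part (A - g *\<^sub>R B)) \<le> norm (A - g *\<^sub>R B - - (g *\<^sub>R B))"
      using h g qform_psd_nonneg[OF B]
      by (intro norm_pos_part_le hermitian_diff hermitian_minus hermitian_scaleR) (auto simp: qform_minus qform_scaleR)
    also have "\<dots> = norm A * 1" by simp
    also have "\<dots> \<le> norm A * (max 1 \<tau> / g)"
      using True g by (intro mult_left_mono) auto
    finally show ?thesis by simp
  next
    case False
    have "qform (A - g *\<^sub>R B) v \<le> 0" for v
      using \<tau>(2)[of v] mult_right_mono[of \<tau> g "qform B v"] False qform_psd_nonneg[OF B, of v]
      by (simp add: qform_diff qform_scaleR)
    then have "pos_part (A - g *\<^sub>R B) = 0"
      using h by (intro pos_part_eq_0 hermitian_diff hermitian_scaleR)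
    then show ?thesis using g by simp
  qed
  have 2: "norm (pos_part (B - g *\<^sub>R A)) \<le> norm B"
  proof -
    have "norm (pos_part (B - g *\<^sub>R A)) \<le> norm (B - g *\<^sub>R A - - (g *\<^sub>R A))"
      using h g qform_psd_nonneg[OF A]
      by (intro norm_pos_part_le hermitian_diff hermitian_minus hermitian_scaleR) (auto simp: qform_minus qform_scaleR)
    then show ?thesis by simp
  qed
  have "norm (div_integrand A B g) \<le> (1 / g) * norm (pos_part (A - g *\<^sub>R B)) + (1 / g\<^sup>2) * norm (pos_part (B - g *\<^sub>R A))"
    unfolding div_integrand_def using g by (intro norm_triangle_le) simp
  also have "\<dots> \<le> (1 / g) * (norm A * (max 1 \<tau>) / g) + (1 / g\<^sup>2) * norm B"
    using 1 2 g by (intro add_mono mult_left_mono) auto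
  also have "\<dots> = C * (1 / g\<^sup>2)" using g by (simp add: C_def power2_eq_square field_simps)
  finally show "norm (div_integrand A B g) \<le> C * (1 / g\<^sup>2)" .
qed simp

lemma bounded_linear_qform: "bounded_linear (\<lambda>M. qform M x)"
  by (intro linear_conv_bounded_linear[THEN iffD1] linearI) (simp_all add: qform_add qform_scaleR)

lemma qform_set_integral:
  assumes "set_integrable M S F"
  shows "set_integrable M S (\<lambda>g. qform (F g) x)" "qform (LINT g:S|M. F g) x = (LINT g:S|M. qform (F g) x)"
proof -
  have i: "integrable M (\<lambda>g. indicator S g *\<^sub>R F g)" using assms by (simp add: set_integrable_def)
  show "set_integrable M S (\<lambda>g. qform (F g) x)"
    using integrable_bounded_linear[OF bounded_linear_qform i, of x] by (simp add: set_integrable_def qform_scaleR)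
  show "qform (LINT g:S|M. F g) x = (LINT g:S|M. qform (F g) x)"
    using integral_bounded_linear[OF bounded_linear_qform i, of x] by (simp add: set_lebesgue_integral_def qform_scaleR)
qed

lemma hermitian_set_integral:
  fixes F :: "'a \<Rightarrow> complex ^ 'n ^ 'n"
  assumes i: "set_integrable M S F" and h: "\<And>g. g \<in> S \<Longrightarrow> hermitian (F g)"
  shows "hermitian (LINT g:S|M. F g)"
proof (rule hermitianI)
  fix i j
  have e: "(LINT g:S|M. F g) $ i $ j = (\<integral>g. (indicator S g *\<^sub>R F g) $ i $ j \<partial>M)" for i j
  proof -
    have "bounded_linear (\<lambda>X :: complex ^ 'n ^ 'n. X $ i $ j)"
      by (intro bounded_linear_compose[OF bounded_linear_vec_nth bounded_linear_vec_nth])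
    from integral_bounded_linear[OF this, of M "\<lambda>g. indicator S g *\<^sub>R F g"] show ?thesis
      using i by (simp add: set_integrable_def set_lebesgue_integral_def)
  qed
  have "cnj ((indicator S g *\<^sub>R F g) $ j $ i) = (indicator S g *\<^sub>R F g) $ i $ j" for g
    using hermitian_nth[OF h, of g j i] by (cases "g \<in> S") auto
  then have 1: "(\<integral>g. cnj ((indicator S g *\<^sub>R F g) $ j $ i) \<partial>M) = (\<integral>g. (indicator S g *\<^sub>R F g) $ i $ j \<partial>M)"
    by (simp only:)
  show "cnj ((LINT g:S|M. F g) $ j $ i) = (LINT g:S|M. F g) $ i $ j"
    unfolding e by (rule trans[OF Bochner_Integration.integral_cnj[symmetric] 1])
qed

lemma psd_set_integral:
  assumes i: "set_integrable M S F" and p: "\<And>g. g \<in> S \<Longrightarrow> psd (F g)"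
  shows "psd (LINT g:S|M. F g)"
  unfolding psd_qform
proof (intro conjI allI hermitian_set_integral[OF i])
  show "hermitian (F g)" if "g \<in> S" for g using p[OF that] by (simp add: psd_qform)
  show "0 \<le> qform (LINT g:S|M. F g) x" for x
  proof -
    have "0 \<le> (LINT g:S|M. qform (F g) x)"
      unfolding set_lebesgue_integral_def
      by (intro Bochner_Integration.integral_nonneg) (use p in \<open>auto simp: indicator_def psd_qform\<close>)
    then show ?thesis by (simp only: qform_set_integral(2)[OF i])
  qed
qed

lemma psd_scaleR: "psd M \<Longrightarrow> 0 \<le> r \<Longrightarrow> psd (r *\<^sub>R M)"
  by (simp add: psd_qform hermitian_scaleR qform_scaleR)

lemma psd_add: "psd M \<Longrightarrow> psd N \<Longrightarrow> psd (M + N)"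
  by (simp add: psd_qform hermitian_add qform_add)

lemma psd_div_integrand:
  assumes "hermitian A" "hermitian B" "1 \<le> g"
  shows "psd (div_integrand A B g)"
  unfolding div_integrand_def using assms
  by (intro psd_add psd_scaleR psd_pos_part hermitian_diff hermitian_scaleR) auto

lemma fc_abs_qform:
  assumes T: "hermitian T"
  shows "qform (fc abs T) x = qform (pos_part T) x + qform (pos_part (- T)) x"
  unfolding pos_part_fc[OF T] pos_part_fc[OF hermitian_minus[OF T]] fc_minus[OF T] qform_fc[OF T]
    sum.distrib[symmetric] distrib_right[symmetric]
  by (intro sum.cong refl arg_cong2[where f="(*)"]) (simp add: max_def)

definition div_int :: "complex ^ 'n ^ 'n \<Rightarrow> complex ^ 'n ^ 'n \<Rightarrow> complex ^ 'n ^ 'n" where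
  "div_int A B = (LINT \<gamma>:{1..}|lborel. div_integrand A B \<gamma>)"

text \<open>Positive parts commute with positive scaling, so u = 1 / g turns g^-2 (B - g A)_+ on [1,
  oo) into (u B - A)_+ / u on (0, 1). Both halves of the integral then lie on one half-line cut at
  1, like the integral of the absolute values.\<close>

lemma div_integrand_qform_parts:
  fixes A B :: "complex ^ 'n ^ 'n" and x :: "complex ^ 'n"
  assumes A: "psd A" and B: "psd B" and \<tau>: "0 < \<tau>" "\<And>v. qform A v \<le> \<tau> * qform B v"
  defines "p \<equiv> \<lambda>g. qform (pos_part (A - g *\<^sub>R B)) x / g" and "n \<equiv> \<lambda>u. qform (pos_part (u *\<^sub>R B - A)) x / u"
  shows "set_integrable lborel {1..} p" "set_integrable lborel {0<..<1} n"
    and "qform (div_int A B) x = (LINT g:{1..}|lborel. p g) + (LINT u:{0<..<1}|lborel. n u)"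
proof -
  have h: "hermitian A" "hermitian B" using A B by (auto simp: psd_qform)
  note si = set_integrable_div_integrand[OF A B \<tau>]
  define m where "m g = qform (pos_part (B - g *\<^sub>R A)) x / g\<^sup>2" for g
  have q: "qform (div_integrand A B g) x = p g + m g" for g
    by (simp add: div_integrand_def p_def m_def qform_add qform_scaleR)
  have hh: "hermitian (A - g *\<^sub>R B)" "hermitian (B - g *\<^sub>R A)" "hermitian (g *\<^sub>R B - A)" for g
    using h by (auto intro: hermitian_diff hermitian_scaleR)
  have nn: "0 \<le> qform (pos_part (A - g *\<^sub>R B)) x" "0 \<le> qform (pos_part (B - g *\<^sub>R A)) x" "0 \<le> qform (pos_part (g *\<^sub>R B - A)) x" for g
    using psd_pos_part[OF hh(1)] psd_pos_part[OF hh(2)] psd_pos_part[OF hh(3)] by (auto simp: psd_qform)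
  have cq: "continuous_on S (\<lambda>g. qform (X g) x)" if "continuous_on S X" for S and X :: "real \<Rightarrow> complex ^ 'n ^ 'n"
    by (rule bounded_linear.continuous_on[OF bounded_linear_qform that])
  have cp: "continuous_on S (\<lambda>g. qform (pos_part (A - g *\<^sub>R B)) x)" "continuous_on S (\<lambda>g. qform (pos_part (B - g *\<^sub>R A)) x)"
    "continuous_on S (\<lambda>g. qform (pos_part (g *\<^sub>R B - A)) x)" for S
    using hh by (auto intro!: cq continuous_on_pos_part continuous_intros)
  have iq: "set_integrable lborel {1..} (\<lambda>g. qform (div_integrand A B g) x)"
    by (rule qform_set_integral(1)[OF si])
  show ip: "set_integrable lborel {1..} p"
  proof (rule set_integrable_norm_bound[OF iq])
    show "continuous_on {1..} p" unfolding p_def by (intro continuous_intros cp) auto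
    show "norm (p g) \<le> qform (div_integrand A B g) x" if "g \<in> {1..}" for g
      using that nn by (simp add: q p_def m_def)
  qed simp
  have im: "set_integrable lborel {1..} m"
  proof (rule set_integrable_norm_bound[OF iq])
    show "continuous_on {1..} m" unfolding m_def by (intro continuous_intros cp) auto
    show "norm (m g) \<le> qform (div_integrand A B g) x" if "g \<in> {1..}" for g
      using that nn by (simp add: q p_def m_def)
  qed simp
  have mn: "n (1 / g) * (1 / g\<^sup>2) = m g" if g: "0 < g" for g
  proof -
    have "pos_part ((1 / g) *\<^sub>R B - A) = (1 / g) *\<^sub>R pos_part (B - g *\<^sub>R A)"
      using pos_part_scaleR[OF hh(2), of "1 / g" g] g by (simp add: scaleR_diff_right)
    then show ?thesis using g by (simp add: n_def m_def qform_scaleR)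
  qed
  have im': "set_integrable lborel {1<..} m" by (rule set_integrable_subset[OF im]) auto
  have inm: "set_integrable lborel {1<..} (\<lambda>g. n (1 / g) * (1 / g\<^sup>2))"
    by (rule iffD2[OF set_integral_congr(1) im']) (use mn in simp)
  have cn: "continuous_on {0<..<1} n" unfolding n_def by (intro continuous_intros cp) auto
  have nnn: "0 \<le> n u" if "0 < u" "u < 1" for u using that nn by (simp add: n_def)
  show "set_integrable lborel {0<..<1} n"
    by (rule integral_substitution_inverse(1)[OF cn nnn inm])
  have "(LINT u:{0<..<1}|lborel. n u) = (LINT g:{1<..}|lborel. n (1 / g) * (1 / g\<^sup>2))"
    by (rule integral_substitution_inverse(2)[OF cn nnn inm])
  also have "\<dots> = (LINT g:{1<..}|lborel. m g)"
    by (rule set_integral_congr(2)) (use mn in simp)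
  also have "\<dots> = (LINT g:{1..}|lborel. m g)"
    unfolding set_lebesgue_integral_def
    by (rule integral_cong_AE) (use im im' AE_lborel_singleton[of 1] in \<open>auto simp: set_integrable_def indicator_def\<close>)
  finally have N: "(LINT u:{0<..<1}|lborel. n u) = (LINT g:{1..}|lborel. m g)" .
  have "qform (div_int A B) x = (LINT g:{1..}|lborel. p g + m g)"
    unfolding div_int_def qform_set_integral(2)[OF si] q ..
  also have "\<dots> = (LINT g:{1..}|lborel. p g) + (LINT g:{1..}|lborel. m g)"
    by (rule set_integral_add(2)[OF ip im])
  finally show "qform (div_int A B) x = (LINT g:{1..}|lborel. p g) + (LINT u:{0<..<1}|lborel. n u)"
    using N by simp
qed

text \<open>Linearity of \<open>A \<mapsto> f(A) + B - I(A, B)\<close>.\<close>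

lemma div_int_family_identity:
  fixes B :: "complex ^ 'n ^ 'n" and K :: "'k set" and c :: "'k \<Rightarrow> real"
    and As :: "'k \<Rightarrow> complex ^ 'n ^ 'n"
  assumes B: "psd B" and \<beta>: "0 < \<beta>" "\<And>v. \<beta> * (norm v)\<^sup>2 \<le> qform B v"
    and K: "finite K" and As: "\<And>k. k \<in> K \<Longrightarrow> psd (As k)" and sum0: "(\<Sum>k\<in>K. c k *\<^sub>R As k) = 0"
  shows "(\<Sum>k\<in>K. c k *\<^sub>R (fc (\<lambda>r. r * ln r) (As k) + B - div_int (As k) B)) = 0"
proof (rule hermitian_eqI)
  have hB: "hermitian B" using B by (simp add: psd_qform)
  have h: "hermitian (As k)" if "k \<in> K" for k using As[OF that] by (simp add: psd_qform)
  have "\<exists>\<tau>. \<forall>k. 0 < \<tau> k \<and> (\<forall>v. qform (As k) v \<le> \<tau> k * qform B v)"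
  proof (rule choice, rule allI)
    show "\<exists>\<tau>. 0 < \<tau> \<and> (\<forall>v. qform (As k) v \<le> \<tau> * qform B v)" for k
      using qform_domination[OF \<beta>, of "As k"] by blast
  qed
  then obtain \<tau> where \<tau>: "0 < \<tau> k" "qform (As k) v \<le> \<tau> k * qform B v" for k v
    by blast
  show "hermitian (\<Sum>k\<in>K. c k *\<^sub>R (fc (\<lambda>r. r * ln r) (As k) + B - div_int (As k) B))"
  proof (intro hermitian_sum hermitian_scaleR hermitian_diff hermitian_add hermitian_fc h hB)
    fix k assume k: "k \<in> K"
    show "hermitian (div_int (As k) B)"
      unfolding div_int_def
    proof (rule hermitian_set_integral[OF set_integrable_div_integrand[OF As[OF k] B \<tau>]])
      show "hermitian (div_integrand (As k) B g)" if "g \<in> {1..}" for g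
        using psd_div_integrand[OF h[OF k] hB, of g] that by (simp add: psd_qform)
    qed
  qed
  show "hermitian (0 :: complex ^ 'n ^ 'n)" by simp
  fix x :: "complex ^ 'n"
  define p where "p k g = qform (pos_part (As k - g *\<^sub>R B)) x / g" for k g
  define n where "n k u = qform (pos_part (u *\<^sub>R B - As k)) x / u" for k u
  define b where "b = qform B x"
  define e where "e g = (\<Sum>k\<in>K. c k * ((qform (fc abs (g *\<^sub>R B + As k)) x - qform (fc abs (g *\<^sub>R B - As k)) x) / g))" for g
  define f where "f k = qform (fc (\<lambda>r. r * ln r) (As k)) x" for k
  have e: "set_integrable lborel {0<..} e" "(LINT g:{0<..}|lborel. e g) = - 2 * (\<Sum>k\<in>K. c k * f k)"
    using absolute_value_family_identity[OF hB \<beta> K As sum0, of x] by (simp_all add: e_def[abs_def] f_def)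
  note parts = div_integrand_qform_parts[OF As B \<tau>, where x=x, folded p_def n_def]
  have ca: "(\<Sum>k\<in>K. c k * qform (As k) x) = 0"
    using arg_cong[OF sum0, of "\<lambda>M. qform M x"] by (simp add: qform_sum qform_scaleR)
  \<comment> \<open>Two expressions for the same \<open>e g\<close>. Since g B + As k is positive
    semidefinite it equals its absolute value. For T = g B - As k, the relations |T| = T_+ + T_- and
    T = T_+ - T_- eliminate one of the two parts. Keeping T_- suits g \<ge> 1, where the leftover As
    k / g drops out of the weighted sum; keeping T_+ suits g < 1.\<close>
  have ee: "e g = - 2 * (\<Sum>k\<in>K. c k * p k g) \<and> e g = 2 * (\<Sum>k\<in>K. c k * (b - n k g))" if g: "0 < g" for g
  proof -
    have t: "(qform (fc abs (g *\<^sub>R B + As k)) x - qform (fc abs (g *\<^sub>R B - As k)) x) / g = 2 * qform (As k) x / g - 2 * p k g \<and>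
      (qform (fc abs (g *\<^sub>R B + As k)) x - qform (fc abs (g *\<^sub>R B - As k)) x) / g = 2 * (b - n k g)" if k: "k \<in> K" for k
    proof -
      have "psd (g *\<^sub>R B + As k)" using g by (intro psd_add psd_scaleR As k B) auto
      then have "fc abs (g *\<^sub>R B + As k) = g *\<^sub>R B + As k"
        using fc_cong[of "g *\<^sub>R B + As k" abs "\<lambda>r. r"] fc_ident[of "g *\<^sub>R B + As k"] spec_lower_bound[of "g *\<^sub>R B + As k" 0]
        by (simp add: psd_qform)
      then have 1: "qform (fc abs (g *\<^sub>R B + As k)) x = g * b + qform (As k) x"
        by (simp add: qform_add qform_scaleR b_def)
      have hm: "hermitian (g *\<^sub>R B - As k)" by (intro hermitian_diff hermitian_scaleR h k hB)
      have 2: "qform (fc abs (g *\<^sub>R B - As k)) x = g * n k g + g * p k g"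
        using fc_abs_qform[OF hm, of x] g by (simp add: n_def p_def)
      have 3: "g * n k g - g * p k g = g * b - qform (As k) x"
        using arg_cong[OF pos_part_minus[OF hm], of "\<lambda>M. qform M x"] g
        by (simp add: n_def p_def qform_diff qform_scaleR b_def)
      have "qform (fc abs (g *\<^sub>R B + As k)) x - qform (fc abs (g *\<^sub>R B - As k)) x = 2 * qform (As k) x - g * (2 * p k g)"
        using 1 2 3 by linarith
      moreover have "qform (fc abs (g *\<^sub>R B + As k)) x - qform (fc abs (g *\<^sub>R B - As k)) x = g * (2 * (b - n k g))"
        using 1 2 3 by (simp add: algebra_simps)
      ultimately show ?thesis using g by (metis diff_divide_distrib nonzero_mult_div_cancel_left less_irrefl)
    qed
    have "e g = (\<Sum>k\<in>K. c k * (2 * qform (As k) x / g - 2 * p k g))"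
      unfolding e_def by (rule sum.cong, simp, simp only: conjunct1[OF t])
    also have "\<dots> = 2 / g * (\<Sum>k\<in>K. c k * qform (As k) x) - 2 * (\<Sum>k\<in>K. c k * p k g)"
      by (simp add: sum_distrib_left sum_subtractf algebra_simps)
    finally have "e g = - 2 * (\<Sum>k\<in>K. c k * p k g)" by (simp add: ca)
    moreover have "e g = (\<Sum>k\<in>K. c k * (2 * (b - n k g)))"
      unfolding e_def by (rule sum.cong, simp, simp only: conjunct2[OF t])
    ultimately show ?thesis by (simp add: sum_distrib_left mult_ac)
  qed
  have u: "{0<..} = {0<..<1} \<union> {1::real..}" by auto
  have "(LINT g:{0<..}|lborel. e g) = (LINT g:{0<..<1}|lborel. e g) + (LINT g:{1..}|lborel. e g)"
    unfolding u by (rule set_integral_Un) (auto intro: set_integrable_subset[OF e(1)])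
  also have "(LINT g:{0<..<1}|lborel. e g) = (LINT g:{0<..<1}|lborel. 2 * (\<Sum>k\<in>K. c k * (b - n k g)))"
    by (rule set_integral_congr(2), rule conjunct2[OF ee], simp)
  also have "\<dots> = 2 * (\<Sum>k\<in>K. c k * (b - (LINT g:{0<..<1}|lborel. n k g)))"
  proof -
    have ib: "set_integrable lborel {0<..<1::real} (\<lambda>g. b)"
      by (auto simp: set_integrable_def intro!: integrable_real_indicator)
    have i: "set_integrable lborel {0<..<1} (\<lambda>g. c k * (b - n k g))" if "k \<in> K" for k
      by (intro set_integrable_mult_right set_integral_diff(1) ib parts(2) that)
    have "(LINT g:{0<..<1}|lborel. b - n k g) = b - (LINT g:{0<..<1}|lborel. n k g)" if "k \<in> K" for k
      using set_integral_diff(2)[OF ib parts(2)[OF that]] by (simp add: set_lebesgue_integral_def)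
    then show ?thesis
      unfolding set_integral_mult_right set_integrable_real_sum(2)[OF i, of K "\<lambda>k. k", simplified]
      by (auto intro!: sum.cong)
  qed
  also have "(LINT g:{1..}|lborel. e g) = (LINT g:{1..}|lborel. - 2 * (\<Sum>k\<in>K. c k * p k g))"
    by (rule set_integral_congr(2), rule conjunct1[OF ee], simp)
  also have "\<dots> = - 2 * (\<Sum>k\<in>K. c k * (LINT g:{1..}|lborel. p k g))"
  proof -
    have i: "set_integrable lborel {1..} (\<lambda>g. c k * p k g)" if "k \<in> K" for k
      by (intro set_integrable_mult_right parts(1) that)
    show ?thesis
      unfolding set_integral_mult_right set_integrable_real_sum(2)[OF i, of K "\<lambda>k. k", simplified] ..
  qed
  finally have "- 2 * (\<Sum>k\<in>K. c k * f k) = 2 * (\<Sum>k\<in>K. c k * (b - (LINT g:{0<..<1}|lborel. n k g)))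
    + - 2 * (\<Sum>k\<in>K. c k * (LINT g:{1..}|lborel. p k g))"
    unfolding e(2) .
  then have "(\<Sum>k\<in>K. c k * f k) + (\<Sum>k\<in>K. c k * (b - (LINT g:{0<..<1}|lborel. n k g)))
    - (\<Sum>k\<in>K. c k * (LINT g:{1..}|lborel. p k g)) = 0"
    by linarith
  then have "(\<Sum>k\<in>K. c k * f k + c k * (b - (LINT g:{0<..<1}|lborel. n k g)) - c k * (LINT g:{1..}|lborel. p k g)) = 0"
    by (simp only: sum.distrib sum_subtractf)
  also have "(\<Sum>k\<in>K. c k * f k + c k * (b - (LINT g:{0<..<1}|lborel. n k g)) - c k * (LINT g:{1..}|lborel. p k g)) =
      (\<Sum>k\<in>K. c k * (f k + b - qform (div_int (As k) B) x))"
    by (intro sum.cong refl) (simp add: parts(3) algebra_simps)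
  finally show "qform (\<Sum>k\<in>K. c k *\<^sub>R (fc (\<lambda>r. r * ln r) (As k) + B - div_int (As k) B)) x = qform 0 x"
    by (simp add: qform_sum qform_scaleR qform_add qform_diff f_def b_def)
qed

section \<open>Differentiating the logarithm\<close>

lemma div_int_same:
  assumes "psd B"
  shows "div_int B B = 0"
proof -
  have h: "hermitian B" using assms by (simp add: psd_qform)
  have "div_integrand B B g = 0" if "g \<in> {1..}" for g
  proof -
    have "pos_part (B - g *\<^sub>R B) = 0"
    proof (rule pos_part_eq_0)
      show "hermitian (B - g *\<^sub>R B)" by (intro hermitian_diff hermitian_scaleR h)
      show "qform (B - g *\<^sub>R B) x \<le> 0" for x
        using mult_right_mono[of 1 g "qform B x"] that qform_psd_nonneg[OF assms, of x]
        by (simp add: qform_diff qform_scaleR)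
    qed
    then show ?thesis by (simp add: div_integrand_def)
  qed
  then have "(LINT g:{1..}|lborel. div_integrand B B g) = (LINT g:{1::real..}|lborel. 0)"
    by (rule set_integral_congr(2))
  then show ?thesis by (simp add: div_int_def set_lebesgue_integral_def)
qed

text \<open>The family identity for B + t A, B and A with coefficients 1, -1 and - t. The integral
  vanishes at B itself, and the summands B of the first two members cancel.\<close>

lemma xlogx_taylor:
  fixes A B :: "complex ^ 'n ^ 'n"
  assumes B: "psd B" and \<beta>: "0 < \<beta>" "\<And>v. \<beta> * (norm v)\<^sup>2 \<le> qform B v"
    and A: "psd A" and At: "psd (B + t *\<^sub>R A)"
  defines "f \<equiv> fc (\<lambda>r. r * ln r)"
  shows "f (B + t *\<^sub>R A) = f B + t *\<^sub>R (f A + B - div_int A B) + div_int (B + t *\<^sub>R A) B"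
proof -
  define c :: "nat \<Rightarrow> real" where "c k = (if k = 0 then 1 else if k = 1 then - 1 else - t)" for k
  define As where "As k = (if k = 0 then B + t *\<^sub>R A else if k = 1 then B else A)" for k :: nat
  have "(\<Sum>k\<in>{0, 1, 2}. c k *\<^sub>R (f (As k) + B - div_int (As k) B)) = 0"
    unfolding f_def
  proof (rule div_int_family_identity[OF B \<beta>])
    show "psd (As k)" for k using A At B by (simp add: As_def)
    show "(\<Sum>k\<in>{0, 1, 2}. c k *\<^sub>R As k) = 0" by (simp add: c_def As_def)
  qed simp
  then show ?thesis
    by (simp add: c_def As_def div_int_same[OF B] algebra_simps)
qed

lemma perturbation_bounds:
  assumes A: "psd A" and B: "psd B" and \<tau>: "\<And>v. qform A v \<le> \<tau> * qform B v" and t: "\<bar>t\<bar> * \<tau> \<le> 1"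
  shows "\<bar>t * qform A v\<bar> \<le> \<bar>t\<bar> * \<tau> * qform B v" "\<bar>t * qform A v\<bar> \<le> qform B v" "psd (B + t *\<^sub>R A)"
proof -
  have 1: "\<bar>t * qform A v\<bar> \<le> \<bar>t\<bar> * \<tau> * qform B v" for v
  proof -
    have "\<bar>t * qform A v\<bar> = \<bar>t\<bar> * qform A v" using qform_psd_nonneg[OF A, of v] by (simp add: abs_mult)
    also have "\<dots> \<le> \<bar>t\<bar> * (\<tau> * qform B v)" using \<tau> by (intro mult_left_mono) auto
    finally show ?thesis by (simp add: mult.assoc)
  qed
  have 2: "\<bar>t * qform A v\<bar> \<le> qform B v" for v
    using mult_right_mono[OF t qform_psd_nonneg[OF B, of v]] 1[of v] by simp
  show "\<bar>t * qform A v\<bar> \<le> \<bar>t\<bar> * \<tau> * qform B v" "\<bar>t * qform A v\<bar> \<le> qform B v" by (fact 1 2)+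
  show "psd (B + t *\<^sub>R A)"
    unfolding psd_qform qform_add qform_scaleR
  proof (intro conjI allI)
    show "hermitian (B + t *\<^sub>R A)" using A B by (auto simp: psd_qform intro: hermitian_add hermitian_scaleR)
    show "0 \<le> qform B w + t * qform A w" for w using 2[of w] by linarith
  qed
qed

text \<open>Both positive parts vanish once g exceeds 1 + 2 \<epsilon>. Up to there, comparison with
  the nonpositive matrix (1 - g) B bounds the integrand by 2 |t| \<open>norm A\<close>. The interval
  has length 2 \<epsilon> = 2 |t| \<tau>, whence the constant.\<close>

lemma div_int_perturbation_bound:
  fixes A B :: "complex ^ 'n ^ 'n"
  assumes A: "psd A" and B: "psd B" and \<tau>: "0 < \<tau>" "\<And>v. qform A v \<le> \<tau> * qform B v"
    and t: "\<bar>t\<bar> * \<tau> \<le> 1 / 2"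
  shows "norm (div_int (B + t *\<^sub>R A) B) \<le> 4 * \<tau> * norm A * t\<^sup>2"
proof -
  define \<epsilon> where "\<epsilon> = \<bar>t\<bar> * \<tau>"
  have \<epsilon>: "0 \<le> \<epsilon>" "\<epsilon> \<le> 1 / 2" using t \<tau> by (auto simp: \<epsilon>_def)
  have h: "hermitian A" "hermitian B" using A B by (auto simp: psd_qform)
  have t1: "\<bar>t\<bar> * \<tau> \<le> 1" using t by simp
  note pert = perturbation_bounds[OF A B \<tau>(2) t1]
  have ta: "\<bar>t * qform A v\<bar> \<le> \<epsilon> * qform B v" for v
    using pert(1) by (simp add: \<epsilon>_def)
  have b: "0 \<le> qform B v" for v by (rule qform_psd_nonneg[OF B])
  define X where "X g = B + t *\<^sub>R A - g *\<^sub>R B" for g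
  define Y where "Y g = B - g *\<^sub>R (B + t *\<^sub>R A)" for g
  have hX: "hermitian (X g)" "hermitian (Y g)" for g
    unfolding X_def Y_def by (intro hermitian_diff hermitian_add hermitian_scaleR h)+
  have hB: "hermitian ((1 - g) *\<^sub>R B)" for g by (intro hermitian_scaleR h)
  have qB: "qform ((1 - g) *\<^sub>R B) v \<le> 0" if "1 \<le> g" for g v
    using mult_right_mono[of 1 g "qform B v"] that b[of v] by (simp add: qform_scaleR left_diff_distrib)
  have bound: "norm (div_integrand (B + t *\<^sub>R A) B g) \<le> indicator {1..1 + 2 * \<epsilon>} g * (2 * (\<bar>t\<bar> * norm A))"
    if g: "1 \<le> g" for g
  proof (cases "g \<le> 1 + 2 * \<epsilon>")
    case True
    have "norm (pos_part (X g)) \<le> norm (X g - (1 - g) *\<^sub>R B)"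
      by (rule norm_pos_part_le[OF hX(1) hB qB[OF g]])
    also have "X g - (1 - g) *\<^sub>R B = t *\<^sub>R A" by (simp add: X_def algebra_simps)
    finally have 1: "norm (pos_part (X g)) \<le> \<bar>t\<bar> * norm A" by simp
    have "norm (pos_part (Y g)) \<le> norm (Y g - (1 - g) *\<^sub>R B)"
      by (rule norm_pos_part_le[OF hX(2) hB qB[OF g]])
    also have "Y g - (1 - g) *\<^sub>R B = - ((g * t) *\<^sub>R A)" by (simp add: Y_def algebra_simps)
    finally have 2: "norm (pos_part (Y g)) \<le> g * (\<bar>t\<bar> * norm A)" using g by (simp add: abs_mult)
    have "norm (div_integrand (B + t *\<^sub>R A) B g) \<le> (1 / g) * norm (pos_part (X g)) + (1 / g\<^sup>2) * norm (pos_part (Y g))"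
      unfolding div_integrand_def X_def Y_def using g by (intro norm_triangle_le) simp
    also have "\<dots> \<le> (1 / g) * (\<bar>t\<bar> * norm A) + (1 / g\<^sup>2) * (g * (\<bar>t\<bar> * norm A))"
      using 1 2 g by (intro add_mono mult_left_mono) auto
    also have "\<dots> = (1 / g) * (2 * (\<bar>t\<bar> * norm A))" using g by (simp add: power2_eq_square)
    also have "\<dots> \<le> 1 * (2 * (\<bar>t\<bar> * norm A))" using g by (intro mult_right_mono) auto
    finally show ?thesis using True g by simp
  next
    case False
    have "pos_part (X g) = 0"
    proof (rule pos_part_eq_0[OF hX(1)])
      fix v
      have "qform (X g) v = (1 - g) * qform B v + t * qform A v"
        by (simp add: X_def qform_add qform_diff qform_scaleR algebra_simps)
      also have "\<dots> \<le> (1 - g) * qform B v + \<epsilon> * qform B v" using ta[of v] by simp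
      also have "\<dots> = (1 - g + \<epsilon>) * qform B v" by (simp add: algebra_simps)
      also have "\<dots> \<le> 0" using False \<epsilon> b[of v] by (intro mult_nonpos_nonneg) auto
      finally show "qform (X g) v \<le> 0" .
    qed
    moreover have "pos_part (Y g) = 0"
    proof (rule pos_part_eq_0[OF hX(2)])
      fix v
      \<comment> \<open>In the second part the perturbation carries the factor g, so vanishing is
        guaranteed only from g = 1 / (1 - \<epsilon>) on. For \<epsilon> \<le> 1/2 this is at most 1
        + 2 \<epsilon>, which explains the factor 2 in the length of the interval.\<close>
      have "1 * 1 \<le> (1 + 2 * \<epsilon>) * (1 - \<epsilon>)"
      proof -
        have "0 \<le> \<epsilon> * (1 - 2 * \<epsilon>)" using \<epsilon> by (intro mult_nonneg_nonneg) auto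
        then show ?thesis by (simp add: algebra_simps)
      qed
      also have "\<dots> \<le> g * (1 - \<epsilon>)" using False \<epsilon> by (intro mult_right_mono) auto
      finally have ge: "1 - g + g * \<epsilon> \<le> 0" by (simp add: algebra_simps)
      have "qform (Y g) v = (1 - g) * qform B v + g * (- (t * qform A v))"
        by (simp add: Y_def qform_add qform_diff qform_scaleR algebra_simps)
      also have "\<dots> \<le> (1 - g) * qform B v + g * (\<epsilon> * qform B v)"
        using ta[of v] g by (intro add_left_mono mult_left_mono) auto
      also have "\<dots> = (1 - g + g * \<epsilon>) * qform B v" by (simp add: algebra_simps)
      also have "\<dots> \<le> 0" using ge b[of v] by (intro mult_nonpos_nonneg)
      finally show "qform (Y g) v \<le> 0" .
    qed
    ultimately show ?thesis by (simp add: div_integrand_def X_def Y_def)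
  qed
  have "qform (B + t *\<^sub>R A) v \<le> 2 * qform B v" for v
    using pert(2)[of v] by (simp add: qform_add qform_scaleR)
  then have si: "set_integrable lborel {1..} (div_integrand (B + t *\<^sub>R A) B)"
    by (intro set_integrable_div_integrand[OF pert(3) B, of 2]) auto
  define J where "J = {1..1 + 2 * \<epsilon>}"
  have iJ: "integrable lborel (\<lambda>g. indicator J g * (2 * (\<bar>t\<bar> * norm A)))"
    unfolding J_def by (intro integrable_mult_left integrable_real_indicator) (use \<epsilon> in auto)
  have "norm (div_int (B + t *\<^sub>R A) B) \<le> (\<integral>g. norm (indicator {1..} g *\<^sub>R div_integrand (B + t *\<^sub>R A) B g) \<partial>lborel)"
    unfolding div_int_def set_lebesgue_integral_def by (rule integral_norm_bound)
  also have "\<dots> \<le> (\<integral>g. indicator J g * (2 * (\<bar>t\<bar> * norm A)) \<partial>lborel)"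
  proof (rule integral_mono)
    show "integrable lborel (\<lambda>g. norm (indicator {1..} g *\<^sub>R div_integrand (B + t *\<^sub>R A) B g))"
      using si by (intro integrable_norm) (simp add: set_integrable_def)
    show "norm (indicator {1..} g *\<^sub>R div_integrand (B + t *\<^sub>R A) B g) \<le> indicator J g * (2 * (\<bar>t\<bar> * norm A))" for g
      using bound[of g] by (cases "1 \<le> g") (auto simp: J_def)
  qed (rule iJ)
  also have "\<dots> = 2 * \<epsilon> * (2 * (\<bar>t\<bar> * norm A))"
    using \<epsilon> by (simp add: J_def)
  also have "\<dots> = 4 * \<tau> * norm A * t\<^sup>2" by (simp add: \<epsilon>_def power2_eq_square)
  finally show ?thesis .
qed

lemma matrix_mult_scaleR_right: "M ** (r *\<^sub>R X) = r *\<^sub>R (M ** (X :: complex ^ 'n ^ 'n))"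
  for M :: "complex ^ 'n ^ 'n"
  by (rule matrix_eqI) (simp add: matrix_vector_mult_scaleR_left matrix_vector_mult_scaleR_right flip: matrix_vector_mul_assoc)

lemma matrix_mult_diff_right: "M ** (X - Y) = M ** X - M ** (Y :: complex ^ 'n ^ 'n)"
  for M :: "complex ^ 'n ^ 'n"
  by (rule matrix_eqI) (simp add: matrix_vector_mult_diff_rdistrib matrix_vector_mult_diff_distrib flip: matrix_vector_mul_assoc)

lemmas matrix_mult_right_simps = matrix_add_ldistrib matrix_mult_diff_right matrix_mult_scaleR_right

lemma bounded_linear_matrix_mult: "bounded_linear (\<lambda>X. M ** (X :: complex ^ 'n ^ 'n))"
  for M :: "complex ^ 'n ^ 'n"
  by (intro linear_conv_bounded_linear[THEN iffD1] linearI) (rule matrix_add_ldistrib matrix_mult_scaleR_right)+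

text \<open>With \<open>L t = ln (B + tA)\<close>, the derivative of \<open>L\<close> comes from
  \<open>B (L t - L 0) = f (B + tA) - f B - t A (L t)\<close>; for small \<open>t\<close> the unknown \<open>L t\<close> on the right is absorbed.\<close>

lemma log_derivative:
  fixes A B :: "complex ^ 'n ^ 'n"
  assumes A: "psd A" and B: "psd B" and \<beta>: "0 < \<beta>" "\<And>v. \<beta> * (norm v)\<^sup>2 \<le> qform B v"
  defines "N \<equiv> fc (\<lambda>r. r * ln r) A + B - div_int A B"
  shows "((\<lambda>t. (1 / t) *\<^sub>R (fc ln (B + t *\<^sub>R A) - fc ln B)) \<longlongrightarrow> matrix_inv B ** (N - A ** fc ln B)) (at 0)"
proof -
  have h: "hermitian A" "hermitian B" using A B by (auto simp: psd_qform)
  define Bi where "Bi = matrix_inv B"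
  define L where "L t = fc ln (B + t *\<^sub>R A)" for t
  define D where "D t = div_int (B + t *\<^sub>R A) B" for t
  define f where "f t = fc (\<lambda>r. r * ln r) (B + t *\<^sub>R A)" for t
  have hT: "hermitian (B + t *\<^sub>R A)" for t by (intro hermitian_add hermitian_scaleR h)
  have "bounded_below \<beta> B"
  proof (rule bounded_belowI[OF \<beta>(1)])
    show "\<beta> * (norm x)\<^sup>2 \<le> cmod (cinner x (B *v x))" for x
      using \<beta>(2)[of x] complex_Re_le_cmod order_trans unfolding qform_def by blast
  qed
  then have Bi: "Bi ** B = mat 1"
    unfolding Bi_def by (intro matrix_inv_invertible bounded_below_invertible)
  obtain \<tau> where \<tau>0: "0 < \<tau>" and \<tau>: "\<And>v. qform A v \<le> \<tau> * qform B v"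
    using qform_domination[OF \<beta>, of A] by blast
  have psdT: "psd (B + t *\<^sub>R A)" if "\<bar>t\<bar> * \<tau> \<le> 1 / 2" for t
    using that by (intro perturbation_bounds(3)[OF A B \<tau>]) simp
  have Dt: "norm (D t) \<le> 4 * \<tau> * norm A * t\<^sup>2" if "\<bar>t\<bar> * \<tau> \<le> 1 / 2" for t
    unfolding D_def by (rule div_int_perturbation_bound[OF A B \<tau>0 \<tau> that])
  have fL: "f t = (B + t *\<^sub>R A) ** L t" for t
    using fc_mult[OF hT, of "\<lambda>r. r" t ln] by (simp add: f_def L_def fc_ident[OF hT])
  note lin = bounded_linear_matrix_mult
  have split: "(B + t *\<^sub>R A) ** X = B ** X + t *\<^sub>R (A ** X)" for t and X :: "complex ^ 'n ^ 'n"
    by (rule matrix_eqI) (simp add: matrix_vector_mult_add_rdistrib matrix_vector_mult_scaleR_left flip: matrix_vector_mul_assoc)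
  have eqn: "L t - L 0 = t *\<^sub>R (Bi ** N) + Bi ** D t - t *\<^sub>R (Bi ** (A ** L t))" if t: "\<bar>t\<bar> * \<tau> \<le> 1 / 2" for t
  proof -
    have "f t = f 0 + t *\<^sub>R N + D t"
      using xlogx_taylor[OF B \<beta> A psdT[OF t]] by (simp add: f_def N_def D_def)
    then have "B ** L t + t *\<^sub>R (A ** L t) = B ** L 0 + t *\<^sub>R N + D t"
      unfolding fL split by simp
    then have "B ** (L t - L 0) = t *\<^sub>R N + D t - t *\<^sub>R (A ** L t)"
      by (simp add: matrix_mult_diff_right algebra_simps)
    then have "Bi ** (B ** (L t - L 0)) = Bi ** (t *\<^sub>R N + D t - t *\<^sub>R (A ** L t))" by simp
    then show ?thesis
      by (simp add: matrix_mul_assoc Bi matrix_mult_right_simps)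
  qed
  obtain k where k: "0 < k" "\<And>X :: complex ^ 'n ^ 'n. norm ((Bi ** A) ** X) \<le> norm X * k"
    using bounded_linear.pos_bounded[OF lin] by blast
  obtain k' where k': "0 < k'" "\<And>X :: complex ^ 'n ^ 'n. norm (Bi ** X) \<le> norm X * k'"
    using bounded_linear.pos_bounded[OF lin] by blast
  define E where "E = norm (Bi ** N) + 4 * \<tau> * norm A * k'"
  have E: "0 \<le> E" using \<tau>0 k' by (simp add: E_def)
  define M where "M = 2 * (norm (L 0) + E)"
  \<comment> \<open>For |t| k \<le> 1/2 the term with \<open>L t\<close> on the right costs at most
    half of its norm, which yields the a priori bound \<open>M\<close>. Inserting this bound once
    more gives a difference of order |t|.\<close>
  have small: "norm (L t - L 0) \<le> \<bar>t\<bar> * (E + k * M)" if t: "\<bar>t\<bar> * \<tau> \<le> 1 / 2" "\<bar>t\<bar> \<le> 1" "\<bar>t\<bar> * k \<le> 1 / 2" for t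
  proof -
    have "norm (Bi ** D t) \<le> norm (D t) * k'" by (rule k'(2))
    also have "\<dots> \<le> (4 * \<tau> * norm A * t\<^sup>2) * k'" using Dt[OF t(1)] k'(1) by (intro mult_right_mono) auto
    also have "\<dots> \<le> (4 * \<tau> * norm A * \<bar>t\<bar>) * k'"
    proof -
      have "t\<^sup>2 \<le> \<bar>t\<bar>" using t(2) mult_left_mono[of "\<bar>t\<bar>" 1 "\<bar>t\<bar>"] by (simp add: power2_eq_square)
      then show ?thesis using \<tau>0 k'(1) by (intro mult_right_mono mult_left_mono) auto
    qed
    finally have 1: "norm (Bi ** D t) \<le> \<bar>t\<bar> * (4 * \<tau> * norm A * k')" by (simp add: mult_ac)
    have 2: "norm (t *\<^sub>R (Bi ** (A ** L t))) \<le> \<bar>t\<bar> * (norm (L t) * k)"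
      using mult_left_mono[OF k(2)[of "L t"], of "\<bar>t\<bar>"] by (simp add: matrix_mul_assoc)
    have "norm (L t - L 0) \<le> norm (t *\<^sub>R (Bi ** N) + Bi ** D t) + norm (t *\<^sub>R (Bi ** (A ** L t)))"
      unfolding eqn[OF t(1)] by (rule norm_triangle_ineq4)
    also have "\<dots> \<le> norm (t *\<^sub>R (Bi ** N)) + norm (Bi ** D t) + norm (t *\<^sub>R (Bi ** (A ** L t)))"
      using norm_triangle_ineq by (intro add_right_mono)
    also have "\<dots> \<le> \<bar>t\<bar> * norm (Bi ** N) + \<bar>t\<bar> * (4 * \<tau> * norm A * k') + \<bar>t\<bar> * (norm (L t) * k)"
      using 1 2 by simp
    also have "\<dots> = \<bar>t\<bar> * E + (\<bar>t\<bar> * k) * norm (L t)" by (simp add: E_def algebra_simps)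
    finally have 3: "norm (L t - L 0) \<le> \<bar>t\<bar> * E + (\<bar>t\<bar> * k) * norm (L t)" .
    have "(\<bar>t\<bar> * k) * norm (L t) \<le> 1 / 2 * norm (L t)" using t(3) by (rule mult_right_mono) simp
    moreover have "\<bar>t\<bar> * E \<le> 1 * E" using t(2) E by (intro mult_right_mono) auto
    moreover have "norm (L t) \<le> norm (L 0) + norm (L t - L 0)" using norm_triangle_ineq[of "L 0" "L t - L 0"] by simp
    moreover have "n \<le> 2 * (n0 + E)" if "b \<le> 1 / 2 * n" "a \<le> 1 * E" "n \<le> n0 + d" "d \<le> a + b" for n n0 a b d :: real
      using that by simp
    ultimately have "norm (L t) \<le> M" using 3 unfolding M_def by blast
    then have "(\<bar>t\<bar> * k) * norm (L t) \<le> (\<bar>t\<bar> * k) * M" using k(1) by (intro mult_left_mono) auto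
    with 3 show ?thesis by (simp add: algebra_simps)
  qed
  have ev: "eventually (\<lambda>t. \<bar>t\<bar> * \<tau> \<le> 1 / 2 \<and> \<bar>t\<bar> \<le> 1 \<and> \<bar>t\<bar> * k \<le> 1 / 2 \<and> t \<noteq> 0) (at 0)"
  proof -
    define d where "d = min (1 / (2 * \<tau>)) (min 1 (1 / (2 * k)))"
    have d: "0 < d" "d \<le> 1 / (2 * \<tau>)" "d \<le> 1" "d \<le> 1 / (2 * k)" using \<tau>0 k by (auto simp: d_def)
    show ?thesis
      unfolding eventually_at
    proof (intro exI[of _ d] conjI ballI impI d(1))
      fix t :: real assume t: "t \<noteq> 0 \<and> dist t 0 < d"
      have "\<bar>t\<bar> \<le> 1 / (2 * \<tau>)" "\<bar>t\<bar> \<le> 1 / (2 * k)" using t d by auto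
      then show "\<bar>t\<bar> * \<tau> \<le> 1 / 2" "\<bar>t\<bar> * k \<le> 1 / 2" using \<tau>0 k by (simp_all add: field_simps)
      show "\<bar>t\<bar> \<le> 1" "t \<noteq> 0" using t d by auto
    qed
  qed
  have "((\<lambda>t. L t - L 0) \<longlongrightarrow> 0) (at 0)"
  proof (rule Lim_null_comparison)
    show "eventually (\<lambda>t. norm (L t - L 0) \<le> \<bar>t\<bar> * (E + k * M)) (at 0)"
      using ev by eventually_elim (auto intro: small)
    show "((\<lambda>t::real. \<bar>t\<bar> * (E + k * M)) \<longlongrightarrow> 0) (at 0)"
      by (intro tendsto_mult_left_zero tendsto_rabs_zero tendsto_ident_at)
  qed
  then have L0: "(L \<longlongrightarrow> L 0) (at 0)" by (simp add: LIM_zero_iff)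
  have D0: "((\<lambda>t. (1 / t) *\<^sub>R D t) \<longlongrightarrow> 0) (at 0)"
  proof (rule Lim_null_comparison)
    show "eventually (\<lambda>t. norm ((1 / t) *\<^sub>R D t) \<le> \<bar>t\<bar> * (4 * \<tau> * norm A)) (at 0)"
      using ev
    proof eventually_elim
      case (elim t)
      then have "norm ((1 / t) *\<^sub>R D t) \<le> (1 / \<bar>t\<bar>) * (4 * \<tau> * norm A * t\<^sup>2)"
      proof -
        have "(1 / \<bar>t\<bar>) * norm (D t) \<le> (1 / \<bar>t\<bar>) * (4 * \<tau> * norm A * t\<^sup>2)"
          using elim by (intro mult_left_mono Dt) auto
        then show ?thesis by simp
      qed
      also have "\<dots> = \<bar>t\<bar> * (4 * \<tau> * norm A)"
      proof -
        have sq: "t\<^sup>2 = \<bar>t\<bar> * \<bar>t\<bar>" by (simp add: power2_eq_square)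
        have cancel: "(1 / u) * (c * (u * u)) = u * c" if "u \<noteq> 0" for u c :: real
          using that by simp
        show ?thesis unfolding sq by (rule cancel) (use elim in simp)
      qed
      finally show ?case .
    qed
    show "((\<lambda>t::real. \<bar>t\<bar> * (4 * \<tau> * norm A)) \<longlongrightarrow> 0) (at 0)"
      by (intro tendsto_mult_left_zero tendsto_rabs_zero tendsto_ident_at)
  qed
  have lim: "((\<lambda>t. Bi ** (N + (1 / t) *\<^sub>R D t - A ** L t)) \<longlongrightarrow> Bi ** (N + 0 - A ** L 0)) (at 0)"
    by (intro bounded_linear.tendsto[OF lin] tendsto_intros D0 L0)
  have "((\<lambda>t. (1 / t) *\<^sub>R (L t - L 0)) \<longlongrightarrow> Bi ** (N + 0 - A ** L 0)) (at 0)"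
  proof (rule Lim_transform_eventually[OF lim])
    show "eventually (\<lambda>t. Bi ** (N + (1 / t) *\<^sub>R D t - A ** L t) = (1 / t) *\<^sub>R (L t - L 0)) (at 0)"
      using ev
    proof eventually_elim
      case (elim t)
      then have "(1 / t) *\<^sub>R (L t - L 0) = (1 / t) *\<^sub>R (t *\<^sub>R (Bi ** N) + Bi ** D t - t *\<^sub>R (Bi ** (A ** L t)))"
        using eqn[of t] by simp
      also have "\<dots> = Bi ** N + (1 / t) *\<^sub>R (Bi ** D t) - Bi ** (A ** L t)"
        using elim by (simp add: scaleR_add_right scaleR_diff_right)
      finally show ?case
        by (simp add: matrix_mult_right_simps)
    qed
  qed
  then show ?thesis by (simp add: L_def Bi_def)
qed

section \<open>Reduction to a positive definite matrix\<close>

lemma psd_positive_definite: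
  fixes M :: "complex ^ 'n ^ 'n"
  assumes M: "psd M" and ker: "\<And>x. M *v x = 0 \<Longrightarrow> x = 0"
  obtains \<beta> where "0 < \<beta>" "\<And>v. \<beta> * (norm v)\<^sup>2 \<le> qform M v"
proof -
  have h: "hermitian M" using M by (simp add: psd_qform)
  have pos: "0 < r" if r: "r \<in> spec M" for r
  proof -
    have "0 \<le> r" using spec_lower_bound[OF h, of 0 r] M r by (simp add: psd_qform)
    moreover have "r \<noteq> 0" using spec_eigenvector[OF h r] ker by auto
    ultimately show ?thesis by simp
  qed
  \<comment> \<open>The smallest eigenvalue, capped at 1; inserting 1 makes the set nonempty at
    once.\<close>
  define \<beta> where "\<beta> = Min (insert 1 (spec M))"
  have fin: "finite (insert 1 (spec M))" using finite_spec[OF h] by simp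
  have "\<beta> \<in> insert 1 (spec M)" unfolding \<beta>_def using fin by (intro Min_in) auto
  then have b0: "0 < \<beta>" using pos by auto
  have "\<beta> * (norm v)\<^sup>2 \<le> qform M v" for v
    unfolding qform_sum_eproj[OF h] norm_eq_sum_eproj[OF h, of v] sum_distrib_left
    using fin by (intro sum_mono mult_right_mono) (auto simp: \<beta>_def)
  with b0 show ?thesis using that by blast
qed

text \<open>The calculus on V vanishes on the complement of V; being Hermitian, it therefore also
  has its range in V.\<close>

lemma fun_calc_on_range:
  assumes V: "vec.subspace V" and T: "hermitian T" and TV: "\<And>x. x \<in> V \<Longrightarrow> T *v x \<in> V"
  shows "(mat 1 - orth_proj V) ** fun_calc_on V f T = 0"
proof (rule matrix_eqI)
  fix x
  let ?Q = "mat 1 - orth_proj V" and ?M = "fun_calc_on V f T"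
  have hQ: "hermitian ?Q" by (intro hermitian_diff hermitian_one orth_proj_hermitian V)
  have "cinner y (?Q *v (?M *v x)) = 0" for y
  proof -
    have "?M *v (?Q *v y) = 0"
    proof (rule fun_calc_on_orth[OF V T TV])
      have "?Q *v y = y - orth_proj V *v y" by (simp add: matrix_vector_mult_diff_rdistrib)
      then show "cinner z (?Q *v y) = 0" if "z \<in> V" for z
        using orth_proj_orth[OF V that, of y] by (simp only:)
    qed
    moreover have "cinner y (?Q *v (?M *v x)) = cinner (?M *v (?Q *v y)) x"
      using hQ hermitian_fun_calc_on[OF V T TV, of f] by (simp add: hermitianD)
    ultimately show ?thesis by simp
  qed
  then have "?Q *v (?M *v x) = 0" by (rule cinner_all_zero)
  then show "(?Q ** ?M) *v x = 0 *v x" by (simp add: matrix_vector_mul_assoc)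
qed

lemma pos_part_add_complement:
  assumes V: "vec.subspace V" and T: "hermitian T" and TV: "\<And>x. T *v x \<in> V"
  shows "pos_part (T + c *\<^sub>R (mat 1 - orth_proj V)) = pos_part T + max 0 c *\<^sub>R (mat 1 - orth_proj V)"
proof -
  have h: "hermitian (T + c *\<^sub>R (mat 1 - orth_proj V))"
    by (intro hermitian_add hermitian_scaleR hermitian_diff T hermitian_one orth_proj_hermitian V)
  show ?thesis
    unfolding pos_part_fc[OF h] pos_part_fc[OF T]
    using fc_add_complement[OF V T TV, of "\<lambda>r. max 0 r" c] fc_add_complement[OF V T TV, of "\<lambda>r. max 0 r" 0]
    by simp
qed

lemma integral_inverse_square: "(LINT g:{1..}|lborel. 1 / g\<^sup>2) = (1 :: real)"
proof -
  have i: "set_integrable lborel {1..} (\<lambda>g::real. 1 / g\<^sup>2)"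
    using set_integrable_inverse_square[of 1] by simp
  have i': "set_integrable lborel {1<..} (\<lambda>g::real. 1 / g\<^sup>2)"
    by (rule set_integrable_subset[OF i]) auto
  have "(LINT g:{1..}|lborel. 1 / g\<^sup>2) = (LINT g:{1<..}|lborel. 1 / (g::real)\<^sup>2)"
    unfolding set_lebesgue_integral_def
    by (rule integral_cong_AE) (use i i' AE_lborel_singleton[of 1] in \<open>auto simp: set_integrable_def indicator_def\<close>)
  also have "\<dots> = (LINT u:{0<..<1::real}|lborel. 1)"
    using integral_substitution_inverse(2)[of "\<lambda>_. 1"] i' by simp
  also have "\<dots> = 1" by (simp add: set_lebesgue_integral_def)
  finally show ?thesis .
qed

section \<open>Matrices with ker B contained in ker A, seen on the support of B\<close>

context
  fixes A B :: "complex ^ 'n ^ 'n"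
  assumes A: "psd A" and B: "psd B" and ker: "\<And>x. B *v x = 0 \<Longrightarrow> A *v x = 0"
begin

abbreviation "suppB \<equiv> range ((*v) B)"
abbreviation "kerB \<equiv> mat 1 - orth_proj suppB"

lemma hermitian_A: "hermitian A" and hermitian_B: "hermitian B"
  using A B by (auto simp: psd_qform)

lemma subspace_suppB: "vec.subspace suppB"
proof -
  have "suppB = (*v) B ` UNIV" by simp
  then show ?thesis
    using vec.subspace_image[OF vec.subspace_UNIV, of B] by simp
qed

lemma orth_suppB_kernel:
  assumes "\<And>y. y \<in> suppB \<Longrightarrow> cinner y x = 0"
  shows "B *v x = 0"
proof (rule cinner_all_zero)
  show "cinner y (B *v x) = 0" for y using assms[of "B *v y"] by (simp add: hermitianD[OF hermitian_B])
qed

lemma kerB_kernel: "B *v (kerB *v x) = 0" "A *v (kerB *v x) = 0"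
proof -
  show "B *v (kerB *v x) = 0"
    by (rule orth_suppB_kernel) (simp add: matrix_vector_mult_diff_rdistrib orth_proj_orth[OF subspace_suppB])
  then show "A *v (kerB *v x) = 0" by (rule ker)
qed

lemma mult_proj_suppB: "A *v (orth_proj suppB *v x) = A *v x" "B *v (orth_proj suppB *v x) = B *v x"
  using kerB_kernel[of x] by (simp_all add: matrix_vector_mult_diff_rdistrib matrix_vector_mult_diff_distrib)

text \<open>The adjoint of \<open>kerB_kernel\<close>: the Hermitian matrix A kills ker B, so its
  range is orthogonal to ker B.\<close>

lemma range_A_suppB: "A *v x \<in> suppB"
proof -
  let ?w = "kerB *v (A *v x)"
  have hQ: "hermitian kerB" by (intro hermitian_diff hermitian_one orth_proj_hermitian subspace_suppB)
  have "cinner y ?w = 0" for y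
  proof -
    have "cinner y ?w = cinner (A *v (kerB *v y)) x"
      using hQ hermitian_A by (simp add: hermitianD)
    then show ?thesis by (simp add: kerB_kernel)
  qed
  then have "?w = 0" by (rule cinner_all_zero)
  then have "A *v x = orth_proj suppB *v (A *v x)" by (simp add: matrix_vector_mult_diff_rdistrib)
  then show ?thesis by (metis orth_proj_in[OF subspace_suppB])
qed

lemma range_B_suppB: "B *v x \<in> suppB"
  by simp

lemma restrict_suppB: "restrict_op suppB A = A" "restrict_op suppB B = B"
  unfolding restrict_op_def
  by (rule matrix_eqI, simp add: mult_proj_suppB flip: matrix_vector_mul_assoc)+

lemma psd_kerB: "psd kerB"
  unfolding psd_qform
proof (intro conjI allI hermitian_diff hermitian_one orth_proj_hermitian subspace_suppB)
  fix x
  let ?P = "orth_proj suppB"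
  have "norm (?P *v x) \<le> norm x"
  proof -
    have "(norm (?P *v x))\<^sup>2 = Re (cinner x (?P *v x))"
      using qform_orth_proj[OF subspace_suppB, of x] by (simp add: qform_def)
    also have "\<dots> \<le> norm x * norm (?P *v x)"
      using complex_Re_le_cmod norm_cinner_le order_trans by blast
    finally show ?thesis by (cases "?P *v x = 0") (auto simp: power2_eq_square)
  qed
  then show "0 \<le> qform kerB x"
    by (simp add: qform_diff qform_one qform_orth_proj[OF subspace_suppB])
qed

lemma psd_B_kerB: "psd (B + kerB)"
  by (intro psd_add B psd_kerB)

text \<open>Both summands have nonnegative forms, so a vector killed by the sum is killed by each.
  It then lies both in the range and in the kernel of the Hermitian matrix B, hence is 0.\<close>

lemma B_kerB_positive:
  obtains \<beta> where "0 < \<beta>" "\<And>v. \<beta> * (norm v)\<^sup>2 \<le> qform (B + kerB) v"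
proof (rule psd_positive_definite[OF psd_B_kerB])
  fix x assume x: "(B + kerB) *v x = 0"
  have "qform B x + qform kerB x = 0"
    using arg_cong[OF x, of "\<lambda>v. Re (cinner x v)"] by (simp add: qform_def matrix_vector_mult_add_rdistrib cinner_add_right)
  then have "qform B x = 0" "qform kerB x = 0"
    using qform_psd_nonneg[OF B, of x] qform_psd_nonneg[OF psd_kerB, of x] by linarith+
  then have 1: "B *v x = 0" "kerB *v x = 0"
    using qform_zero_imp_kernel B psd_kerB by blast+
  from 1(2) have "x = orth_proj suppB *v x" by (simp add: matrix_vector_mult_diff_rdistrib)
  then obtain y where y: "x = B *v y" using orth_proj_in[OF subspace_suppB, of x] by auto
  have "cinner x x = cinner (B *v x) y" using y by (simp add: hermitianD[OF hermitian_B])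
  then show "x = 0" by (simp add: 1)
qed (rule that)

text \<open>A is dominated by a multiple of the positive definite B + \<open>kerB\<close>. The forms
  of A and B depend only on the component of v in the support of B, and there \<open>kerB\<close>
  contributes nothing. This is the converse of the fact that domination forces the kernel
  inclusion.\<close>

lemma domination:
  obtains \<tau> where "1 \<le> \<tau>" "\<And>v. qform A v \<le> \<tau> * qform B v"
proof -
  obtain \<beta> where \<beta>: "0 < \<beta>" "\<And>v. \<beta> * (norm v)\<^sup>2 \<le> qform (B + kerB) v" using B_kerB_positive by blast
  obtain \<tau>0 where \<tau>0: "\<And>v. qform A v \<le> \<tau>0 * qform (B + kerB) v" using qform_domination[OF \<beta>, of A] by blast
  define \<tau> where "\<tau> = max 1 \<tau>0"
  have "qform A v \<le> \<tau> * qform B v" for v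
  proof -
    let ?v = "orth_proj suppB *v v"
    have e: "qform M ?v = qform M v" if "hermitian M" "\<And>x. M *v (orth_proj suppB *v x) = M *v x" for M
    proof -
      have "cinner ?v (M *v ?v) = cinner ?v (M *v v)" by (simp only: that(2))
      also have "\<dots> = cinner (M *v ?v) v" by (simp only: hermitianD[OF that(1)])
      also have "\<dots> = cinner (M *v v) v" by (simp only: that(2))
      also have "\<dots> = cinner v (M *v v)" by (rule hermitianD[OF that(1)])
      finally show ?thesis by (simp add: qform_def)
    qed
    have k: "kerB *v ?v = 0" by (simp add: matrix_vector_mult_diff_rdistrib orth_proj_idem[OF subspace_suppB])
    have "qform A v = qform A ?v" using e[OF hermitian_A] mult_proj_suppB by simp
    also have "\<dots> \<le> \<tau>0 * qform (B + kerB) ?v" by (rule \<tau>0)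
    also have "qform (B + kerB) ?v = qform B ?v"
      using k by (simp add: qform_def matrix_vector_mult_add_rdistrib)
    also have "\<dots> = qform B v" using e[OF hermitian_B] mult_proj_suppB by simp
    also have "\<tau>0 * qform B v \<le> \<tau> * qform B v"
      using qform_psd_nonneg[OF B] by (intro mult_right_mono) (simp_all add: \<tau>_def)
    finally show ?thesis .
  qed
  then show ?thesis using that[of \<tau>] by (simp add: \<tau>_def)
qed

lemma set_integrable_div_integrand_ker: "set_integrable lborel {1..} (div_integrand A B)"
proof -
  obtain \<tau> where "1 \<le> \<tau>" "\<And>v. qform A v \<le> \<tau> * qform B v" using domination by blast
  then show ?thesis by (intro set_integrable_div_integrand[OF A B, of \<tau>]) auto
qed

text \<open>On ker B the pair A, B + \<open>kerB\<close> acts as 0 and 1. There the first positive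
  part vanishes, the second is 1, and g^-2 has integral 1 over [1, oo).\<close>

lemma div_int_add_kerB: "div_int A (B + kerB) = div_int A B + kerB"
proof -
  have V: "hermitian (A - g *\<^sub>R B)" "hermitian (B - g *\<^sub>R A)"
    "(A - g *\<^sub>R B) *v x \<in> suppB" "(B - g *\<^sub>R A) *v x \<in> suppB" for g x
  proof -
    show "hermitian (A - g *\<^sub>R B)" "hermitian (B - g *\<^sub>R A)"
      by (intro hermitian_diff hermitian_scaleR hermitian_A hermitian_B)+
    show "(A - g *\<^sub>R B) *v x \<in> suppB" "(B - g *\<^sub>R A) *v x \<in> suppB"
      unfolding matrix_vector_mult_diff_rdistrib matrix_vector_mult_scaleR_left
      by (intro subspace_diff subspace_scale subspace_real subspace_suppB range_A_suppB range_B_suppB)+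
  qed
  have e: "div_integrand A (B + kerB) g = div_integrand A B g + (1 / g\<^sup>2) *\<^sub>R kerB" if "g \<in> {1..}" for g
  proof -
    have eq1: "A - g *\<^sub>R (B + kerB) = (A - g *\<^sub>R B) + (- g) *\<^sub>R kerB" by (simp add: scaleR_add_right)
    have 1: "pos_part (A - g *\<^sub>R (B + kerB)) = pos_part (A - g *\<^sub>R B)"
      unfolding eq1 pos_part_add_complement[OF subspace_suppB V(1) V(3)] using that by (simp add: max_def)
    have eq2: "B + kerB - g *\<^sub>R A = (B - g *\<^sub>R A) + 1 *\<^sub>R kerB" by simp
    have 2: "pos_part (B + kerB - g *\<^sub>R A) = pos_part (B - g *\<^sub>R A) + kerB"
      unfolding eq2 pos_part_add_complement[OF subspace_suppB V(2) V(4)] by simp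
    show ?thesis unfolding div_integrand_def 1 2 by (simp add: scaleR_add_right)
  qed
  have i: "set_integrable lborel {1..} (\<lambda>g::real. 1 / g\<^sup>2)"
    using set_integrable_inverse_square[of 1] by simp
  have i1: "integrable lborel (\<lambda>g. indicator {1..} g *\<^sub>R (1 / g\<^sup>2 :: real))"
    using i by (simp add: set_integrable_def)
  have i2: "integrable lborel (\<lambda>g. (indicator {1..} g *\<^sub>R (1 / g\<^sup>2)) *\<^sub>R kerB)"
    by (rule integrable_scaleR_left) (rule i1)
  have "div_int A (B + kerB) = (LINT g:{1..}|lborel. div_integrand A B g + (1 / g\<^sup>2) *\<^sub>R kerB)"
    unfolding div_int_def by (rule set_integral_congr(2)[OF e])
  also have "\<dots> = div_int A B + (\<integral>g. (indicator {1..} g *\<^sub>R (1 / g\<^sup>2)) *\<^sub>R kerB \<partial>lborel)"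
    unfolding div_int_def set_lebesgue_integral_def
    using set_integrable_div_integrand_ker i2
    by (subst Bochner_Integration.integral_add[symmetric]) (auto simp: set_integrable_def scaleR_add_right)
  also have "(\<integral>g. (indicator {1..} g *\<^sub>R (1 / g\<^sup>2)) *\<^sub>R kerB \<partial>lborel) = (LINT g:{1..}|lborel. 1 / g\<^sup>2) *\<^sub>R kerB"
    unfolding set_lebesgue_integral_def by (rule integral_scaleR_left) (rule i1)
  finally show ?thesis by (simp add: integral_inverse_square)
qed

text \<open>The logarithms on the support of B are the full logarithms of B' + t A, since the added
  eigenvalue 1 has logarithm 0. The derivative is therefore the one from the positive definite case,
  and the added projection cancels between B' and the integral.\<close>

lemma div_op_eq_div_int: "div_op A B = div_int A B"
proof -
  obtain \<beta> where \<beta>: "0 < \<beta>" "\<And>v. \<beta> * (norm v)\<^sup>2 \<le> qform (B + kerB) v" using B_kerB_positive by blast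
  define B' where "B' = B + kerB"
  define N where "N = fc (\<lambda>r. r * ln r) A + B' - div_int A B'"
  define D where "D = matrix_inv B' ** (N - A ** fc ln B')"
  have log: "log_on suppB (B + t *\<^sub>R A) = fc ln (B' + t *\<^sub>R A)" for t
  proof -
    have T: "hermitian (B + t *\<^sub>R A)" "(B + t *\<^sub>R A) *v x \<in> suppB" for x
      unfolding matrix_vector_mult_add_rdistrib matrix_vector_mult_scaleR_left
      by (intro hermitian_add hermitian_scaleR hermitian_A hermitian_B
          subspace_add subspace_scale subspace_real subspace_suppB range_A_suppB range_B_suppB)+
    have eq: "B' + t *\<^sub>R A = (B + t *\<^sub>R A) + 1 *\<^sub>R kerB" by (simp add: B'_def)
    show ?thesis unfolding log_on_def eq fc_add_complement[OF subspace_suppB T] by simp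
  qed
  have log0: "log_on suppB B = fc ln B'" using log[of 0] by simp
  have xl: "xlogx_on suppB A = fc (\<lambda>r. r * ln r) A"
    using fc_add_complement[OF subspace_suppB hermitian_A range_A_suppB, of "\<lambda>r. r * ln r" 0] by (simp add: xlogx_on_def)
  have lim: "((\<lambda>t. (1 / t) *\<^sub>R (log_on suppB (B + t *\<^sub>R A) - log_on suppB B)) \<longlongrightarrow> D) (at 0)"
    unfolding log log0 D_def N_def
    using log_derivative[OF A psd_B_kerB \<beta>] by (simp add: B'_def)
  then have Dlog: "Dlog_on suppB B A = D"
    unfolding Dlog_on_def by (intro tendsto_Lim) auto
  \<comment> \<open>Every difference quotient has its range in the support of B, hence so does the
    limit \<open>D\<close>; this allows B to replace B' in front of \<open>D\<close>.\<close>
  have "((\<lambda>t. kerB ** ((1 / t) *\<^sub>R (log_on suppB (B + t *\<^sub>R A) - log_on suppB B))) \<longlongrightarrow> kerB ** D) (at 0)"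
    by (rule bounded_linear.tendsto[OF bounded_linear_matrix_mult lim])
  moreover have "kerB ** ((1 / t) *\<^sub>R (log_on suppB (B + t *\<^sub>R A) - log_on suppB B)) = 0" for t
  proof -
    have "kerB ** log_on suppB (B + t *\<^sub>R A) = 0" for t
      unfolding log_on_def
    proof (rule fun_calc_on_range[OF subspace_suppB])
      show "hermitian (B + t *\<^sub>R A)" by (intro hermitian_add hermitian_scaleR hermitian_A hermitian_B)
      show "(B + t *\<^sub>R A) *v x \<in> suppB" for x
        unfolding matrix_vector_mult_add_rdistrib matrix_vector_mult_scaleR_left
        by (intro subspace_add subspace_scale subspace_real subspace_suppB range_A_suppB range_B_suppB)
    qed
    from this[of t] this[of 0] show ?thesis by (simp add: matrix_mult_right_simps)
  qed
  ultimately have "((\<lambda>t::real. 0) \<longlongrightarrow> kerB ** D) (at 0)" by simp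
  then have kD: "kerB ** D = 0" by (simp add: tendsto_const_iff)
  have "bounded_below \<beta> B'"
  proof (rule bounded_belowI[OF \<beta>(1)])
    show "\<beta> * (norm x)\<^sup>2 \<le> cmod (cinner x (B' *v x))" for x
      using \<beta>(2)[of x] complex_Re_le_cmod order_trans unfolding qform_def B'_def by blast
  qed
  then have "B' ** matrix_inv B' = mat 1" by (intro matrix_inv_invertible bounded_below_invertible)
  then have B'D: "B' ** D = N - A ** fc ln B'" by (simp add: D_def matrix_mul_assoc)
  have BD: "B ** D = N - A ** fc ln B'"
  proof -
    have "B' ** D = B ** D + kerB ** D"
      unfolding B'_def by (rule matrix_eqI) (simp add: matrix_vector_mult_add_rdistrib flip: matrix_vector_mul_assoc)
    then show ?thesis using B'D kD by simp
  qed
  have "div_op A B = fc (\<lambda>r. r * ln r) A - A ** fc ln B' - B ** D + B"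
    by (simp add: div_op_def div_op_on_def Let_def restrict_suppB xl log0 Dlog)
  also have "\<dots> = div_int A B' - B' + B" by (simp add: BD N_def)
  also have "\<dots> = div_int A B" using div_int_add_kerB by (simp add: B'_def)
  finally show ?thesis .
qed

end

lemma loewner_le_scaled:
  assumes "psd A" "psd B"
  shows "loewner_le A (\<tau> *\<^sub>R B) \<longleftrightarrow> (\<forall>v. qform A v \<le> \<tau> * qform B v)"
  using assms by (auto simp: loewner_le_def psd_qform hermitian_diff hermitian_scaleR qform_diff qform_scaleR)

lemma op_norm_ge_qform: "qform M x \<le> op_norm M * (norm x)\<^sup>2"
  using abs_qform_le[of M x] by linarith

text \<open>The rank-one matrix X = x x^* is at most |x|^2 times the identity, and pairing with M
  under the trace preserves this inequality; tr(M X) is the form of M at x.\<close>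

lemma qform_le_trace:
  assumes M: "psd M"
  shows "qform M x \<le> (norm x)\<^sup>2 * Re (trace M)"
proof -
  define X :: "complex ^ 'a ^ 'a" where "X = (\<chi> i j. x $ i * cnj (x $ j))"
  have Xv: "X *v v = cinner x v *s x" for v
    by (simp add: X_def vec_eq_iff matrix_vector_mult_def cinner_def sum_distrib_left sum_distrib_right mult_ac)
  have hX: "hermitian X" by (rule hermitianI) (simp add: X_def)
  have qX: "qform X v = (cmod (cinner x v))\<^sup>2" for v
  proof -
    have "cinner v (X *v v) = cinner x v * cnj (cinner x v)"
      by (simp add: Xv cinner_smult_right cinner_commute[of v x])
    then show ?thesis by (simp add: qform_def complex_norm_square[symmetric] del: of_real_power)
  qed
  have "psd ((norm x)\<^sup>2 *\<^sub>R mat 1 - X)"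
    unfolding psd_qform
  proof (intro conjI allI hermitian_diff hermitian_scaleR hermitian_one hX)
    fix v
    have "(cmod (cinner x v))\<^sup>2 \<le> (norm x * norm v)\<^sup>2" by (intro power_mono norm_cinner_le) simp
    then show "0 \<le> qform ((norm x)\<^sup>2 *\<^sub>R mat 1 - X) v"
      by (simp add: qform_diff qform_scaleR qform_one qX power_mult_distrib)
  qed
  from inner_psd_nonneg[OF this M] have "inner X M \<le> (norm x)\<^sup>2 * inner (mat 1) M"
    by (simp add: inner_diff_left)
  moreover have "inner (mat 1) M = Re (trace M)" by (simp add: inner_hermitian_trace)
  moreover have "inner X M = qform M x"
  proof -
    have "inner X M = Re (trace (M ** X))" using inner_hermitian_trace[OF hX, of M] by (metis trace_mul_sym)
    also have "trace (M ** X) = (\<Sum>i\<in>UNIV. cinner x (axis i 1) * cinner (axis i 1) (M *v x))"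
      unfolding trace_sum_cinner
      by (simp add: Xv matrix_vector_mult_smult cinner_smult_right flip: matrix_vector_mul_assoc)
    also have "\<dots> = cinner x (M *v x)"
      unfolding cinner_axis cinner_commute[of x "axis _ 1"] by (simp add: cinner_def)
    finally show ?thesis by (simp add: qform_def)
  qed
  ultimately show ?thesis by simp
qed

section \<open>Divergence along a vector in ker B on which A is positive\<close>

context
  fixes A B :: "complex ^ 'n ^ 'n" and x :: "complex ^ 'n"
  assumes A: "psd A" and B: "psd B" and x: "B *v x = 0" "0 < qform A x"
begin

lemma herm_AB: "hermitian A" "hermitian B" using A B by (auto simp: psd_qform)

lemma x_nonzero: "0 < norm x"
  using x by (cases "x = 0") auto

lemma set_integrable_div_integrand_Icc: "set_integrable lborel {1..t} (div_integrand A B)"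
  by (intro borel_integrable_atLeastAtMost' continuous_on_subset[OF continuous_on_div_integrand[OF herm_AB]]) auto

lemma psd_integral_Icc: "psd (LINT g:{1..t}|lborel. div_integrand A B g)"
  by (intro psd_set_integral set_integrable_div_integrand_Icc psd_div_integrand herm_AB) auto

text \<open>At x the form of A - g B equals that of A for every g, and passing to the positive part
  can only increase a form. The weight 1/g then forces logarithmic growth of the integral.\<close>

lemma qform_div_integrand_ge:
  assumes g: "1 \<le> g"
  shows "qform A x * (1 / g) \<le> qform (div_integrand A B g) x"
proof -
  have h: "hermitian (A - g *\<^sub>R B)" "hermitian (B - g *\<^sub>R A)"
    by (intro hermitian_diff hermitian_scaleR herm_AB)+
  have "qform (A - g *\<^sub>R B) x = qform A x"
    using x by (simp add: qform_def matrix_vector_mult_diff_rdistrib matrix_vector_mult_scaleR_left)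
  then have 1: "qform A x \<le> qform (pos_part (A - g *\<^sub>R B)) x" using pos_part_ge[OF h(1), of x] by simp
  have 2: "0 \<le> qform (pos_part (B - g *\<^sub>R A)) x" by (rule qform_psd_nonneg[OF psd_pos_part[OF h(2)]])
  have "qform A x * (1 / g) \<le> (1 / g) * qform (pos_part (A - g *\<^sub>R B)) x"
    using 1 g by (simp add: divide_right_mono)
  also have "\<dots> \<le> qform (div_integrand A B g) x"
    using 2 g by (simp add: div_integrand_def qform_add qform_scaleR)
  finally show ?thesis .
qed

lemma qform_integral_ge:
  assumes t: "1 \<le> t"
  shows "qform A x * ln t \<le> qform (LINT g:{1..t}|lborel. div_integrand A B g) x"
proof -
  have c: "continuous_on {1..t} (\<lambda>g. qform A x * (1 / g))"
    by (intro continuous_intros) auto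
  have "(\<integral>g. indicator {1..t} g *\<^sub>R (qform A x * (1 / g)) \<partial>lborel) = qform A x * ln t - qform A x * ln 1"
  proof (rule integral_FTC_atLeastAtMost[OF t _ c])
    fix y :: real assume y: "1 \<le> y" "y \<le> t"
    have "((\<lambda>g. qform A x * ln g) has_real_derivative qform A x * (1 / y)) (at y within {1..t})"
      using y by (auto intro!: derivative_eq_intros)
    then show "((\<lambda>g. qform A x * ln g) has_vector_derivative qform A x * (1 / y)) (at y within {1..t})"
      by (simp only: has_real_derivative_iff_has_vector_derivative)
  qed
  then have "qform A x * ln t = (LINT g:{1..t}|lborel. qform A x * (1 / g))"
    by (simp add: set_lebesgue_integral_def)
  also have "\<dots> \<le> (LINT g:{1..t}|lborel. qform (div_integrand A B g) x)"
    by (intro set_integral_mono borel_integrable_atLeastAtMost' c qform_set_integral(1)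
        set_integrable_div_integrand_Icc qform_div_integrand_ge) auto
  also have "\<dots> = qform (LINT g:{1..t}|lborel. div_integrand A B g) x"
    by (rule qform_set_integral(2)[symmetric, OF set_integrable_div_integrand_Icc])
  finally show ?thesis .
qed

lemma ln_scaled_at_top: "0 < c \<Longrightarrow> filterlim (\<lambda>t. c * ln t) at_top at_top" for c :: real
  by (intro filterlim_tendsto_pos_mult_at_top[OF tendsto_const _ ln_at_top])

lemma op_norm_integral_at_top:
  "filterlim (\<lambda>t. op_norm (LINT g:{1..t}|lborel. div_integrand A B g)) at_top at_top"
proof (rule filterlim_at_top_mono)
  show "filterlim (\<lambda>t. qform A x / (norm x)\<^sup>2 * ln t) at_top at_top"
    using x x_nonzero by (intro ln_scaled_at_top) simp
  show "eventually (\<lambda>t. qform A x / (norm x)\<^sup>2 * ln t \<le> op_norm (LINT g:{1..t}|lborel. div_integrand A B g)) at_top"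
    using eventually_ge_at_top[of 1]
  proof eventually_elim
    case (elim t)
    have "qform A x * ln t \<le> op_norm (LINT g:{1..t}|lborel. div_integrand A B g) * (norm x)\<^sup>2"
      by (rule order_trans[OF qform_integral_ge[OF elim] op_norm_ge_qform])
    then show ?case using x_nonzero by (simp add: pos_divide_le_eq)
  qed
qed

text \<open>The form of the integrand at x is nonnegative, so a finite integral over [1, oo) would
  bound all partial integrals, which grow at least like a multiple of ln t.\<close>

lemma not_set_integrable_div_integrand: "\<not> set_integrable lborel {1..} (div_integrand A B)"
proof
  assume i: "set_integrable lborel {1..} (div_integrand A B)"
  note iq = qform_set_integral(1)[OF i, of x]
  define m where "m = (LINT g:{1..}|lborel. qform (div_integrand A B g) x)"
  have bound: "qform A x * ln t \<le> m" if t: "1 \<le> t" for t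
  proof -
    have "qform A x * ln t \<le> (LINT g:{1..t}|lborel. qform (div_integrand A B g) x)"
      using qform_integral_ge[OF t] by (simp only: qform_set_integral(2)[OF set_integrable_div_integrand_Icc])
    also have "\<dots> \<le> m"
      unfolding m_def set_lebesgue_integral_def
    proof (rule integral_mono)
      show "integrable lborel (\<lambda>g. indicator {1..t} g *\<^sub>R qform (div_integrand A B g) x)"
        using qform_set_integral(1)[OF set_integrable_div_integrand_Icc] by (simp add: set_integrable_def)
      show "integrable lborel (\<lambda>g. indicator {1..} g *\<^sub>R qform (div_integrand A B g) x)"
        using iq by (simp add: set_integrable_def)
      show "indicator {1..t} g *\<^sub>R qform (div_integrand A B g) x \<le> indicator {1..} g *\<^sub>R qform (div_integrand A B g) x" for g
        using qform_psd_nonneg[OF psd_div_integrand[OF herm_AB, of g], of x] by (auto simp: indicator_def)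
    qed
    finally show ?thesis .
  qed
  have "eventually (\<lambda>t. m + 1 \<le> qform A x * ln t) at_top"
    using ln_scaled_at_top[OF x(2)] by (simp add: filterlim_at_top)
  then obtain t0 where t0: "\<And>t. t0 \<le> t \<Longrightarrow> m + 1 \<le> qform A x * ln t"
    unfolding eventually_at_top_linorder by blast
  show False using t0[of "max t0 1"] bound[of "max t0 1"] by simp
qed

lemma rel_entropy_infinite: "rel_entropy A B = \<infinity>"
proof -
  have "\<not> range ((*v) A) \<subseteq> range ((*v) B)"
  proof
    assume "range ((*v) A) \<subseteq> range ((*v) B)"
    then obtain y where "A *v x = B *v y" by blast
    then have "cinner x (A *v x) = cinner (B *v x) y" by (simp add: hermitianD[OF herm_AB(2)])
    with x show False by (simp add: qform_def)
  qed
  then show ?thesis by (simp add: rel_entropy_def)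
qed

text \<open>The integral diverges at t = 1 from the right: the form of the negative part at x is at
  least (t - 1) times that of A, so the weight (t - 1)^-2 leaves a multiple of 1 / (t - 1).\<close>

lemma trace_integral_infinite:
  "(\<integral>\<^sup>+ t. ennreal (1 / (\<bar>t\<bar> * (t - 1)\<^sup>2) *
     Re (trace (neg_part ((1 - t) *\<^sub>R A + t *\<^sub>R B)))) \<partial>lborel) = \<infinity>" (is "?I = \<infinity>")
proof (rule ccontr)
  assume fin: "?I \<noteq> \<infinity>"
  \<comment> \<open>The 2 in the denominator accounts for |t| \<le> 2 on the interval (1,
    2].\<close>
  define k where "k = qform A x / (2 * (norm x)\<^sup>2)"
  have k: "0 < k" using x x_nonzero by (simp add: k_def)
  have ge: "k / (t - 1) \<le> 1 / (\<bar>t\<bar> * (t - 1)\<^sup>2) * Re (trace (neg_part ((1 - t) *\<^sub>R A + t *\<^sub>R B)))"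
    if t: "1 < t" "t \<le> 2" for t
  proof -
    define T where "T = (1 - t) *\<^sub>R A + t *\<^sub>R B"
    have hT: "hermitian (- T)" unfolding T_def
      by (intro hermitian_minus hermitian_add hermitian_scaleR herm_AB)
    have qB: "qform B x = 0" using x by (simp add: qform_def)
    have "(t - 1) * qform A x = qform (- T) x"
      unfolding T_def qform_minus qform_add qform_scaleR qB by (simp add: left_diff_distrib)
    also have "\<dots> \<le> qform (neg_part T) x" unfolding neg_part_pos_part by (rule pos_part_ge[OF hT])
    also have "\<dots> \<le> (norm x)\<^sup>2 * Re (trace (neg_part T))"
      unfolding neg_part_pos_part by (rule qform_le_trace[OF psd_pos_part[OF hT]])
    finally have tr: "(t - 1) * (qform A x / (norm x)\<^sup>2) \<le> Re (trace (neg_part T))"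
      using x_nonzero by (simp add: field_simps)
    have "k / (t - 1) = 1 / (2 * (t - 1)\<^sup>2) * ((t - 1) * (qform A x / (norm x)\<^sup>2))"
      using t by (simp add: k_def power2_eq_square)
    also have "\<dots> \<le> 1 / (\<bar>t\<bar> * (t - 1)\<^sup>2) * Re (trace (neg_part T))"
    proof (rule mult_mono[OF _ tr])
      show "1 / (2 * (t - 1)\<^sup>2) \<le> 1 / (\<bar>t\<bar> * (t - 1)\<^sup>2)"
        using t by (intro divide_left_mono mult_right_mono mult_pos_pos) auto
      show "0 \<le> (t - 1) * (qform A x / (norm x)\<^sup>2)" using t x by simp
    qed simp
    finally show ?thesis by (simp add: T_def)
  qed
  obtain r where r: "0 \<le> r" "?I = ennreal r" using fin by (cases ?I) auto
  have bound: "- (k * ln d) \<le> r" if d: "0 < d" "d < 1" for d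
  proof -
    have "(\<integral>\<^sup>+ t. ennreal (k / (t - 1)) * indicator {1 + d..2} t \<partial>lborel) = ennreal (k * ln (2 - 1) - k * ln (1 + d - 1))"
    proof (rule nn_integral_FTC_Icc)
      show "(\<lambda>t::real. k / (t - 1)) \<in> borel_measurable borel" by measurable
      show "((\<lambda>t. k * ln (t - 1)) has_real_derivative k / (t - 1)) (at t)"
        if "t \<in> {1 + d..2}" for t
        using that d by (auto intro!: derivative_eq_intros)
      show "0 \<le> k / (t - 1)" if "t \<in> {1 + d..2}" for t using that d k by simp
    qed (use d in simp)
    then have "ennreal (- (k * ln d)) = (\<integral>\<^sup>+ t. ennreal (k / (t - 1)) * indicator {1 + d..2} t \<partial>lborel)" by simp
    also have "\<dots> \<le> ?I"
    proof (rule nn_integral_mono)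
      fix t :: real
      show "ennreal (k / (t - 1)) * indicator {1 + d..2} t
        \<le> ennreal (1 / (\<bar>t\<bar> * (t - 1)\<^sup>2) * Re (trace (neg_part ((1 - t) *\<^sub>R A + t *\<^sub>R B))))"
      proof (cases "t \<in> {1 + d..2}")
        case True
        then have "1 < t" "t \<le> 2" using d by auto
        from ennreal_leI[OF ge[OF this]] show ?thesis using True by simp
      qed simp
    qed
    finally have "ennreal (- (k * ln d)) \<le> ennreal r" using r by simp
    then show ?thesis using r by (simp add: ennreal_le_iff)
  qed
  \<comment> \<open>For this choice of d the bound reads r + 1 \<le> r.\<close>
  have "- (k * ln (exp (- ((r + 1) / k)))) \<le> r" by (rule bound) (use k r in auto)
  then show False using k by simp
qed

end

text \<open>The dichotomy is decided by whether ker B is contained in ker A: domination implies the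
  inclusion, and \<open>domination\<close> gives the converse.\<close>

theorem theorem1:
  fixes A B :: "complex ^ 'n ^ 'n"
  assumes "psd A" and "psd B"
  shows
    "((\<exists>\<tau>::real. 1 \<le> \<tau> \<and> loewner_le A (\<tau> *\<^sub>R B)) \<longrightarrow>
        psd (div_op A B) \<and>
        set_integrable lborel {1..} (div_integrand A B) \<and>
        div_op A B = (LINT \<gamma>:{1..}|lborel. div_integrand A B \<gamma>)) \<and>
     ((\<nexists>\<tau>::real. 1 \<le> \<tau> \<and> loewner_le A (\<tau> *\<^sub>R B)) \<longrightarrow>
        (\<exists>x. B *v x = 0 \<and> 0 < Re (cinner x (A *v x))) \<and>
        (\<forall>t\<ge>1. set_integrable lborel {1..t} (div_integrand A B) \<and>
                psd (LINT \<gamma>:{1..t}|lborel. div_integrand A B \<gamma>)) \<and>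
        \<not> set_integrable lborel {1..} (div_integrand A B) \<and>
        filterlim (\<lambda>t. op_norm (LINT \<gamma>:{1..t}|lborel. div_integrand A B \<gamma>)) at_top at_top \<and>
        rel_entropy A B = \<infinity> \<and>
        (\<integral>\<^sup>+ t. ennreal (1 / (\<bar>t\<bar> * (t - 1)\<^sup>2) *
             Re (trace (neg_part ((1 - t) *\<^sub>R A + t *\<^sub>R B)))) \<partial>lborel) = \<infinity>)"
proof (intro conjI impI)
  assume "\<exists>\<tau>::real. 1 \<le> \<tau> \<and> loewner_le A (\<tau> *\<^sub>R B)"
  then obtain \<tau> where \<tau>: "\<And>v. qform A v \<le> \<tau> * qform B v"
    using loewner_le_scaled[OF assms] by blast
  \<comment> \<open>From here on only the kernel inclusion is used; a constant for the integrability
    is recovered from it.\<close>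
  have ker: "A *v x = 0" if "B *v x = 0" for x
  proof (rule qform_zero_imp_kernel[OF assms(1)])
    show "qform A x = 0"
      using \<tau>[of x] that qform_psd_nonneg[OF assms(1), of x] by (simp add: qform_def[of B])
  qed
  show i: "set_integrable lborel {1..} (div_integrand A B)"
    by (rule set_integrable_div_integrand_ker[OF assms ker])
  show e: "div_op A B = (LINT \<gamma>:{1..}|lborel. div_integrand A B \<gamma>)"
    using div_op_eq_div_int[OF assms ker] by (simp add: div_int_def)
  show "psd (div_op A B)"
    unfolding e using assms by (intro psd_set_integral[OF i] psd_div_integrand) (auto simp: psd_qform)
next
  assume no: "\<nexists>\<tau>::real. 1 \<le> \<tau> \<and> loewner_le A (\<tau> *\<^sub>R B)"
  have "\<not> (\<forall>x. B *v x = 0 \<longrightarrow> A *v x = 0)"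
  proof
    assume "\<forall>x. B *v x = 0 \<longrightarrow> A *v x = 0"
    then obtain \<tau> where "1 \<le> \<tau>" "\<And>v. qform A v \<le> \<tau> * qform B v"
      using domination[OF assms] by blast
    with no show False using loewner_le_scaled[OF assms] by blast
  qed
  then obtain x where x: "B *v x = 0" "A *v x \<noteq> 0" by blast
  then have "qform A x \<noteq> 0" using qform_zero_imp_kernel[OF assms(1)] by blast
  then have pos: "0 < qform A x" using qform_psd_nonneg[OF assms(1), of x] by simp
  note facts = assms x(1) pos
  show "\<exists>x. B *v x = 0 \<and> 0 < Re (cinner x (A *v x))"
    using x pos by (auto simp: qform_def)
  show "\<forall>t\<ge>1. set_integrable lborel {1..t} (div_integrand A B) \<and>
                psd (LINT \<gamma>:{1..t}|lborel. div_integrand A B \<gamma>)"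
    using set_integrable_div_integrand_Icc[OF facts] psd_integral_Icc[OF facts] by blast
  show "\<not> set_integrable lborel {1..} (div_integrand A B)"
    by (rule not_set_integrable_div_integrand[OF facts])
  show "filterlim (\<lambda>t. op_norm (LINT \<gamma>:{1..t}|lborel. div_integrand A B \<gamma>)) at_top at_top"
    by (rule op_norm_integral_at_top[OF facts])
  show "rel_entropy A B = \<infinity>" by (rule rel_entropy_infinite[OF facts])
  show "(\<integral>\<^sup>+ t. ennreal (1 / (\<bar>t\<bar> * (t - 1)\<^sup>2) *
             Re (trace (neg_part ((1 - t) *\<^sub>R A + t *\<^sub>R B)))) \<partial>lborel) = \<infinity>"
    by (rule trace_integral_infinite[OF facts])
qed

end
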